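(* Let $0<q<1$ with a fixed square root $q^{1/2}$, and let $k\in\mathbb{C}^\times$ be generic. Consider the specialization $(k_1,k_0,l_1,l_0)=(k,1,1,1)$ of the type $(C_1^\vee,C_1)$ parameters. Identify the finite Hecke algebras of type $A_1$ and of type $(C_1^\vee,C_1)$ as linear spaces with common basis $\{1,T_1\}$, and denote this space by $H_0$, so that both bispectral qKZ solution spaces below are subspaces of $H_0^{\mathbb{K}}=\mathbb{K}\otimes H_0$. Then the specialization yields the commutative diagram of injective maps $$\begin{array}{ccc}\mathrm{SOL}_{\mathrm{bqKZ}}^{(C_1^\vee,C_1)}(k,1,1,1,q)&\xrightarrow{\ \chi_+^{(C_1^\vee,C_1)}\ }&\mathrm{SOL}_{\mathrm{bAW}}(k,1,1,1,q)\\ {\scriptstyle \mathrm{sp}}\downarrow& &\downarrow{\scriptstyle \mathrm{sp}}\\ \mathrm{SOL}_{\mathrm{bqKZ}}^{A_1}(k,q)&\xrightarrow{\ \chi_+^{A_1}\ }&\mathrm{SOL}_{\mathrm{bMR}}(k,q)\end{array}$$ in which the vertical maps $\mathrm{sp}$ are the embeddings given by regarding a solution of the specialized type $(C_1^\vee,C_1)$ system as a solution of the type $A_1$ system.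
   Context: Common notation. $\mathbb{K}$ is the field of meromorphic functions of the variables $x,\xi$; $\mathbb{L}=\mathbb{C}[x^{\pm1},\xi^{\pm1}]$; $p_1(z)=z+z^{-1}$. TYPE $A_1$, parameters $k,q^{1/2}\in\mathbb{C}^\times$. (1) $W=\langle s_1,s_0,u\mid s_1^2=s_0^2=u^2=e,\ us_1=s_0u\rangle$ is the extended affine Weyl group, $W_0=\langle s_1\rangle$, $\mathrm{t}(\varpi)=us_1$, $\mathrm{t}(l\varpi)=\mathrm{t}(\varpi)^l$, so $W=W_0\ltimes\mathrm{t}(\mathbb{Z}\varpi)$. $W$ acts on functions of $x$ through $(s_1f)(x)=f(x^{-1})$, $(s_0f)(x)=f(qx^{-1})$, $(uf)(x)=f(q^{1/2}x^{-1})$. (2) The affine Hecke algebra $H(k)$ is generated by $T_1,T_0,U$ with relations $(T_i-k)(T_i+k^{-1})=0$, $U^2=1$, $UT_1=T_0U$; $Y=UT_1$; $H_0=\mathbb{C}+\mathbb{C}T_1$ is the finite Hecke algebra. Let $c(z;k)=\frac{k^{-1}-kz}{1-z}$, $b(z;k)=k-c(z;k)$, $x_1=x^2$, $x_0=qx^{-2}$. The (faithful) basic representation $\rho_{k,q}:H(k)\to\mathrm{End}(\mathbb{C}[x^{\pm1}])$ is $T_i\mapsto c(x_i;k)s_i+b(x_i;k)$, $U\mapsto u$. The double affine Hecke algebra $\mathbb{H}=\mathbb{H}(k,q)$ is the subalgebra of $\mathrm{End}(\mathbb{C}[x^{\pm1}])$ generated by the image of $\rho_{k,q}$ and $X^{\pm1}$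 (multiplication by $x^{\pm1}$). One has $\mathbb{H}\cong\mathbb{C}[X^{\pm1}]\otimes H_0\otimes\mathbb{C}[Y^{\pm1}]$, and a unique anti-involution $*$ of $\mathbb{H}$ with $T_1^*=T_1$, $X^*=Y^{-1}$, $Y^*=X^{-1}$. $\mathbb{H}$ is an $\mathbb{L}$-module by $(f(x)g(\xi))h=f(X)\,h\,g(Y)$, so $\mathbb{H}\cong\mathbb{L}\otimes H_0$ and $H_0^{\mathbb{K}}\cong\mathbb{K}\otimes_{\mathbb{L}}\mathbb{H}$. (3) Put $d_i(x)=k^{-1}-kx_i$. For a reduced expression $w=s_{j_1}\cdots s_{j_r}u^{a}$ ($a\in\{0,1\}$) put $d_w(x)=d_{j_1}\cdot(s_{j_1}d_{j_2})\cdots(s_{j_1}\cdots s_{j_{r-1}}d_{j_r})$ and $\widetilde S_w=d_w(x)\,w\in\mathbb{H}$. $W\times W$ acts on $\mathbb{K}$: the first factor acts on $x$ as in (1); $w'$ in the second factor acts on $\xi$ as $w'^\diamond$ does in (1) with $x$ replaced by $\xi$, where $\diamond$ is the involution of $W$ with $s_1^\diamond=s_1$, $\mathrm{t}(\lambda)^\diamond=\mathrm{t}(-\lambda)$. It acts on $H_0^{\mathbb{K}}$ coefficientwise in the basis $1,T_1$. The maps $h\mapsto\widetilde S_w\,h\,(\widetilde S_{w'})^*$ on $\mathbb{H}$ extend, semilinearly for the action on $\mathbb{K}$, to $H_0^{\mathbb{K}}$; multiplying by $d_w(x)^{-1}d_{w'}(\xi^{-1})^{-1}$ gives a group action $\tau$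 of $W\times W$ on $H_0^{\mathbb{K}}$, and $C_{(w,w')}=\tau(w,w')\,(w,w')^{-1}$ is $\mathbb{K}$-linear, i.e. a $\mathrm{GL}(H_0)$-valued function of $x,\xi$. With $C_{l,m}=C_{(\mathrm{t}(l\varpi),\mathrm{t}(m\varpi))}$, $$\mathrm{SOL}^{A_1}_{\mathrm{bqKZ}}(k,q)=\{f\in H_0^{\mathbb{K}}: C_{l,m}(x,\xi)f(q^{-l}x,q^{m}\xi)=f(x,\xi)\ \ \forall l,m\in\mathbb{Z}\}.$$ (4) Elements of the crossed product of $W\times W$ with $\mathbb{C}(x,\xi)$ are written $\sum_{s\in W_0\times W_0}D_s s$, where each $D_s$ is a combination of elements of $\mathrm{t}(\mathbb{Z}\varpi)\times\mathrm{t}(\mathbb{Z}\varpi)$ with coefficients in $\mathbb{C}(x,\xi)$; $\mathrm{Res}(\sum D_ss)=\sum D_s$. Put $L^x_{p_1}=\mathrm{Res}(\rho^x_{1/k,q}(Y+Y^{-1}))$ and $L^\xi_{p_1}=\mathrm{Res}(\rho^\xi_{k,1/q}(Y+Y^{-1}))$, where $\rho^x_{1/k,q}$ is the basic representation of $H(1/k)$ in the variable $x$ and $\rho^\xi_{k,1/q}$ is the basic representation of $H(k)$ in the variable $\xi$ with $q$ replaced by $q^{-1}$ (realized through the second factor of $W\times W$). Then $$\mathrm{SOL}_{\mathrm{bMR}}(k,q)=\{f\in\mathbb{K}: L^x_{p_1}f=p_1(\xi^{-1})f,\ L^\xi_{p_1}f=p_1(x)f\}.$$ (5) $\chi_+^{A_1}:H_0^{\mathbb{K}}\to\mathbb{K}$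 is the $\mathbb{K}$-linear map with $1\mapsto1$, $T_1\mapsto k$. For $0<q<1$ it restricts to an injective map $\mathrm{SOL}^{A_1}_{\mathrm{bqKZ}}(k,q)\to\mathrm{SOL}_{\mathrm{bMR}}(k,q)$. TYPE $(C_1^\vee,C_1)$, parameters $k_1,k_0,l_1,l_0,q^{1/2}\in\mathbb{C}^\times$; dual parameters $(k_1^*,k_0^*,l_1^*,l_0^* )=(k_1,l_1,k_0,l_0)$ (so $(k,1,1,1)$ is self-dual). (1') $W=\langle s_1,s_0\mid s_1^2=s_0^2=e\rangle$, $W_0=\langle s_1\rangle$, $\mathrm{t}(\epsilon)=s_0s_1$, $\mathrm{t}(l\epsilon)=\mathrm{t}(\epsilon)^l$; $(s_1f)(x)=f(x^{-1})$, $(s_0f)(x)=f(qx^{-1})$. (2') $H(k_1,k_0)$ is generated by $T_1,T_0$ with $(T_i-k_i)(T_i+k_i^{-1})=0$; $Y=T_0T_1$; the finite Hecke algebra is $\mathbb{C}+\mathbb{C}T_1$. With $x_1=x^2$, $x_0=qx^{-2}$, $x_1^{1/2}=x$, $x_0^{1/2}=q^{1/2}x^{-1}$, $c(z;k,l)=k^{-1}\frac{(1-klz^{1/2})(1+kl^{-1}z^{1/2})}{1-z}$, $b=k-c$, the basic representation is $T_i\mapsto c(x_i;k_i,l_i)s_i+b(x_i;k_i,l_i)$. The double affine Hecke algebra is generated by its image and $X^{\pm1}$; the decomposition and $\mathbb{L}$-module structure are as in type $A_1$; the duality anti-involution $*$, from the algebra with parameters $(k_1,k_0,l_1,l_0,q)$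 to the one with parameters $(k_1^*,k_0^*,l_1^*,l_0^*,q)$, is given by $T_1^*=T_1$, $X^*=Y^{-1}$, $Y^*=X^{-1}$. (3') With $d_i(x)=k_i^{-1}(1-k_il_ix_i^{1/2})(1+k_il_i^{-1}x_i^{1/2})$, define $d_w$, $\widetilde S_w$, the $W\times W$-action, $\tau$ and $C_{(w,w')}$ as in type $A_1$ (the factors for the second component taken with dual parameters). With $C_{l,m}=C_{(\mathrm{t}(l\epsilon),\mathrm{t}(m\epsilon))}$, $$\mathrm{SOL}^{(C_1^\vee,C_1)}_{\mathrm{bqKZ}}(k_1,k_0,l_1,l_0,q)=\{f\in H_0^{\mathbb{K}}:C_{l,m}(x,\xi)f(q^{-l}x,q^m\xi)=f(x,\xi)\ \ \forall l,m\in\mathbb{Z}\}.$$ (4') $L^x_{p_1}=\mathrm{Res}(\rho^x(Y+Y^{-1}))$ with $\rho^x$ the basic representation in $x$ with parameters $(1/k_1,1/k_0,1/l_1,1/l_0,q)$, and $L^\xi_{p_1}=\mathrm{Res}(\rho^\xi(Y+Y^{-1}))$ with $\rho^\xi$ the basic representation in $\xi$ with parameters $(k_1^*,k_0^*,l_1^*,l_0^*,q^{-1})$. $\mathrm{SOL}_{\mathrm{bAW}}(k_1,k_0,l_1,l_0,q)$ is the set of $f\in\mathbb{K}$ with $L^x_{p_1}f=p_1(\xi^{-1})f$ and $L^\xi_{p_1}f=p_1(x)f$. (5') $\chi_+^{(C_1^\vee,C_1)}$ is the $\mathbb{K}$-linear map to $\mathbb{K}$ sending $1\mapsto1$ and $T_1$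 to the Hecke parameter of $T_1$: on the finite Hecke algebra with reciprocal parameters $(1/k_1,1/k_0)$ it is $T_1\mapsto k_1^{-1}$, and in this form it is an injective map $\mathrm{SOL}_{\mathrm{bqKZ}}^{(C_1^\vee,C_1)}(1/k_1,1/k_0,1/l_1,1/l_0,q)\to\mathrm{SOL}_{\mathrm{bAW}}(k_1,k_0,l_1,l_0,q)$ for $0<q<1$. In the diagram of the claim the map is written with the same parameters $(k,1,1,1,q)$ on source and target.
   Formalization: In type A_1, q is the step of t(ϖ): u sends x to q/x, s_0 sends x to q²/x, x_0=q²x^{-2}, as the shifts q^{-l}, q^m in SOL_bqKZ require; with u sending x to q^{1/2}/x the right vertical map fails. *)

theory Defs
  imports "HOL-Complex_Analysis.Complex_Analysis" "HOL-Library.Poly_Mapping"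
begin

section \<open>Meromorphic functions of two variables on the complex torus\<close>

definition torus2 :: "(complex \<times> complex) set" where
  "torus2 = (UNIV - {0}) \<times> (UNIV - {0})"

definition holo2 :: "(complex \<times> complex \<Rightarrow> complex) \<Rightarrow> (complex \<times> complex) set \<Rightarrow> bool" where
  "holo2 g V \<longleftrightarrow> (\<forall>z\<in>V. \<exists>a b. (g has_derivative (\<lambda>h. a * fst h + b * snd h)) (at z))"

text \<open>Being a local quotient of holomorphic functions. The values at points where the chosen
  denominator vanishes are irrelevant, so the meromorphic functions proper are classes of such
  functions modulo equality on a dense open set.\<close>

definition mero2 :: "(complex \<times> complex \<Rightarrow> complex) \<Rightarrow> bool" where
  "mero2 F \<longleftrightarrow> (\<forall>p\<in>torus2. \<exists>V g h. open V \<and> p \<in> V \<and> holo2 g V \<and> holo2 h V \<and>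
      interior {z\<in>V. h z = 0} = {} \<and> (\<forall>z\<in>V. h z \<noteq> 0 \<longrightarrow> F z = g z / h z))"

definition generically :: "(complex \<times> complex \<Rightarrow> bool) \<Rightarrow> bool" where
  "generically P \<longleftrightarrow> torus2 \<subseteq> closure (interior {z. P z})"

definition mero2_eq :: "(complex \<times> complex \<Rightarrow> complex) \<Rightarrow> (complex \<times> complex \<Rightarrow> complex) \<Rightarrow> bool" where
  "mero2_eq F G \<longleftrightarrow> mero2 F \<and> mero2 G \<and> generically (\<lambda>z. F z = G z)"

lemma torus2_mem: "z \<in> torus2 \<longleftrightarrow> fst z \<noteq> 0 \<and> snd z \<noteq> 0"
  by (cases z) (auto simp: torus2_def)

lemma open_torus2: "open torus2"
  unfolding torus2_def by (intro open_Times open_Diff) auto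

lemma connected_torus2: "connected torus2"
proof -
  have "connected (UNIV - {0::complex})"
    using connected_punctured_universe[of "0::complex"] by (simp add: Compl_eq_Diff_UNIV)
  then show ?thesis unfolding torus2_def by (rule connected_Times) fact
qed

lemma generically_iff:
  "generically P \<longleftrightarrow>
    (\<forall>U. open U \<longrightarrow> U \<inter> torus2 \<noteq> {} \<longrightarrow> (\<exists>U'. open U' \<and> U' \<noteq> {} \<and> U' \<subseteq> U \<and> (\<forall>z\<in>U'. P z)))"
  (is "_ \<longleftrightarrow> ?R")
proof
  assume g: "generically P"
  show ?R
  proof (intro allI impI)
    fix U :: "(complex \<times> complex) set" assume U: "open U" "U \<inter> torus2 \<noteq> {}"
    then have "U \<inter> closure (interior {z. P z}) \<noteq> {}"
      using g unfolding generically_def by blast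
    then have "U \<inter> interior {z. P z} \<noteq> {}"
      using U(1) open_Int_closure_eq_empty by blast
    then show "\<exists>U'. open U' \<and> U' \<noteq> {} \<and> U' \<subseteq> U \<and> (\<forall>z\<in>U'. P z)"
      using U(1) interior_subset[of "{z. P z}"]
      by (intro exI[of _ "U \<inter> interior {z. P z}"]) auto
  qed
next
  assume R: ?R
  show "generically P"
    unfolding generically_def
  proof
    fix p assume p: "p \<in> torus2"
    show "p \<in> closure (interior {z. P z})"
    proof (rule ccontr)
      assume n: "p \<notin> closure (interior {z. P z})"
      let ?U = "- closure (interior {z. P z})"
      have "open ?U" "?U \<inter> torus2 \<noteq> {}" using n p by auto
      then obtain U' where U': "open U'" "U' \<noteq> {}" "U' \<subseteq> ?U" "\<forall>z\<in>U'. P z"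
        using R by blast
      then have "U' \<subseteq> interior {z. P z}" by (intro interior_maximal) auto
      then show False using U' closure_subset[of "interior {z. P z}"] by blast
    qed
  qed
qed

lemma generically_True: "(\<And>z. P z) \<Longrightarrow> generically P"
  unfolding generically_iff by blast

lemma generically_mp2:
  assumes "generically P" "generically Q" "\<And>z. P z \<Longrightarrow> Q z \<Longrightarrow> R z"
  shows "generically R"
  unfolding generically_iff
proof (intro allI impI)
  fix U :: "(complex \<times> complex) set" assume U: "open U" "U \<inter> torus2 \<noteq> {}"
  then have "open (U \<inter> torus2)" using open_torus2 by auto
  then obtain U1 where U1: "open U1" "U1 \<noteq> {}" "U1 \<subseteq> U \<inter> torus2" "\<forall>z\<in>U1. P z"
    using assms(1)[unfolded generically_iff, rule_format, of "U \<inter> torus2"] U(2) by auto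
  then have "U1 \<inter> torus2 \<noteq> {}" by auto
  then obtain U2 where U2: "open U2" "U2 \<noteq> {}" "U2 \<subseteq> U1" "\<forall>z\<in>U2. Q z"
    using assms(2) U1(1) unfolding generically_iff by meson
  have "U2 \<subseteq> U" using U1(3) U2(3) by blast
  moreover have "\<forall>z\<in>U2. R z" using U1(4) U2(3,4) assms(3) by (meson subsetD)
  ultimately show "\<exists>U'. open U' \<and> U' \<noteq> {} \<and> U' \<subseteq> U \<and> (\<forall>z\<in>U'. R z)"
    using U2(1,2) by (intro exI[of _ U2]) simp
qed

lemma generically_mp: "generically P \<Longrightarrow> (\<And>z. P z \<Longrightarrow> R z) \<Longrightarrow> generically R"
  by (rule generically_mp2[of P P]) auto

lemma holo2_subset: "holo2 g V \<Longrightarrow> W \<subseteq> V \<Longrightarrow> holo2 g W"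
  unfolding holo2_def by blast

lemma holo2_const: "holo2 (\<lambda>_. c) V"
  unfolding holo2_def by (auto intro!: exI[of _ 0])

lemma holo2_fst: "holo2 fst V"
  unfolding holo2_def
proof
  fix z :: "complex \<times> complex"
  have "(fst has_derivative (\<lambda>h. 1 * fst h + 0 * snd h)) (at z)"
    using has_derivative_fst[OF has_derivative_ident] by simp
  then show "\<exists>a b. (fst has_derivative (\<lambda>h. a * fst h + b * snd h)) (at z)" by blast
qed

lemma holo2_snd: "holo2 snd V"
  unfolding holo2_def
proof
  fix z :: "complex \<times> complex"
  have "(snd has_derivative (\<lambda>h. 0 * fst h + 1 * snd h)) (at z)"
    using has_derivative_snd[OF has_derivative_ident] by simp
  then show "\<exists>a b. (snd has_derivative (\<lambda>h. a * fst h + b * snd h)) (at z)" by blast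
qed

lemma holo2_add: "holo2 f V \<Longrightarrow> holo2 g V \<Longrightarrow> holo2 (\<lambda>z. f z + g z) V"
  unfolding holo2_def
proof
  fix z assume *: "\<forall>z\<in>V. \<exists>a b. (f has_derivative (\<lambda>h. a * fst h + b * snd h)) (at z)"
    "\<forall>z\<in>V. \<exists>a b. (g has_derivative (\<lambda>h. a * fst h + b * snd h)) (at z)" "z \<in> V"
  then obtain a b c d where "(f has_derivative (\<lambda>h. a * fst h + b * snd h)) (at z)"
    "(g has_derivative (\<lambda>h. c * fst h + d * snd h)) (at z)" by blast
  from has_derivative_add[OF this]
  show "\<exists>a b. ((\<lambda>z. f z + g z) has_derivative (\<lambda>h. a * fst h + b * snd h)) (at z)"
    by (intro exI[of _ "a + c"] exI[of _ "b + d"]) (simp add: algebra_simps)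
qed

lemma holo2_mult: "holo2 f V \<Longrightarrow> holo2 g V \<Longrightarrow> holo2 (\<lambda>z. f z * g z) V"
  unfolding holo2_def
proof
  fix z assume *: "\<forall>z\<in>V. \<exists>a b. (f has_derivative (\<lambda>h. a * fst h + b * snd h)) (at z)"
    "\<forall>z\<in>V. \<exists>a b. (g has_derivative (\<lambda>h. a * fst h + b * snd h)) (at z)" "z \<in> V"
  then obtain a b c d where "(f has_derivative (\<lambda>h. a * fst h + b * snd h)) (at z)"
    "(g has_derivative (\<lambda>h. c * fst h + d * snd h)) (at z)" by blast
  from has_derivative_mult[OF this]
  show "\<exists>a b. ((\<lambda>z. f z * g z) has_derivative (\<lambda>h. a * fst h + b * snd h)) (at z)"
    by (intro exI[of _ "f z * c + a * g z"] exI[of _ "f z * d + b * g z"])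
      (simp add: algebra_simps)
qed

lemma holo2_continuous: "holo2 f V \<Longrightarrow> continuous_on V f"
  unfolding holo2_def continuous_on_eq_continuous_within
  by (meson has_derivative_continuous continuous_at_imp_continuous_at_within)

lemma holo2_nonzero_open:
  assumes "holo2 f V" "open V" "z \<in> V" "f z \<noteq> 0"
  obtains W where "open W" "z \<in> W" "W \<subseteq> V" "\<forall>w\<in>W. f w \<noteq> 0"
proof -
  have "open (f -` (- {0}) \<inter> V)"
    using continuous_open_preimage[OF holo2_continuous[OF assms(1)] assms(2), of "- {0}"]
    by (simp add: Int_commute open_Compl)
  then show thesis using assms by (intro that[of "f -` (- {0}) \<inter> V"]) auto
qed

lemma interior_zero_iff:
  "interior {z\<in>V. h z = 0} = {} \<longleftrightarrow> (\<forall>U. open U \<longrightarrow> U \<subseteq> V \<longrightarrow> U \<noteq> {} \<longrightarrow> (\<exists>z\<in>U. h z \<noteq> (0::complex)))"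
proof
  assume i: "interior {z\<in>V. h z = 0} = {}"
  show "\<forall>U. open U \<longrightarrow> U \<subseteq> V \<longrightarrow> U \<noteq> {} \<longrightarrow> (\<exists>z\<in>U. h z \<noteq> (0::complex))"
  proof (intro allI impI, rule ccontr)
    fix U assume U: "open U" "U \<subseteq> V" "U \<noteq> {}" "\<not> (\<exists>z\<in>U. h z \<noteq> 0)"
    then have "U \<subseteq> interior {z\<in>V. h z = 0}" by (intro interior_maximal) auto
    then show False using i U by auto
  qed
next
  assume R: "\<forall>U. open U \<longrightarrow> U \<subseteq> V \<longrightarrow> U \<noteq> {} \<longrightarrow> (\<exists>z\<in>U. h z \<noteq> (0::complex))"
  have s: "interior {z\<in>V. h z = 0} \<subseteq> {z\<in>V. h z = 0}" by (rule interior_subset)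
  show "interior {z\<in>V. h z = 0} = {}"
  proof (rule ccontr)
    assume "interior {z\<in>V. h z = 0} \<noteq> {}"
    moreover have "interior {z\<in>V. h z = 0} \<subseteq> V" using s by blast
    ultimately obtain z where "z \<in> interior {z\<in>V. h z = 0}" "h z \<noteq> 0"
      using R open_interior by meson
    then show False using s by blast
  qed
qed

lemma interior_zero_mult:
  assumes "open V" "holo2 g V" "interior {z\<in>V. g z = 0} = {}" "interior {z\<in>V. h z = 0} = {}"
  shows "interior {z\<in>V. g z * h z = (0::complex)} = {}"
  unfolding interior_zero_iff
proof (intro allI impI)
  fix U assume U: "open U" "U \<subseteq> V" "U \<noteq> {}"
  then obtain z where z: "z \<in> U" "g z \<noteq> 0" using assms(3) unfolding interior_zero_iff by blast
  then obtain W where "open W" "z \<in> W" "W \<subseteq> U" "\<forall>w\<in>W. g w \<noteq> 0"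
    using holo2_nonzero_open[OF holo2_subset[OF assms(2) U(2)] U(1)] by blast
  moreover from this obtain w where "w \<in> W" "h w \<noteq> 0"
    using assms(4) U(2) unfolding interior_zero_iff by (metis empty_iff subset_trans)
  ultimately show "\<exists>z\<in>U. g z * h z \<noteq> 0" by (intro bexI[of _ w]) auto
qed

lemma interior_zero_subset:
  "interior {z\<in>V. h z = (0::complex)} = {} \<Longrightarrow> W \<subseteq> V \<Longrightarrow> interior {z\<in>W. h z = 0} = {}"
  unfolding interior_zero_iff by blast

lemma mero2I_holo2: "holo2 g torus2 \<Longrightarrow> mero2 g"
  unfolding mero2_def
proof (intro ballI)
  fix p assume "p \<in> torus2" "holo2 g torus2"
  then show "\<exists>V g' h. open V \<and> p \<in> V \<and> holo2 g' V \<and> holo2 h V \<and>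
      interior {z\<in>V. h z = 0} = {} \<and> (\<forall>z\<in>V. h z \<noteq> 0 \<longrightarrow> g z = g' z / h z)"
    by (intro exI[of _ torus2] exI[of _ g] exI[of _ "\<lambda>_. 1"]) (auto simp: open_torus2 holo2_const)
qed

lemma mero2E:
  assumes "mero2 F" "p \<in> torus2"
  obtains V g h where "open V" "p \<in> V" "holo2 g V" "holo2 h V" "interior {z\<in>V. h z = 0} = {}"
    "\<forall>z\<in>V. h z \<noteq> 0 \<longrightarrow> F z = g z / h z"
  using bspec[OF assms(1)[unfolded mero2_def] assms(2)]
  by (elim exE conjE) (rule that; assumption)

lemma mero2_local2:
  assumes "mero2 F" "mero2 G" "p \<in> torus2"
  obtains V g h g' h' where "open V" "p \<in> V" "holo2 g V" "holo2 h V" "holo2 g' V" "holo2 h' V"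
    "interior {z\<in>V. h z * h' z = 0} = {}"
    "\<forall>z\<in>V. h z \<noteq> 0 \<longrightarrow> F z = g z / h z" "\<forall>z\<in>V. h' z \<noteq> 0 \<longrightarrow> G z = g' z / h' z"
proof -
  obtain V g h where 1: "open V" "p \<in> V" "holo2 g V" "holo2 h V"
    "interior {z\<in>V. h z = 0} = {}" "\<forall>z\<in>V. h z \<noteq> 0 \<longrightarrow> F z = g z / h z"
    by (rule mero2E[OF assms(1,3)])
  obtain V' g' h' where 2: "open V'" "p \<in> V'" "holo2 g' V'" "holo2 h' V'"
    "interior {z\<in>V'. h' z = 0} = {}" "\<forall>z\<in>V'. h' z \<noteq> 0 \<longrightarrow> G z = g' z / h' z"
    by (rule mero2E[OF assms(2,3)])
  let ?V = "V \<inter> V'"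
  have s: "?V \<subseteq> V" "?V \<subseteq> V'" by auto
  have i: "interior {z\<in>?V. h z * h' z = 0} = {}"
    using 1(1) 2(1) by (intro interior_zero_mult holo2_subset[OF 1(4) s(1)]
        interior_zero_subset[OF 1(5) s(1)] interior_zero_subset[OF 2(5) s(2)] open_Int)
  show thesis
    by (rule that[OF open_Int[OF 1(1) 2(1)] _ holo2_subset[OF 1(3) s(1)] holo2_subset[OF 1(4) s(1)]
          holo2_subset[OF 2(3) s(2)] holo2_subset[OF 2(4) s(2)] i])
      (use 1(2,6) 2(2,6) in auto)
qed

lemma mero2_add:
  assumes "mero2 F" "mero2 G" shows "mero2 (\<lambda>z. F z + G z)"
  unfolding mero2_def
proof
  fix p assume p: "p \<in> torus2"
  obtain V g h g' h' where *:
    "open V" "p \<in> V" "holo2 g V" "holo2 h V" "holo2 g' V" "holo2 h' V"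
    "interior {z\<in>V. h z * h' z = 0} = {}"
    "\<forall>z\<in>V. h z \<noteq> 0 \<longrightarrow> F z = g z / h z" "\<forall>z\<in>V. h' z \<noteq> 0 \<longrightarrow> G z = g' z / h' z"
    by (rule mero2_local2[OF assms p])
  show "\<exists>V g h. open V \<and> p \<in> V \<and> holo2 g V \<and> holo2 h V \<and>
      interior {z\<in>V. h z = 0} = {} \<and> (\<forall>z\<in>V. h z \<noteq> 0 \<longrightarrow> F z + G z = g z / h z)"
    using * by (intro exI[of _ V] exI[of _ "\<lambda>z. g z * h' z + g' z * h z"] exI[of _ "\<lambda>z. h z * h' z"])
      (auto intro!: holo2_add holo2_mult simp: add_frac_eq)
qed

lemma mero2_mult:
  assumes "mero2 F" "mero2 G" shows "mero2 (\<lambda>z. F z * G z)"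
  unfolding mero2_def
proof
  fix p assume p: "p \<in> torus2"
  obtain V g h g' h' where *:
    "open V" "p \<in> V" "holo2 g V" "holo2 h V" "holo2 g' V" "holo2 h' V"
    "interior {z\<in>V. h z * h' z = 0} = {}"
    "\<forall>z\<in>V. h z \<noteq> 0 \<longrightarrow> F z = g z / h z" "\<forall>z\<in>V. h' z \<noteq> 0 \<longrightarrow> G z = g' z / h' z"
    by (rule mero2_local2[OF assms p])
  show "\<exists>V g h. open V \<and> p \<in> V \<and> holo2 g V \<and> holo2 h V \<and>
      interior {z\<in>V. h z = 0} = {} \<and> (\<forall>z\<in>V. h z \<noteq> 0 \<longrightarrow> F z * G z = g z / h z)"
    using * by (intro exI[of _ V] exI[of _ "\<lambda>z. g z * g' z"] exI[of _ "\<lambda>z. h z * h' z"])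
      (auto intro!: holo2_mult)
qed

lemma mero2_const: "mero2 (\<lambda>_. c)"
  by (rule mero2I_holo2[OF holo2_const])

lemma mero2_uminus: "mero2 F \<Longrightarrow> mero2 (\<lambda>z. - F z)"
  using mero2_mult[OF mero2_const[of "-1"]] by simp

lemma mero2_diff: "mero2 F \<Longrightarrow> mero2 G \<Longrightarrow> mero2 (\<lambda>z. F z - G z)"
  using mero2_add[OF _ mero2_uminus] by simp

lemma holo2_identity:
  assumes g: "holo2 g V" and V: "open V" "convex V"
    and U: "open U" "U \<noteq> {}" "U \<subseteq> V" "\<forall>z\<in>U. g z = 0"
    and z: "z \<in> V"
  shows "g z = 0"
proof -
  obtain a where a: "a \<in> U" using U by blast
  define d1 d2 where "d1 = fst z - fst a" and "d2 = snd z - snd a"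
  define \<phi> where "\<phi> t = (fst a + t * d1, snd a + t * d2)" for t :: complex
  have cont: "continuous_on UNIV \<phi>" unfolding \<phi>_def by (intro continuous_intros)
  have op: "open (\<phi> -` W)" if "open W" for W
    by (rule open_vimage[OF that cont])
  have "convex (\<phi> -` V)"
  proof (rule convexI)
    fix s t and u v :: real assume h: "s \<in> \<phi> -` V" "t \<in> \<phi> -` V" "0 \<le> u" "0 \<le> v" "u + v = 1"
    have "\<phi> (u *\<^sub>R s + v *\<^sub>R t) = u *\<^sub>R \<phi> s + v *\<^sub>R \<phi> t"
    proof -
      have e: "c = u *\<^sub>R c + v *\<^sub>R c" for c :: complex
        using h(5) by (metis scaleR_left_distrib scaleR_one)
      show ?thesis
        unfolding \<phi>_def using e[of "fst a"] e[of "snd a"] by (simp add: algebra_simps)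
    qed
    then show "u *\<^sub>R s + v *\<^sub>R t \<in> \<phi> -` V" using convexD[OF V(2)] h by auto
  qed
  then have conn: "connected (\<phi> -` V)" by (rule convex_connected)
  have hol: "(g \<circ> \<phi>) holomorphic_on (\<phi> -` V)"
    unfolding holomorphic_on_open[OF op[OF V(1)]]
  proof
    fix t assume "t \<in> \<phi> -` V"
    then obtain b c where D: "(g has_derivative (\<lambda>h. b * fst h + c * snd h)) (at (\<phi> t))"
      using g unfolding holo2_def by blast
    have "(\<phi> has_derivative (\<lambda>h. (h * d1, h * d2))) (at t)"
      unfolding \<phi>_def by (auto intro!: derivative_eq_intros)
    from diff_chain_at[OF this D]
    have "((g \<circ> \<phi>) has_derivative (\<lambda>h. (b * d1 + c * d2) * h)) (at t)"
      by (simp add: o_def algebra_simps)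
    then show "\<exists>f'. ((g \<circ> \<phi>) has_field_derivative f') (at t)"
      unfolding has_field_derivative_def by (auto simp: o_def)
  qed
  have 0: "\<phi> 0 = a" and 1: "\<phi> 1 = z" unfolding \<phi>_def d1_def d2_def by auto
  have lim: "0 islimpt (\<phi> -` U)"
    using 0 a by (intro open_imp_islimpt op U) auto
  have "(g \<circ> \<phi>) 1 = 0"
    using analytic_continuation[OF hol op[OF V(1)] conn _ _ lim, of 1] U 0 1 a z by auto
  then show ?thesis using 1 by simp
qed

lemma mero2_local_ball:
  assumes "mero2 F" "p \<in> torus2"
  obtains V g h where "open V" "p \<in> V" "V \<subseteq> torus2" "holo2 g V" "holo2 h V"
    "interior {z\<in>V. h z = 0} = {}" "\<forall>z\<in>V. h z \<noteq> 0 \<longrightarrow> F z = g z / h z"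
    "interior {z\<in>V. g z = 0} = {} \<or> (\<forall>z\<in>V. g z = 0)"
proof -
  obtain V g h where 1: "open V" "p \<in> V" "holo2 g V" "holo2 h V"
    "interior {z\<in>V. h z = 0} = {}" "\<forall>z\<in>V. h z \<noteq> 0 \<longrightarrow> F z = g z / h z"
    by (rule mero2E[OF assms])
  then obtain r where r: "r > 0" "ball p r \<subseteq> V \<inter> torus2"
    using assms open_torus2 by (metis IntI open_Int openE)
  let ?B = "ball p r"
  have s: "?B \<subseteq> V" "?B \<subseteq> torus2" using r by auto
  have "interior {z\<in>?B. g z = 0} = {} \<or> (\<forall>z\<in>?B. g z = 0)"
    using holo2_identity[OF holo2_subset[OF 1(3) s(1)] open_ball convex_ball]
    unfolding interior_zero_iff by blast
  then show thesis
    by (intro that[of ?B g h] holo2_subset[OF 1(3) s(1)] holo2_subset[OF 1(4) s(1)]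
        interior_zero_subset[OF 1(5) s(1)] s(2)) (use 1(6) r(1) s(1) in auto)
qed

lemma mero2_inverse:
  assumes "mero2 F" shows "mero2 (\<lambda>z. inverse (F z))"
  unfolding mero2_def
proof
  fix p assume p: "p \<in> torus2"
  obtain V g h where *: "open V" "p \<in> V" "V \<subseteq> torus2"
    "holo2 g V" "holo2 h V"
    "interior {z\<in>V. h z = 0} = {}" "\<forall>z\<in>V. h z \<noteq> 0 \<longrightarrow> F z = g z / h z"
    "interior {z\<in>V. g z = 0} = {} \<or> (\<forall>z\<in>V. g z = 0)"
    by (rule mero2_local_ball[OF assms p])
  show "\<exists>V g h. open V \<and> p \<in> V \<and> holo2 g V \<and> holo2 h V \<and>
      interior {z\<in>V. h z = 0} = {} \<and> (\<forall>z\<in>V. h z \<noteq> 0 \<longrightarrow> inverse (F z) = g z / h z)"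
  proof (cases "\<forall>z\<in>V. g z = 0")
    case True
    then show ?thesis using *
      by (intro exI[of _ V] exI[of _ "\<lambda>_. 0"] exI[of _ h]) (auto intro: holo2_const)
  next
    case False
    then have "interior {z\<in>V. g z = 0} = {}" using *(8) by auto
    from interior_zero_mult[OF *(1,4) this *(6)] show ?thesis using *
      by (intro exI[of _ V] exI[of _ "\<lambda>z. h z * h z"] exI[of _ "\<lambda>z. g z * h z"])
        (auto intro!: holo2_mult)
  qed
qed

lemma mero2_zero_or_generically_nonzero:
  assumes F: "mero2 F" and nz: "\<not> generically (\<lambda>z. F z = 0)"
  shows "generically (\<lambda>z. F z \<noteq> 0)"
proof -
  define D where "D P W \<longleftrightarrow> (\<forall>U. open U \<longrightarrow> U \<noteq> {} \<longrightarrow> U \<subseteq> W \<longrightarrow>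
      (\<exists>U'. open U' \<and> U' \<noteq> {} \<and> U' \<subseteq> U \<and> (\<forall>z\<in>U'. P (F z))))"
    for P :: "complex \<Rightarrow> bool" and W :: "(complex \<times> complex) set"
  define A where "A P = \<Union>{W. open W \<and> W \<subseteq> torus2 \<and> D P W}" for P
  have opA: "open (A P)" for P unfolding A_def by (intro open_Union) blast
  have memA: "p \<in> A P \<longleftrightarrow> (\<exists>W. open W \<and> W \<subseteq> torus2 \<and> D P W \<and> p \<in> W)" for p P
    unfolding A_def by (simp only: Union_iff mem_Collect_eq Bex_def conj_assoc)
  have DE: "\<exists>U'. open U' \<and> U' \<noteq> {} \<and> U' \<subseteq> U \<and> (\<forall>z\<in>U'. P (F z))"
    if "D P W" "open U" "U \<noteq> {}" "U \<subseteq> W" for P W U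
    using that(1)[unfolded D_def, rule_format, OF that(2-4)] .
  have gen: "generically (\<lambda>z. P (F z))" if "torus2 \<subseteq> A P" for P
    unfolding generically_iff
  proof (intro allI impI)
    fix U :: "(complex \<times> complex) set" assume U: "open U" "U \<inter> torus2 \<noteq> {}"
    then obtain p where p: "p \<in> U" "p \<in> torus2" by blast
    have "p \<in> A P" using subsetD[OF that p(2)] .
    then obtain W where W: "p \<in> W" "open W" "D P W" unfolding memA by (elim exE conjE)
    have "open (U \<inter> W)" "U \<inter> W \<noteq> {}" "U \<inter> W \<subseteq> W" using U(1) W p(1) by auto
    from DE[OF W(3) this] obtain U' where
      "open U'" "U' \<noteq> {}" "U' \<subseteq> U \<inter> W" "\<forall>z\<in>U'. P (F z)" by (elim exE conjE)
    then show "\<exists>U'. open U' \<and> U' \<noteq> {} \<and> U' \<subseteq> U \<and> (\<forall>z\<in>U'. P (F z))"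
      by (intro exI[of _ U'] conjI) auto
  qed
  have cover: "torus2 \<subseteq> A (\<lambda>c. c = 0) \<union> A (\<lambda>c. c \<noteq> 0)"
  proof
    fix p assume p: "p \<in> torus2"
    obtain V g h where *: "open V" "p \<in> V" "V \<subseteq> torus2"
      "holo2 g V" "holo2 h V"
      "interior {z\<in>V. h z = 0} = {}" "\<forall>z\<in>V. h z \<noteq> 0 \<longrightarrow> F z = g z / h z"
      "interior {z\<in>V. g z = 0} = {} \<or> (\<forall>z\<in>V. g z = 0)"
      by (rule mero2_local_ball[OF F p])
    have dense: "\<exists>U'. open U' \<and> U' \<noteq> {} \<and> U' \<subseteq> U \<and> (\<forall>z\<in>U'. f z \<noteq> 0)"
      if d: "holo2 f V" "interior {z\<in>V. f z = 0} = {}" "open U" "U \<noteq> {}" "U \<subseteq> V" for f U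
    proof -
      obtain z where z: "z \<in> U" "f z \<noteq> 0"
        using d(2)[unfolded interior_zero_iff, rule_format, OF d(3,5,4)] by (elim bexE)
      obtain W where "open W" "z \<in> W" "W \<subseteq> U" "\<forall>w\<in>W. f w \<noteq> 0"
        by (rule holo2_nonzero_open[OF holo2_subset[OF d(1,5)] d(3) z])
      then show ?thesis by (intro exI[of _ W]) auto
    qed
    show "p \<in> A (\<lambda>c. c = 0) \<union> A (\<lambda>c. c \<noteq> 0)"
    proof (cases "\<forall>z\<in>V. g z = 0")
      case True
      have "D (\<lambda>c. c = 0) V"
        unfolding D_def
      proof (intro allI impI)
        fix U assume U: "open U" "U \<noteq> {}" "U \<subseteq> V"
        from dense[OF *(5,6) this] obtain U' where
          "open U'" "U' \<noteq> {}" "U' \<subseteq> U" "\<forall>z\<in>U'. h z \<noteq> 0" by (elim exE conjE)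
        then show "\<exists>U'. open U' \<and> U' \<noteq> {} \<and> U' \<subseteq> U \<and> (\<forall>z\<in>U'. F z = 0)"
          using *(7) True U by (intro exI[of _ U']) (auto simp: subset_eq)
      qed
      then show ?thesis using *(1-3) unfolding Un_iff memA by auto
    next
      case False
      then have "interior {z\<in>V. g z = 0} = {}" using *(8) by auto
      from interior_zero_mult[OF *(1,4) this *(6)]
      have i: "interior {z\<in>V. g z * h z = 0} = {}" .
      have "D (\<lambda>c. c \<noteq> 0) V"
        unfolding D_def
      proof (intro allI impI)
        fix U assume U: "open U" "U \<noteq> {}" "U \<subseteq> V"
        from dense[OF holo2_mult[OF *(4,5)] i this] obtain U' where
          "open U'" "U' \<noteq> {}" "U' \<subseteq> U" "\<forall>z\<in>U'. g z * h z \<noteq> 0" by (elim exE conjE)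
        then show "\<exists>U'. open U' \<and> U' \<noteq> {} \<and> U' \<subseteq> U \<and> (\<forall>z\<in>U'. F z \<noteq> 0)"
          using *(7) U by (intro exI[of _ U']) (auto simp: subset_eq)
      qed
      then show ?thesis using *(1-3) unfolding Un_iff memA by auto
    qed
  qed
  have "A (\<lambda>c. c = 0) \<inter> A (\<lambda>c. c \<noteq> 0) = {}"
  proof (rule ccontr)
    assume "\<not> ?thesis"
    then obtain p where p: "p \<in> A (\<lambda>c. c = 0)" "p \<in> A (\<lambda>c. c \<noteq> 0)" by blast
    obtain W where W: "p \<in> W" "open W" "D (\<lambda>c. c = 0) W" using p(1) unfolding memA by (elim exE conjE)
    obtain W' where W': "p \<in> W'" "open W'" "D (\<lambda>c. c \<noteq> 0) W'" using p(2) unfolding memA by (elim exE conjE)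
    have "open (W \<inter> W')" "W \<inter> W' \<noteq> {}" "W \<inter> W' \<subseteq> W" using W W' by auto
    from DE[OF W(3) this] obtain U where
      U: "open U" "U \<noteq> {}" "U \<subseteq> W \<inter> W'" "\<forall>z\<in>U. F z = 0" by (elim exE conjE)
    have "U \<subseteq> W'" using U(3) by blast
    from DE[OF W'(3) U(1,2) this] obtain U' where
      "U' \<noteq> {}" "U' \<subseteq> U" "\<forall>z\<in>U'. F z \<noteq> 0" by (elim exE conjE)
    then show False using U(4) by blast
  qed
  then have "A (\<lambda>c. c = 0) \<inter> torus2 = {} \<or> A (\<lambda>c. c \<noteq> 0) \<inter> torus2 = {}"
    using connectedD[OF connected_torus2 opA opA _ cover] by blast
  then show ?thesis
  proof
    assume "A (\<lambda>c. c = 0) \<inter> torus2 = {}"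
    then have "torus2 \<subseteq> A (\<lambda>c. c \<noteq> 0)" using cover by blast
    from gen[OF this] show ?thesis .
  next
    assume "A (\<lambda>c. c \<noteq> 0) \<inter> torus2 = {}"
    then have "torus2 \<subseteq> A (\<lambda>c. c = 0)" using cover by blast
    from gen[OF this] nz show ?thesis by blast
  qed
qed

lemma part_equivp_mero2_eq: "part_equivp mero2_eq"
proof (rule part_equivpI)
  show "\<exists>F. mero2_eq F F"
    using mero2_const unfolding mero2_eq_def by (blast intro: generically_True)
  show "symp mero2_eq"
    unfolding mero2_eq_def by (auto intro!: sympI elim!: generically_mp)
  show "transp mero2_eq"
  proof (rule transpI)
    fix F G H assume "mero2_eq F G" "mero2_eq G H"
    then show "mero2_eq F H"
      unfolding mero2_eq_def
      using generically_mp2[of "\<lambda>z. F z = G z" "\<lambda>z. G z = H z" "\<lambda>z. F z = H z"] by simp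
  qed
qed

quotient_type mero = "complex \<times> complex \<Rightarrow> complex" / partial: mero2_eq
  by (rule part_equivp_mero2_eq)

instantiation mero :: field
begin

lift_definition zero_mero :: mero is "\<lambda>_. 0"
  by (simp add: mero2_eq_def mero2_const generically_True)

lift_definition one_mero :: mero is "\<lambda>_. 1"
  by (simp add: mero2_eq_def mero2_const generically_True)

lift_definition plus_mero :: "mero \<Rightarrow> mero \<Rightarrow> mero" is "\<lambda>F G z. F z + G z"
  by (auto simp: mero2_eq_def intro: mero2_add elim: generically_mp2)

lift_definition minus_mero :: "mero \<Rightarrow> mero \<Rightarrow> mero" is "\<lambda>F G z. F z - G z"
  by (auto simp: mero2_eq_def intro: mero2_diff elim: generically_mp2)

lift_definition uminus_mero :: "mero \<Rightarrow> mero" is "\<lambda>F z. - F z"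
  by (auto simp: mero2_eq_def intro: mero2_uminus elim: generically_mp)

lift_definition times_mero :: "mero \<Rightarrow> mero \<Rightarrow> mero" is "\<lambda>F G z. F z * G z"
  by (auto simp: mero2_eq_def intro: mero2_mult elim: generically_mp2)

lift_definition inverse_mero :: "mero \<Rightarrow> mero" is "\<lambda>F z. inverse (F z)"
  by (auto simp: mero2_eq_def intro: mero2_inverse elim: generically_mp)

definition divide_mero :: "mero \<Rightarrow> mero \<Rightarrow> mero" where
  "divide_mero f g = f * inverse g"

instance
proof
  fix a b c :: mero
  show "a * b * c = a * (b * c)"
    by transfer (auto simp: mero2_eq_def mult.assoc intro!: mero2_mult generically_True)
  show "a * b = b * a"
    by transfer (auto simp: mero2_eq_def mult.commute intro!: mero2_mult generically_True)
  show "1 * a = a"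
    by transfer (auto simp: mero2_eq_def intro!: generically_True)
  show "a + b + c = a + (b + c)"
    by transfer (auto simp: mero2_eq_def add.assoc intro!: mero2_add generically_True)
  show "a + b = b + a"
    by transfer (auto simp: mero2_eq_def add.commute intro!: mero2_add generically_True)
  show "0 + a = a"
    by transfer (auto simp: mero2_eq_def intro!: generically_True)
  show "- a + a = 0"
    by transfer (auto simp: mero2_eq_def mero2_const intro!: generically_True)
  show "a - b = a + - b"
    by transfer (auto simp: mero2_eq_def intro!: mero2_diff generically_True)
  show "(a + b) * c = a * c + b * c"
    by transfer (auto simp: mero2_eq_def distrib_right intro!: mero2_mult mero2_add generically_True)
  show "(0::mero) \<noteq> 1"
  proof transfer
    have "(1, 1) \<in> torus2" by (simp add: torus2_mem)
    then show "\<not> mero2_eq (\<lambda>_. 0) (\<lambda>_. 1)" by (auto simp: mero2_eq_def generically_def)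
  qed
  show "a div b = a * inverse b" by (rule divide_mero_def)
  show "inverse (0::mero) = 0"
    by transfer (simp add: mero2_eq_def mero2_const generically_True)
  show "inverse a * a = 1" if "a \<noteq> 0"
    using that
  proof transfer
    fix F assume "mero2_eq F F" "\<not> mero2_eq F (\<lambda>_. 0)"
    then have F: "mero2 F" "\<not> generically (\<lambda>z. F z = 0)"
      by (auto simp: mero2_eq_def mero2_const)
    from mero2_zero_or_generically_nonzero[OF this]
    have "generically (\<lambda>z. inverse (F z) * F z = 1)" by (rule generically_mp) simp
    then show "mero2_eq (\<lambda>z. inverse (F z) * F z) (\<lambda>_. 1)"
      using F(1) by (auto simp: mero2_eq_def mero2_const intro!: mero2_mult mero2_inverse)
  qed
qed

end

lift_definition mconst :: "complex \<Rightarrow> mero" is "\<lambda>c _. c"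
  by (simp add: mero2_eq_def mero2_const generically_True)

lift_definition mx :: mero is fst
  by (simp add: mero2_eq_def mero2I_holo2 holo2_fst generically_True)

lift_definition mxi :: mero is snd
  by (simp add: mero2_eq_def mero2I_holo2 holo2_snd generically_True)

text \<open>Substitution; only used for biholomorphic maps of the torus onto itself.\<close>

definition msubst :: "(complex \<times> complex \<Rightarrow> complex \<times> complex) \<Rightarrow> mero \<Rightarrow> mero" where
  "msubst \<phi> f = abs_mero (rep_mero f \<circ> \<phi>)"


section \<open>The Weyl group and its actions\<close>

text \<open>\<open>Weyl l e\<close> is the element \<open>t(l) s\<^sub>1\<^sup>e\<close> of the semidirect product of \<open>W\<^sub>0\<close> and the translations.
  The same group serves both types; they differ in the generators \<open>s\<^sub>0\<close> and \<open>u\<close> and hence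
  in the notion of reduced expression.\<close>

datatype weyl = Weyl int bool

instantiation weyl :: monoid_mult
begin

definition one_weyl :: weyl where "1 = Weyl 0 False"

fun times_weyl :: "weyl \<Rightarrow> weyl \<Rightarrow> weyl" where
  "Weyl l e * Weyl m e' = Weyl (l + (if e then - m else m)) (e \<noteq> e')"

instance
proof
  fix a b c :: weyl
  show "a * b * c = a * (b * c)" by (cases a; cases b; cases c) auto
  show "1 * a = a" by (cases a) (simp add: one_weyl_def)
  show "a * 1 = a" by (cases a) (simp add: one_weyl_def)
qed

end

abbreviation wt :: "int \<Rightarrow> weyl" where "wt l \<equiv> Weyl l False"
abbreviation ws1 :: weyl where "ws1 \<equiv> Weyl 0 True"
abbreviation ws0_A :: weyl where "ws0_A \<equiv> Weyl 2 True"
abbreviation wu :: weyl where "wu \<equiv> Weyl 1 True"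
abbreviation ws0_C :: weyl where "ws0_C \<equiv> Weyl 1 True"

lemma weyl_relations_A:
  "ws1 * ws1 = 1" "ws0_A * ws0_A = 1" "wu * wu = 1" "wu * ws1 = ws0_A * wu" "wt 1 = wu * ws1"
  by (simp_all add: one_weyl_def)

lemma weyl_relations_C:
  "ws1 * ws1 = 1" "ws0_C * ws0_C = 1" "wt 1 = ws0_C * ws1"
  by (simp_all add: one_weyl_def)

fun winv :: "weyl \<Rightarrow> weyl" where
  "winv (Weyl l e) = Weyl (if e then l else - l) e"

lemma winv: "winv w * w = 1" "w * winv w = 1"
  by (cases w; simp add: one_weyl_def)+

text \<open>The action on functions, where \<open>p\<close> is the step of the translations:
  \<open>(t(l) f)(x) = f(p\<^sup>-\<^sup>l x)\<close> and \<open>(s\<^sub>1 f)(x) = f(x\<^sup>-\<^sup>1)\<close>. The second factor of \<open>W \<times> W\<close> acts on \<open>\<xi>\<close>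
  through \<open>t(m) s\<^sub>1\<^sup>e \<mapsto> t(-m) s\<^sub>1\<^sup>e\<close>.\<close>

fun wact2 :: "complex \<Rightarrow> weyl \<times> weyl \<Rightarrow> mero \<Rightarrow> mero" where
  "wact2 p (Weyl l e, Weyl m e') =
     msubst (\<lambda>(x, \<xi>). ((p powi (- l) * x) powi (if e then -1 else 1),
                       (p powi m * \<xi>) powi (if e' then -1 else 1)))"

type_synonym laurent = "int \<Rightarrow>\<^sub>0 complex"

abbreviation lmon :: "int \<Rightarrow> complex \<Rightarrow> laurent" where
  "lmon n a \<equiv> Poly_Mapping.single n a"

fun wact :: "complex \<Rightarrow> weyl \<Rightarrow> laurent \<Rightarrow> laurent" where
  "wact p (Weyl l e) f = (\<Sum>n\<in>Poly_Mapping.keys f.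
     let s = (if e then -1 else 1) in lmon (s * n) (Poly_Mapping.lookup f n * p powi (- l * s * n)))"

definition laurent_eval :: "laurent \<Rightarrow> mero \<Rightarrow> mero" where
  "laurent_eval f z = (\<Sum>n\<in>Poly_Mapping.keys f. mconst (Poly_Mapping.lookup f n) * z powi n)"


section \<open>Double affine Hecke algebras as operators on Laurent polynomials\<close>

type_synonym op = "laurent \<Rightarrow> laurent"

definition op_add :: "op \<Rightarrow> op \<Rightarrow> op" where "op_add g h = (\<lambda>f. g f + h f)"
definition op_scale :: "complex \<Rightarrow> op \<Rightarrow> op" where "op_scale c h = (\<lambda>f. lmon 0 c * h f)"
definition Xpow :: "int \<Rightarrow> op" where "Xpow n = (\<lambda>f. lmon n 1 * f)"

definition op_pow :: "op \<Rightarrow> int \<Rightarrow> op" where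
  "op_pow h n = (if n \<ge> 0 then h ^^ nat n else inv h ^^ nat (- n))"

inductive_set subalg :: "op set \<Rightarrow> op set" for G where
  "g \<in> G \<Longrightarrow> g \<in> subalg G"
| "id \<in> subalg G"
| "g \<in> subalg G \<Longrightarrow> h \<in> subalg G \<Longrightarrow> op_add g h \<in> subalg G"
| "g \<in> subalg G \<Longrightarrow> op_scale c g \<in> subalg G"
| "g \<in> subalg G \<Longrightarrow> h \<in> subalg G \<Longrightarrow> g \<circ> h \<in> subalg G"

text \<open>The operator \<open>c s + (k - c)\<close> where \<open>c = d / (1 - z)\<close>, with the denominator cleared.\<close>

definition hecke_op :: "complex \<Rightarrow> complex \<Rightarrow> laurent \<Rightarrow> laurent \<Rightarrow> weyl \<Rightarrow> op" where
  "hecke_op p k d z s f =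
     (THE g. (1 - z) * g = d * wact p s f + (lmon 0 k * (1 - z) - d) * f)"

datatype node = I1 | I0

fun word_factor :: "complex \<Rightarrow> (node \<Rightarrow> weyl) \<Rightarrow> (node \<Rightarrow> laurent) \<Rightarrow> node list \<Rightarrow> laurent" where
  "word_factor p s d [] = 1"
| "word_factor p s d (j # js) = d j * wact p (s j) (word_factor p s d js)"

definition reduced_expr :: "(node \<Rightarrow> weyl) \<Rightarrow> weyl set \<Rightarrow> weyl \<Rightarrow> node list \<Rightarrow> bool" where
  "reduced_expr s \<Omega> w js \<longleftrightarrow>
     (\<exists>\<omega>\<in>\<Omega>. w = prod_list (map s js) * \<omega>) \<and>
     (\<forall>js' \<omega>. \<omega> \<in> \<Omega> \<longrightarrow> w = prod_list (map s js') * \<omega> \<longrightarrow> length js \<le> length js')"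

record daha =
  step :: complex
  alg :: "op set"
  T1op :: op
  Yop :: op
  dfac :: "weyl \<Rightarrow> laurent"

subsection \<open>Type \<open>A\<^sub>1\<close>\<close>

text \<open>Normalisation: the argument \<open>q\<close> is the step of the translations, \<open>t(\<varpi>) : x \<mapsto> q\<^sup>-\<^sup>1 x\<close>, as in the
  difference equations \<open>C\<^bsub>l,m\<^esub>(x,\<xi>) f(q\<^sup>-\<^sup>l x, q\<^sup>m \<xi>) = f(x,\<xi>)\<close>. Thus \<open>u : x \<mapsto> q x\<^sup>-\<^sup>1\<close>,
  \<open>s\<^sub>0 : x \<mapsto> q\<^sup>2 x\<^sup>-\<^sup>1\<close> and \<open>x\<^sub>0 = q\<^sup>2 x\<^sup>-\<^sup>2\<close>. The normalisation with \<open>u : x \<mapsto> q\<^sup>1\<^sup>/\<^sup>2 x\<^sup>-\<^sup>1\<close> and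
  \<open>x\<^sub>0 = q x\<^sup>-\<^sup>2\<close> is obtained by using \<open>q\<^sup>1\<^sup>/\<^sup>2\<close> as the argument.\<close>

fun s_A :: "node \<Rightarrow> weyl" where "s_A I1 = ws1" | "s_A I0 = ws0_A"

fun x_A :: "complex \<Rightarrow> node \<Rightarrow> laurent" where
  "x_A q I1 = lmon 2 1"
| "x_A q I0 = lmon (-2) (q^2)"

definition d_A :: "complex \<Rightarrow> complex \<Rightarrow> node \<Rightarrow> laurent" where
  "d_A k q j = lmon 0 (inverse k) - lmon 0 k * x_A q j"

definition T_A :: "complex \<Rightarrow> complex \<Rightarrow> node \<Rightarrow> op" where
  "T_A k q j = hecke_op q k (d_A k q j) (x_A q j) (s_A j)"

definition U_A :: "complex \<Rightarrow> op" where "U_A q = wact q wu"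

definition daha_A :: "complex \<Rightarrow> complex \<Rightarrow> daha" where
  "daha_A k q = \<lparr> step = q,
     alg = subalg {T_A k q I1, T_A k q I0, U_A q, Xpow 1, Xpow (-1)},
     T1op = T_A k q I1,
     Yop = U_A q \<circ> T_A k q I1,
     dfac = (\<lambda>w. word_factor q s_A (d_A k q) (SOME js. reduced_expr s_A {1, wu} w js)) \<rparr>"

subsection \<open>Type \<open>(C\<^sub>1\<^sup>\<or>, C\<^sub>1)\<close>\<close>

text \<open>Here the last argument \<open>r\<close> is the square root \<open>q\<^sup>1\<^sup>/\<^sup>2\<close>; the step of the translations
  is \<open>q = r\<^sup>2\<close>.\<close>

fun s_C :: "node \<Rightarrow> weyl" where "s_C I1 = ws1" | "s_C I0 = ws0_C"

fun x_C_sqrt :: "complex \<Rightarrow> node \<Rightarrow> laurent" where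
  "x_C_sqrt r I1 = lmon 1 1"
| "x_C_sqrt r I0 = lmon (-1) r"

definition d_C :: "complex \<Rightarrow> complex \<Rightarrow> laurent \<Rightarrow> laurent" where
  "d_C k l y = lmon 0 (inverse k) * (1 - lmon 0 (k * l) * y) * (1 + lmon 0 (k / l) * y)"

fun d_CC :: "complex \<Rightarrow> complex \<Rightarrow> complex \<Rightarrow> complex \<Rightarrow> complex \<Rightarrow> node \<Rightarrow> laurent" where
  "d_CC k1 k0 l1 l0 r I1 = d_C k1 l1 (x_C_sqrt r I1)"
| "d_CC k1 k0 l1 l0 r I0 = d_C k0 l0 (x_C_sqrt r I0)"

fun T_C :: "complex \<Rightarrow> complex \<Rightarrow> complex \<Rightarrow> complex \<Rightarrow> complex \<Rightarrow> node \<Rightarrow> op" where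
  "T_C k1 k0 l1 l0 r I1 = hecke_op (r^2) k1 (d_CC k1 k0 l1 l0 r I1) ((x_C_sqrt r I1)^2) (s_C I1)"
| "T_C k1 k0 l1 l0 r I0 = hecke_op (r^2) k0 (d_CC k1 k0 l1 l0 r I0) ((x_C_sqrt r I0)^2) (s_C I0)"

definition daha_C :: "complex \<Rightarrow> complex \<Rightarrow> complex \<Rightarrow> complex \<Rightarrow> complex \<Rightarrow> daha" where
  "daha_C k1 k0 l1 l0 r = \<lparr> step = r^2,
     alg = subalg {T_C k1 k0 l1 l0 r I1, T_C k1 k0 l1 l0 r I0, Xpow 1, Xpow (-1)},
     T1op = T_C k1 k0 l1 l0 r I1,
     Yop = T_C k1 k0 l1 l0 r I0 \<circ> T_C k1 k0 l1 l0 r I1,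
     dfac = (\<lambda>w. word_factor (r^2) s_C (d_CC k1 k0 l1 l0 r) (SOME js. reduced_expr s_C {1} w js)) \<rparr>"


section \<open>The bispectral quantum KZ equations\<close>

text \<open>An element of \<open>H\<^sub>0\<^sup>K\<close> is the pair of its coordinates in the basis \<open>1, T\<^sub>1\<close>.\<close>

type_synonym H0K = "mero \<times> mero"

text \<open>Laurent polynomials in \<open>x, \<xi>\<close>, and their action \<open>(f(x) g(\<xi>)) h = f(X) h g(Y)\<close>.\<close>

type_synonym laurent2 = "(int \<times> int) \<Rightarrow>\<^sub>0 complex"

definition laurent2_act :: "daha \<Rightarrow> laurent2 \<Rightarrow> op \<Rightarrow> op" where
  "laurent2_act D a h = (\<lambda>f. \<Sum>(m, n)\<in>Poly_Mapping.keys a. lmon m (Poly_Mapping.lookup a (m, n)) * h (op_pow (Yop D) n f))"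

definition laurent2_mero :: "laurent2 \<Rightarrow> mero" where
  "laurent2_mero a = (\<Sum>(m, n)\<in>Poly_Mapping.keys a. mconst (Poly_Mapping.lookup a (m, n)) * mx powi m * mxi powi n)"

text \<open>The embedding of the double affine Hecke algebra into \<open>H\<^sub>0\<^sup>K\<close>.\<close>

definition coord :: "daha \<Rightarrow> op \<Rightarrow> H0K" where
  "coord D h = (let (a, b) = (THE (a, b). h = op_add (laurent2_act D a id) (laurent2_act D b (T1op D)))
                in (laurent2_mero a, laurent2_mero b))"

definition Stilde :: "daha \<Rightarrow> weyl \<Rightarrow> op" where
  "Stilde D w = (\<lambda>f. dfac D w * wact (step D) w f)"

text \<open>Since \<open>T\<^sub>1\<close>, \<open>X\<^sup>\<plusminus>\<^sup>1\<close> and \<open>Y\<^sup>\<plusminus>\<^sup>1\<close> generate the algebra, these conditions determine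
  \<open>\<phi>\<close> on it (and make it involutive when \<open>D = D'\<close>).\<close>

definition duality_anti :: "daha \<Rightarrow> daha \<Rightarrow> (op \<Rightarrow> op) \<Rightarrow> bool" where
  "duality_anti D D' \<phi> \<longleftrightarrow>
     bij_betw \<phi> (alg D) (alg D') \<and> \<phi> id = id \<and>
     (\<forall>g\<in>alg D. \<forall>h\<in>alg D. \<phi> (op_add g h) = op_add (\<phi> g) (\<phi> h)) \<and>
     (\<forall>c. \<forall>h\<in>alg D. \<phi> (op_scale c h) = op_scale c (\<phi> h)) \<and>
     (\<forall>g\<in>alg D. \<forall>h\<in>alg D. \<phi> (g \<circ> h) = \<phi> h \<circ> \<phi> g) \<and>
     \<phi> (T1op D) = T1op D' \<and> \<phi> (Xpow 1) = op_pow (Yop D') (-1) \<and> \<phi> (Yop D) = Xpow (-1)"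

definition star :: "daha \<Rightarrow> daha \<Rightarrow> op \<Rightarrow> op" where
  "star D D' = (SOME \<phi>. duality_anti D D' \<phi>)"

definition vscale :: "mero \<Rightarrow> H0K \<Rightarrow> H0K" where "vscale c v = (c * fst v, c * snd v)"

text \<open>In the following \<open>D'\<close> is the algebra with the dual parameters. The semilinear extension of
  \<open>h \<mapsto> S\<^bsub>w\<^esub> h (S\<^bsub>w'\<^esub>)\<^sup>*\<close> is written out on the basis \<open>1, T\<^sub>1\<close>.\<close>

definition tau :: "daha \<Rightarrow> daha \<Rightarrow> weyl \<times> weyl \<Rightarrow> H0K \<Rightarrow> H0K" where
  "tau D D' ww v = (case ww of (w, w') \<Rightarrow>
     let R = (\<lambda>h. coord D (Stilde D w \<circ> h \<circ> star D' D (Stilde D' w')))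
     in vscale (inverse (laurent_eval (dfac D w) mx) * inverse (laurent_eval (dfac D' w') (inverse mxi)))
          (vscale (wact2 (step D) ww (fst v)) (R id)
           + vscale (wact2 (step D) ww (snd v)) (R (T1op D))))"

definition Cmat :: "daha \<Rightarrow> daha \<Rightarrow> weyl \<times> weyl \<Rightarrow> H0K \<Rightarrow> H0K" where
  "Cmat D D' ww v =
     tau D D' ww (map_prod (wact2 (step D) (map_prod winv winv ww)) (wact2 (step D) (map_prod winv winv ww)) v)"

definition mshift :: "complex \<Rightarrow> complex \<Rightarrow> mero \<Rightarrow> mero" where
  "mshift a b = msubst (\<lambda>(x, \<xi>). (a * x, b * \<xi>))"

definition bqKZ_solutions :: "daha \<Rightarrow> daha \<Rightarrow> H0K set" where
  "bqKZ_solutions D D' = {f. \<forall>l m::int.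
     Cmat D D' (wt l, wt m)
       (map_prod (mshift (step D powi (- l)) (step D powi m)) (mshift (step D powi (- l)) (step D powi m)) f)
     = f}"

definition SOL_bqKZ_A :: "complex \<Rightarrow> complex \<Rightarrow> H0K set" where
  "SOL_bqKZ_A k q = bqKZ_solutions (daha_A k q) (daha_A k q)"

definition SOL_bqKZ_C :: "complex \<Rightarrow> complex \<Rightarrow> complex \<Rightarrow> complex \<Rightarrow> complex \<Rightarrow> H0K set" where
  "SOL_bqKZ_C k1 k0 l1 l0 r = bqKZ_solutions (daha_C k1 k0 l1 l0 r) (daha_C k1 l1 k0 l0 r)"


section \<open>The bispectral Macdonald--Ruijsenaars and Askey--Wilson problems\<close>

text \<open>An element of the crossed product is the finitely supported family of its left coefficients.\<close>

type_synonym crossed = "(weyl \<times> weyl) \<Rightarrow>\<^sub>0 mero"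

definition cp_times :: "complex \<Rightarrow> crossed \<Rightarrow> crossed \<Rightarrow> crossed" where
  "cp_times p A B = (\<Sum>(v, v')\<in>Poly_Mapping.keys A. \<Sum>(w, w')\<in>Poly_Mapping.keys B.
     Poly_Mapping.single (v * w, v' * w') (Poly_Mapping.lookup A (v, v') * wact2 p (v, v') (Poly_Mapping.lookup B (w, w'))))"

definition cp_apply :: "complex \<Rightarrow> crossed \<Rightarrow> mero \<Rightarrow> mero" where
  "cp_apply p A f = (\<Sum>w\<in>Poly_Mapping.keys A. Poly_Mapping.lookup A w * wact2 p w f)"

fun wtrans :: "weyl \<Rightarrow> weyl" where "wtrans (Weyl l e) = Weyl l False"

definition Res :: "crossed \<Rightarrow> crossed" where
  "Res A = (\<Sum>(w, w')\<in>Poly_Mapping.keys A. Poly_Mapping.single (wtrans w, wtrans w') (Poly_Mapping.lookup A (w, w')))"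

definition cp_const :: "mero \<Rightarrow> crossed" where "cp_const a = Poly_Mapping.single (1, 1) a"

text \<open>\<open>c s + (k - c)\<close> and its inverse, by the quadratic relation.\<close>

definition cp_T :: "complex \<Rightarrow> mero \<Rightarrow> weyl \<times> weyl \<Rightarrow> crossed" where
  "cp_T k c s = Poly_Mapping.single s c + cp_const (mconst k - c)"

definition cp_T_inv :: "complex \<Rightarrow> mero \<Rightarrow> weyl \<times> weyl \<Rightarrow> crossed" where
  "cp_T_inv k c s = cp_T k c s - cp_const (mconst (k - inverse k))"

definition c_A :: "mero \<Rightarrow> complex \<Rightarrow> mero" where
  "c_A z k = (mconst (inverse k) - mconst k * z) / (1 - z)"

text \<open>\<open>y\<close> stands for \<open>z\<^sup>1\<^sup>/\<^sup>2\<close>.\<close>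

definition c_C :: "mero \<Rightarrow> complex \<Rightarrow> complex \<Rightarrow> mero" where
  "c_C y k l = mconst (inverse k) * ((1 - mconst (k * l) * y) * (1 + mconst (k / l) * y)) / (1 - y^2)"

definition L_x_A :: "complex \<Rightarrow> complex \<Rightarrow> crossed" where
  "L_x_A k q = (let \<kappa> = inverse k; U = Poly_Mapping.single (wu, 1) 1; c = c_A (mx^2) \<kappa>; s = (ws1, 1)
     in Res (cp_times q U (cp_T \<kappa> c s) + cp_times q (cp_T_inv \<kappa> c s) U))"

text \<open>The second factor of \<open>W \<times> W\<close> acts with the inverse step, so \<open>(1, u)\<close> is \<open>\<xi> \<mapsto> q\<^sup>-\<^sup>1 \<xi>\<^sup>-\<^sup>1\<close>.\<close>

definition L_xi_A :: "complex \<Rightarrow> complex \<Rightarrow> crossed" where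
  "L_xi_A k q = (let U = Poly_Mapping.single (1, wu) 1; c = c_A (mxi^2) k; s = (1, ws1)
     in Res (cp_times q U (cp_T k c s) + cp_times q (cp_T_inv k c s) U))"

definition L_x_C :: "complex \<Rightarrow> complex \<Rightarrow> complex \<Rightarrow> complex \<Rightarrow> complex \<Rightarrow> crossed" where
  "L_x_C k1 k0 l1 l0 r =
     (let c1 = c_C mx (1 / k1) (1 / l1); c0 = c_C (mconst r * inverse mx) (1 / k0) (1 / l0);
          s1 = (ws1, 1); s0 = (ws0_C, 1)
      in Res (cp_times (r^2) (cp_T (1 / k0) c0 s0) (cp_T (1 / k1) c1 s1)
            + cp_times (r^2) (cp_T_inv (1 / k1) c1 s1) (cp_T_inv (1 / k0) c0 s0)))"

text \<open>The dual parameters are \<open>(k\<^sub>1, l\<^sub>1, k\<^sub>0, l\<^sub>0)\<close>.\<close>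

definition L_xi_C :: "complex \<Rightarrow> complex \<Rightarrow> complex \<Rightarrow> complex \<Rightarrow> complex \<Rightarrow> crossed" where
  "L_xi_C k1 k0 l1 l0 r =
     (let c1 = c_C mxi k1 k0; c0 = c_C (mconst (inverse r) * inverse mxi) l1 l0;
          s1 = (1, ws1); s0 = (1, ws0_C)
      in Res (cp_times (r^2) (cp_T l1 c0 s0) (cp_T k1 c1 s1)
            + cp_times (r^2) (cp_T_inv k1 c1 s1) (cp_T_inv l1 c0 s0)))"

definition p1 :: "mero \<Rightarrow> mero" where "p1 z = z + inverse z"

definition SOL_bMR :: "complex \<Rightarrow> complex \<Rightarrow> mero set" where
  "SOL_bMR k q = {f. cp_apply q (L_x_A k q) f = p1 (inverse mxi) * f \<and>
                     cp_apply q (L_xi_A k q) f = p1 mx * f}"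

definition SOL_bAW :: "complex \<Rightarrow> complex \<Rightarrow> complex \<Rightarrow> complex \<Rightarrow> complex \<Rightarrow> mero set" where
  "SOL_bAW k1 k0 l1 l0 r = {f. cp_apply (r^2) (L_x_C k1 k0 l1 l0 r) f = p1 (inverse mxi) * f \<and>
                               cp_apply (r^2) (L_xi_C k1 k0 l1 l0 r) f = p1 mx * f}"


section \<open>The maps in the diagram\<close>

text \<open>\<open>k\<close>, respectively \<open>k1\<close>, is the Hecke parameter of \<open>T\<^sub>1\<close> in the source.\<close>

definition chi_A :: "complex \<Rightarrow> H0K \<Rightarrow> mero" where
  "chi_A k v = fst v + mconst k * snd v"

definition chi_C :: "complex \<Rightarrow> H0K \<Rightarrow> mero" where
  "chi_C k1 v = fst v + mconst k1 * snd v"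

text \<open>A solution of the specialised system is regarded, unchanged, as a solution of the other one.\<close>

definition sp :: "'a \<Rightarrow> 'a" where "sp f = f"

end

(*
  At (k,1,1,1) the operator T_0 of type (C_1^vee, C_1) is the reflection x -> q/x, which is U of type A_1.
  So both types give the same double affine Hecke algebra with the same T_1 and Y, and differ only in the
  factors d_w.  These cancel in the cocycle, because d_w w and e_w w have a common multiple e_w d_w w.
  Hence the vertical maps are equalities.

  For the horizontal maps only the two translations of length one matter.  The algebra has the basis
  X^m T_1^e Y^n: it spans by the cross relations, and it is independent by comparing the coefficients of
  x^(N+M) after applying an operator to x^N and x^(-N).  On it the duality is
  X^m T_1^e Y^n -> X^(-n) T_1^e Y^(-m).  The resulting 2x2 systems give, for a solution f = f_0 + f_1 T_1,
  chi(f)(x/q) = (k/xi) f_0 + xi f_1.  With chi(f) = f_0 + k f_1 this determines f, and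
  the second order equation follows after shifting the system once more.
*)
theory Submission
  imports Defs
begin

text \<open>The parameters (k,1,1,1) are self-dual, so both solution spaces have the form
  \<open>bqKZ_solutions D D\<close> over one algebra of operators, and \<open>star\<close> is an
  anti-involution of it. Three ingredients are given only by description or choice, and each needs
  its own argument: the coordinates in \<open>coord\<close> (by independence of the basis), the map
  \<open>star\<close> (one duality is constructed and shown to be the only one on the algebra), and
  the reduced word in \<open>dfac\<close> (any nonzero \<open>e\<close> with \<open>e w\<close> in
  the algebra gives the same cocycle). One eigenvalue argument, \<open>twist_closed_trivial\<close>,
  supplies the nonvanishing throughout. With \<open>q\<close> or \<open>1/q\<close> it shows that a
  Laurent polynomial vanishing along a geometric progression is zero, which gives independence; with
  2 it shows that \<open>x\<close> and \<open>1/\<xi>\<close> are transcendental over the constants,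
  which makes all denominators nonzero in the field of meromorphic functions. The reflection becomes
  a generator because for k_0 = l_0 = 1 the numerator of \<open>c\<close> is \<open>1 - z\<close>
  itself. The maps chi work because the row (K/\<eta>, \<eta>) times the matrix of a basic
  translation is the row (1, K).\<close>

lemma lmon_mult: "lmon m a * lmon n b = lmon (m + n) (a * b)"
  by (rule mult_single)

lemma lookup_single_if: "Poly_Mapping.lookup (Poly_Mapping.single n c) m = (if n = m then c else 0)"
  by (simp add: lookup_single when_def)

lemma poly_mapping_additive_induct [case_names zero single add]:
  fixes f :: "'a \<Rightarrow>\<^sub>0 'b::comm_monoid_add"
  assumes "P 0" "\<And>n c. P (Poly_Mapping.single n c)" "\<And>f g. P f \<Longrightarrow> P g \<Longrightarrow> P (f + g)"
  shows "P f"
proof -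
  have "P (\<Sum>n\<in>A. Poly_Mapping.single n (Poly_Mapping.lookup f n))" if "finite A" for A
    using that by induction (auto intro: assms)
  moreover have "f = (\<Sum>n\<in>Poly_Mapping.keys f. Poly_Mapping.single n (Poly_Mapping.lookup f n))"
    by (rule poly_mapping_eqI)
      (auto simp: lookup_sum lookup_single_if in_keys_iff)
  ultimately show ?thesis by (metis finite_keys)
qed

text \<open>Most identities below are additive in a Laurent polynomial of one or two variables, so a
  check on monomials decides them.\<close>

lemma additive_eqI:
  fixes f :: "'a \<Rightarrow>\<^sub>0 'b::comm_monoid_add" and F G :: "('a \<Rightarrow>\<^sub>0 'b) \<Rightarrow> 'c::ab_group_add"
  assumes "\<And>f g. F (f + g) = F f + F g" "\<And>f g. G (f + g) = G f + G g"
    "\<And>n c. F (Poly_Mapping.single n c) = G (Poly_Mapping.single n c)"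
  shows "F f = G f"
proof (induction f rule: poly_mapping_additive_induct)
  case zero
  have "F 0 = 0" "G 0 = 0"
    using assms(1,2)[of 0 0] by simp_all
  then show ?case by simp
qed (use assms in auto)

lemma lookup_lmon_mult: "Poly_Mapping.lookup (lmon n c * f) m = c * Poly_Mapping.lookup f (m - n)"
  by (rule additive_eqI[where f = f and F = "\<lambda>f. Poly_Mapping.lookup (lmon n c * f) m"
        and G = "\<lambda>f. c * Poly_Mapping.lookup f (m - n)"])
    (auto simp: distrib_left lookup_add lookup_single_if lmon_mult)

section \<open>The Weyl group action on Laurent polynomials\<close>

declare wact.simps [simp del]

lemma wact_add: "wact p w (f + g) = wact p w f + wact p w g"
proof (cases w)
  case (Weyl l e)
  define h :: "int \<Rightarrow> complex \<Rightarrow> laurent" where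
    "h n c = (let s = (if e then -1 else 1) in lmon (s * n) (c * p powi (- l * s * n)))" for n c
  have *: "wact p w f = (\<Sum>n\<in>Poly_Mapping.keys f. h n (Poly_Mapping.lookup f n))" for f
    by (simp add: Weyl h_def wact.simps)
  show ?thesis unfolding *
    by (rule setsum_keys_plus_distrib) (auto simp: h_def Let_def single_add[symmetric] algebra_simps)
qed

lemma wact_lmon: "wact p (Weyl l e) (lmon n c) =
    (if e then lmon (- n) (c * p powi (l * n)) else lmon n (c * p powi (- (l * n))))"
  by (simp add: Let_def wact.simps)

lemma wact_0 [simp]: "wact p w 0 = 0"
  by (cases w) (simp add: wact.simps)

lemma wact_mult:
  assumes "p \<noteq> 0" shows "wact p w (f * g) = wact p w f * wact p w g"
proof (rule additive_eqI[where f = f])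
  fix n c
  show "wact p w (lmon n c * g) = wact p w (lmon n c) * wact p w g"
  proof (rule additive_eqI[where f = g])
    fix m d
    show "wact p w (lmon n c * lmon m d) = wact p w (lmon n c) * wact p w (lmon m d)"
      using assms
      by (cases w) (auto simp: lmon_mult wact_lmon power_int_add power_int_minus power_int_diff distrib_left field_simps)
  qed (auto simp: wact_add distrib_left)
qed (auto simp: wact_add distrib_right)

lemma wact_times:
  assumes "p \<noteq> 0" shows "wact p (v * w) f = wact p v (wact p w f)"
proof (rule additive_eqI[where f = f])
  fix n c
  obtain l e m e' where "v = Weyl l e" "w = Weyl m e'" by (metis weyl.exhaust)
  then show "wact p (v * w) (lmon n c) = wact p v (wact p w (lmon n c))"
    using assms by (auto simp: wact_lmon power_int_add[symmetric] algebra_simps)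
qed (auto simp: wact_add)

lemma wact_one [simp]: "wact p 1 f = f"
  unfolding one_weyl_def
  by (rule additive_eqI[where f = f]) (auto simp: wact_add wact_lmon)

lemma wact_winv: "p \<noteq> 0 \<Longrightarrow> wact p (winv w) (wact p w f) = f" "p \<noteq> 0 \<Longrightarrow> wact p w (wact p (winv w) f) = f"
  by (simp_all add: wact_times[symmetric] winv)

lemma wact_eq_0_iff [simp]: "p \<noteq> 0 \<Longrightarrow> wact p w f = 0 \<longleftrightarrow> f = 0"
  by (metis wact_winv(1) wact_0)

lemma wact_minus: "p \<noteq> 0 \<Longrightarrow> wact p w (f - g) = wact p w f - wact p w g"
  by (metis wact_add diff_add_cancel eq_diff_eq)

lemma wact_const [simp]: "wact p w (lmon 0 c) = lmon 0 c"
  by (cases w) (simp add: wact_lmon)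

lemma wact_1 [simp]: "wact p w 1 = 1"
  using wact_const[of p w 1] by simp

text \<open>The eigenvalue argument: a nonzero element with fewest terms is a monomial.\<close>

lemma twist_closed_trivial:
  fixes S :: "laurent set"
  assumes p: "p \<noteq> 0" "\<And>n::nat. n > 0 \<Longrightarrow> p ^ n \<noteq> 1"
    and S: "\<And>f c. f \<in> S \<Longrightarrow> wact p (wt (- 1)) f - lmon 0 c * f \<in> S"
    and mon: "\<And>n c. lmon n c \<in> S \<Longrightarrow> c = 0"
    and "f \<in> S"
  shows "f = 0"
  using \<open>f \<in> S\<close>
proof (induction "card (Poly_Mapping.keys f)" arbitrary: f rule: less_induct)
  case less
  have lk: "Poly_Mapping.lookup (wact p (wt (- 1)) f) m = Poly_Mapping.lookup f m * p powi m" for f m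
    by (rule additive_eqI[where f = f and F = "\<lambda>f. Poly_Mapping.lookup (wact p (wt (- 1)) f) m"
          and G = "\<lambda>f. Poly_Mapping.lookup f m * p powi m"])
      (simp_all add: wact_add lookup_add distrib_right wact_lmon lookup_single_if)
  show ?case
  proof (rule ccontr)
    assume "f \<noteq> 0"
    then obtain n where n: "n \<in> Poly_Mapping.keys f" by (metis all_not_in_conv keys_eq_empty)
    \<comment> \<open>Subtracting the eigenvalue of \<open>x^n\<close> removes the exponent
      \<open>n\<close> and creates no new one, so \<open>g\<close> has fewer terms. Once
      \<open>g = 0\<close>, all exponents of \<open>f\<close> share one power of \<open>p\<close>,
      and distinct powers differ.\<close>
    define g where "g = wact p (wt (- 1)) f - lmon 0 (p powi n) * f"
    have lg: "Poly_Mapping.lookup g m = Poly_Mapping.lookup f m * (p powi m - p powi n)" for m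
      unfolding g_def lookup_minus lk lookup_lmon_mult by (simp add: algebra_simps)
    have "Poly_Mapping.keys g \<subset> Poly_Mapping.keys f"
      using n lg by (auto simp: in_keys_iff)
    then have "card (Poly_Mapping.keys g) < card (Poly_Mapping.keys f)"
      by (simp add: psubset_card_mono)
    moreover have "g \<in> S" unfolding g_def by (rule S) (rule less)
    ultimately have g0: "g = 0" using less(1) by blast
    have "Poly_Mapping.lookup f m = 0" if "m \<noteq> n" for m
    proof (rule ccontr)
      assume "Poly_Mapping.lookup f m \<noteq> 0"
      with lg[of m] g0 have "p powi m = p powi n" by simp
      then have "p powi (m - n) = 1" "p powi (n - m) = 1" using p(1) by (simp_all add: power_int_diff)
      moreover have "p powi int (nat (abs (m - n))) \<noteq> 1" unfolding power_int_of_nat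
        by (rule p(2)) (use that in simp)
      ultimately show False by (auto simp: abs_if split: if_splits)
    qed
    then have "f = lmon n (Poly_Mapping.lookup f n)"
      by (intro poly_mapping_eqI) (auto simp: lookup_single_if)
    with mon[of n "Poly_Mapping.lookup f n"] less(2) n show False
      by (simp add: in_keys_iff)
  qed
qed

section \<open>Demazure-Lusztig operators\<close>

text \<open>Laurent polynomials form an integral domain, so \<open>1 - z\<close> cancels and
  exhibiting one quotient settles the description in \<open>hecke_op\<close>.\<close>

lemma hecke_opI:
  assumes "z \<noteq> 1" "(1 - z) * g = d * wact p s f + (lmon 0 k * (1 - z) - d) * f"
  shows "hecke_op p k d z s f = g"
  unfolding hecke_op_def
proof (rule the_equality)
  fix h assume "(1 - z) * h = d * wact p s f + (lmon 0 k * (1 - z) - d) * f"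
  with assms show "h = g" by (metis mult_left_cancel right_minus_eq)
qed (rule assms)

lemma lmon_neq_1: "n \<noteq> 0 \<Longrightarrow> lmon n c \<noteq> 1"
  by (metis keys_one keys_single insertI1 insert_not_empty singletonD)

text \<open>This is why Demazure-Lusztig operators preserve Laurent polynomials: the denominator of
  \<open>c\<close> only has to divide differences \<open>s f - f\<close>.\<close>

lemma reflection_diff_dvd: "1 - lmon 2 1 dvd wact p ws1 f - f"
proof (induction f rule: poly_mapping_additive_induct)
  case (single n c)
  have nat: "1 - lmon 2 1 dvd lmon (- int m) 1 - lmon (int m) (1::complex)" for m
  proof (induction m)
    case (Suc m)
    \<comment> \<open>Insert \<open>x^(m-1)\<close>: the first difference is \<open>x^(-1)\<close>
      times the previous one, the second is visibly a multiple of \<open>1 - x^2\<close>.\<close>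
    have "lmon (- int (Suc m)) 1 - lmon (int (Suc m)) (1::complex) =
        lmon (- 1) 1 * (lmon (- int m) 1 - lmon (int m) 1) + (1 - lmon 2 1) * lmon (int m - 1) 1"
      by (simp add: algebra_simps lmon_mult)
    then show ?case using Suc by (metis dvd_add dvd_mult dvd_triv_left)
  qed simp
  have "1 - lmon 2 1 dvd lmon (- n) 1 - lmon n (1::complex)"
    using nat[of "nat n"] nat[of "nat (- n)"]
    by (cases "n \<ge> 0") (simp_all, metis dvd_minus_iff minus_diff_eq)
  then have "1 - lmon 2 1 dvd lmon 0 c * (lmon (- n) 1 - lmon n (1::complex))" by (rule dvd_mult)
  then show ?case by (simp add: wact_lmon algebra_simps lmon_mult)
next
  case (add f g)
  have "wact p ws1 (f + g) - (f + g) = (wact p ws1 f - f) + (wact p ws1 g - g)"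
    by (simp add: wact_add)
  then show ?case using add by (metis dvd_add)
qed simp

text \<open>Used with \<open>a = k\<close>, \<open>b = 1/k\<close>, \<open>z = x^2\<close>, where
  \<open>g\<close> is the divided difference of \<open>f\<close>; it passes from the division-free
  form of the operator to the one with cleared denominator.\<close>

lemma lusztig_identity:
  fixes a b z f f' g t :: "'a::comm_ring_1"
  shows "t = (b - a * z) * g + a * f \<Longrightarrow> f' = f + (1 - z) * g \<Longrightarrow> (1 - z) * t = (b - a * z) * f' + (a - b) * f"
  by (hypsubst, simp add: algebra_simps)

text \<open>Read \<open>y = 1/x\<close>, \<open>f' = s f\<close>, \<open>t = T f\<close>,
  \<open>t' = s (T f)\<close>. After substitution the terms in \<open>f'\<close> cancel, and those
  in \<open>f\<close> cancel by \<open>(b - a z)(b - a w) - (a - b)^2 = (1 - z)(1 - w)\<close> for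
  \<open>z w = a b = 1\<close>.\<close>

lemma quadratic_identity:
  fixes x y a b f f' t t' :: "'a::idom"
  assumes "x * y = 1" "a * b = 1"
    "(1 - x * x) * t = (b - a * x * x) * f' + (a - b) * f"
    "(1 - y * y) * t' = (b - a * y * y) * f + (a - b) * f'"
  shows "(1 - y * y) * ((1 - x * x) * (f + (a - b) * t)) =
    (1 - y * y) * ((b - a * x * x) * t' + (a - b) * t)"
proof -
  have zw: "(x * x) * (y * y) = 1" using assms(1) by algebra
  have "(1 - y * y) * ((b - a * x * x) * t' + (a - b) * t) - (1 - y * y) * ((1 - x * x) * (f + (a - b) * t))
      = (b - a * x * x) * ((1 - y * y) * t') - (a - b) * (1 - x * x) * t
        - (1 - y * y) * (1 - x * x) * f + (a - b) * (1 - (x * x) * (y * y)) * t"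
    by (simp add: algebra_simps)
  also have "\<dots> = (b - a * x * x) * ((b - a * y * y) * f + (a - b) * f')
      - (a - b) * ((b - a * x * x) * f' + (a - b) * f) - (1 - y * y) * (1 - x * x) * f"
    unfolding assms(3)[symmetric] assms(4)[symmetric] zw by (simp add: algebra_simps)
  also have "\<dots> = ((b - a * x * x) * (b - a * y * y) - (a - b) * (a - b) - (1 - y * y) * (1 - x * x)) * f"
    by (simp add: algebra_simps)
  also have "(b - a * x * x) * (b - a * y * y) - (a - b) * (a - b) - (1 - y * y) * (1 - x * x) = 0"
    using zw assms(2) by algebra
  finally show ?thesis by (metis mult_zero_left right_minus_eq)
qed

text \<open>The same scalar identity as for the quadratic relation; the mixed term is brought to the
  common factor through \<open>(1 - y^2) x = - y (1 - x^2)\<close>.\<close>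

lemma cross_identity:
  fixes x y a b f f' t t' :: "'a::idom"
  assumes "x * y = 1" "a * b = 1"
    "(1 - x * x) * t = (b - a * x * x) * f' + (a - b) * f"
    "(1 - y * y) * t' = (b - a * y * y) * f + (a - b) * f'"
  shows "(1 - y * y) * ((1 - x * x) * (y * f)) =
    (1 - y * y) * ((b - a * x * x) * (y * t') + (a - b) * (x * t))"
proof -
  have zw: "(x * x) * (y * y) = 1" using assms(1) by algebra
  have "(1 - y * y) * ((b - a * x * x) * (y * t') + (a - b) * (x * t))
      = (b - a * x * x) * y * ((1 - y * y) * t') + (a - b) * ((1 - y * y) * x) * t"
    by (simp add: algebra_simps)
  also have "(1 - y * y) * x = - y * (1 - x * x)" using assms(1) by algebra
  also have "(b - a * x * x) * y * ((1 - y * y) * t') + (a - b) * (- y * (1 - x * x)) * t =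
      (b - a * x * x) * y * ((b - a * y * y) * f + (a - b) * f')
      - (a - b) * y * ((b - a * x * x) * f' + (a - b) * f)"
    unfolding assms(3)[symmetric] assms(4) by (simp add: algebra_simps)
  also have "\<dots> = y * f * ((b - a * x * x) * (b - a * y * y) - (a - b) * (a - b))"
    by (simp add: algebra_simps)
  also have "(b - a * x * x) * (b - a * y * y) - (a - b) * (a - b) = (1 - y * y) * (1 - x * x)"
    using zw assms(2) by algebra
  finally show ?thesis by (simp only: ac_simps)
qed

section \<open>The rank one algebra: generators and relations\<close>

locale rank_one_daha =
  fixes q k :: complex
  assumes q0: "q \<noteq> 0" and k0: "k \<noteq> 0" and not_root: "\<And>n::nat. n > 0 \<Longrightarrow> q ^ n \<noteq> 1"
begin

abbreviation \<kappa> :: laurent where "\<kappa> \<equiv> lmon 0 (k - inverse k)"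
abbreviation x :: laurent where "x \<equiv> lmon 1 1"
abbreviation xi :: laurent where "xi \<equiv> lmon (- 1) 1"
abbreviation T :: op where "T \<equiv> T_A k q I1"
abbreviation U :: op where "U \<equiv> U_A q"
definition Y :: op where "Y f = U (T f)"
text \<open>This is \<open>T^(-1) U\<close>, the inverse of \<open>Y = U T\<close>, with
  \<open>T^(-1) = T - \<kappa>\<close> from the quadratic relation.\<close>

definition Yi :: op where "Yi f = T (U f) - \<kappa> * U f"

lemma x_xi: "x * xi = 1" "xi * x = 1" by (simp_all add: lmon_mult)

lemma lmon2: "lmon 2 c = lmon 0 c * x * x" "lmon (-2) c = lmon 0 c * xi * xi"
  by (simp_all add: lmon_mult)

lemma one_minus_x2: "1 - x * x \<noteq> 0" "1 - xi * xi \<noteq> 0"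
  using lmon_neq_1[of 2 1] lmon_neq_1[of "-2" 1] by (simp_all add: lmon_mult)

lemma kki: "lmon 0 k * lmon 0 (inverse k) = 1" "\<kappa> = lmon 0 k - lmon 0 (inverse k)"
  using k0 by (simp_all add: lmon_mult single_diff)

abbreviation s :: op where "s \<equiv> wact q ws1"

lemma s_x [simp]: "s x = xi" "s xi = x"
  by (simp_all add: wact_lmon)

lemma s_s [simp]: "s (s f) = f"
  using wact_times[OF q0, of ws1 ws1 f] weyl_relations_A(1) by simp

lemma s_mult: "s (f * g) = s f * s g" and s_add: "s (f + g) = s f + s g" and s_minus: "s (f - g) = s f - s g"
  by (simp_all only: wact_mult[OF q0] wact_add wact_minus[OF q0])

text \<open>The coefficient of \<open>f\<close> is constant because
  \<open>k (1 - x^2) - (1/k - k x^2) = k - 1/k\<close>. This form replaces \<open>hecke_op\<close>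
  from here on.\<close>

lemma T_char: "(1 - x * x) * T f = (lmon 0 (inverse k) - lmon 0 k * x * x) * s f + \<kappa> * f"
proof -
  obtain g where g: "wact q ws1 f - f = (1 - lmon 2 1) * g" using reflection_diff_dvd by blast
  have "T f = (lmon 0 (inverse k) - lmon 0 k * lmon 2 1) * g + lmon 0 k * f"
    unfolding T_A_def
  proof (rule hecke_opI)
    show "x_A q I1 \<noteq> 1" by (simp add: lmon_neq_1)
    have "wact q ws1 f = f + (1 - lmon 2 1) * g" using g by (metis add.commute diff_add_cancel)
    then show "(1 - x_A q I1) * ((lmon 0 (inverse k) - lmon 0 k * lmon 2 1) * g + lmon 0 k * f) =
      d_A k q I1 * wact q (s_A I1) f + (lmon 0 k * (1 - x_A q I1) - d_A k q I1) * f"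
      by (simp only: d_A_def x_A.simps s_A.simps) (simp add: algebra_simps)
  qed
  moreover have "s f = f + (1 - lmon 2 1) * g" using g by (metis add.commute diff_add_cancel)
  moreover have "lmon 2 1 = x * x" by (simp add: lmon_mult)
  ultimately show ?thesis unfolding kki(2) mult.assoc by (metis lusztig_identity)
qed

lemma T_unique: "(1 - x * x) * g = (lmon 0 (inverse k) - lmon 0 k * x * x) * s f + \<kappa> * f \<Longrightarrow> T f = g"
  using T_char[of f] one_minus_x2 by (metis mult_left_cancel)

lemma T_add: "T (f + g) = T f + T g"
proof (rule T_unique)
  show "(1 - x * x) * (T f + T g) = (lmon 0 (inverse k) - lmon 0 k * x * x) * s (f + g) + \<kappa> * (f + g)"
    unfolding s_add distrib_left T_char by (simp add: ac_simps)
qed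

lemma T_const: "T (lmon 0 c * f) = lmon 0 c * T f"
proof (rule T_unique)
  have "(1 - x * x) * (lmon 0 c * T f) = lmon 0 c * ((1 - x * x) * T f)" by (simp only: ac_simps)
  then show "(1 - x * x) * (lmon 0 c * T f) =
      (lmon 0 (inverse k) - lmon 0 k * x * x) * s (lmon 0 c * f) + \<kappa> * (lmon 0 c * f)"
    unfolding T_char s_mult by (simp add: algebra_simps)
qed

lemma sT_char: "(1 - xi * xi) * s (T f) = (lmon 0 (inverse k) - lmon 0 k * xi * xi) * f + \<kappa> * s f"
  using arg_cong[OF T_char[of f], of s] by (simp add: s_mult s_add s_minus)

lemma T_sq: "T (T f) = f + \<kappa> * T f"
proof (rule T_unique)
  \<comment> \<open>\<open>s (T f)\<close> is known only through its multiple by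
    \<open>1 - xi * xi\<close>, so this factor is carried along and cancelled at the end.\<close>
  have "(1 - xi * xi) * ((1 - x * x) * (f + \<kappa> * T f)) =
      (1 - xi * xi) * ((lmon 0 (inverse k) - lmon 0 k * x * x) * s (T f) + \<kappa> * T f)"
    unfolding kki(2)
    by (rule quadratic_identity[OF x_xi(1) kki(1) T_char[unfolded kki(2)] sT_char[unfolded kki(2)]])
  then show "(1 - x * x) * (f + \<kappa> * T f) = (lmon 0 (inverse k) - lmon 0 k * x * x) * s (T f) + \<kappa> * T f"
    using one_minus_x2 by (metis mult_left_cancel)
qed

text \<open>The cross relation \<open>T X T = X^(-1)\<close>; together with the quadratic relation
  it moves \<open>T\<close> past every power of \<open>X\<close>.\<close>

lemma T_x_T: "T (x * T f) = xi * f"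
proof (rule T_unique)
  have "(1 - xi * xi) * ((1 - x * x) * (xi * f)) =
      (1 - xi * xi) * ((lmon 0 (inverse k) - lmon 0 k * x * x) * (xi * s (T f)) + \<kappa> * (x * T f))"
    unfolding kki(2)
    by (rule cross_identity[OF x_xi(1) kki(1) T_char[unfolded kki(2)] sT_char[unfolded kki(2)]])
  then show "(1 - x * x) * (xi * f) = (lmon 0 (inverse k) - lmon 0 k * x * x) * s (x * T f) + \<kappa> * (x * T f)"
    using one_minus_x2 by (metis mult_left_cancel s_mult s_x(1))
qed

lemma U_add: "U (f + g) = U f + U g" and U_mult: "U (f * g) = U f * U g" and U_minus: "U (f - g) = U f - U g"
  and U_const [simp]: "U (lmon 0 c) = lmon 0 c"
  and U_lmon: "U (lmon n c) = lmon (- n) (c * q powi n)"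
  by (simp_all add: U_A_def wact_mult[OF q0] wact_add wact_minus[OF q0] wact_lmon)

lemma U_U [simp]: "U (U f) = f"
  unfolding U_A_def using wact_times[OF q0, of wu wu f] weyl_relations_A(3) by simp

lemma T_minus: "T (f - g) = T f - T g"
  by (metis T_add diff_add_cancel eq_diff_eq)

lemma Y_Yi [simp]: "Y (Yi f) = f"
  by (simp add: Y_def Yi_def T_minus T_const T_sq)

lemma Yi_Y [simp]: "Yi (Y f) = f"
  by (simp add: Y_def Yi_def T_sq)

lemma Y_add: "Y (f + g) = Y f + Y g" and Y_const: "Y (lmon 0 c * f) = lmon 0 c * Y f"
  by (simp_all add: Y_def T_add U_add T_const U_mult)

lemma Yi_add: "Yi (f + g) = Yi f + Yi g" and Yi_const: "Yi (lmon 0 c * f) = lmon 0 c * Yi f"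
  by (simp_all add: Yi_def T_add U_add T_const U_mult right_diff_distrib distrib_left mult.left_commute)

lemma T_Yi: "T (Yi f) = U f"
  by (simp add: Yi_def T_minus T_const T_sq)

end

section \<open>The Poincare-Birkhoff-Witt basis\<close>

lemma additive_expand:
  fixes F :: "laurent \<Rightarrow> complex"
  assumes "\<And>f g. F (f + g) = F f + F g" "\<And>n c. F (lmon n c) = c * F (lmon n 1)"
  shows "F f = (\<Sum>j\<in>Poly_Mapping.keys f. Poly_Mapping.lookup f j * F (lmon j 1))"
proof (rule additive_eqI[where f = f and F = F
      and G = "\<lambda>f. \<Sum>j\<in>Poly_Mapping.keys f. Poly_Mapping.lookup f j * F (lmon j 1)"])
  fix n c
  have "F 0 = 0" using assms(1)[of 0 0] by simp
  then show "F (lmon n c) = (\<Sum>j\<in>Poly_Mapping.keys (lmon n c). Poly_Mapping.lookup (lmon n c) j * F (lmon j 1))"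
    using assms(2)[of n c] by simp
next
  fix f g :: laurent
  show "(\<Sum>j\<in>Poly_Mapping.keys (f + g). Poly_Mapping.lookup (f + g) j * F (lmon j 1)) =
      (\<Sum>j\<in>Poly_Mapping.keys f. Poly_Mapping.lookup f j * F (lmon j 1)) +
      (\<Sum>j\<in>Poly_Mapping.keys g. Poly_Mapping.lookup g j * F (lmon j 1))"
    by (rule setsum_keys_plus_distrib) (simp_all add: distrib_right)
qed (rule assms)

definition laurent_at :: "complex \<Rightarrow> laurent \<Rightarrow> complex" where
  "laurent_at z g = (\<Sum>n\<in>Poly_Mapping.keys g. Poly_Mapping.lookup g n * z powi n)"

lemma laurent_at_add: "laurent_at z (f + g) = laurent_at z f + laurent_at z g"
  unfolding laurent_at_def by (rule setsum_keys_plus_distrib) (auto simp: distrib_right)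

lemma laurent_at_lmon [simp]: "laurent_at z (lmon n c) = c * z powi n"
  by (simp add: laurent_at_def)

lemma laurent_at_const_mult: "laurent_at z (lmon 0 c * g) = c * laurent_at z g"
  by (rule additive_eqI[where f = g and F = "\<lambda>g. laurent_at z (lmon 0 c * g)" and G = "\<lambda>g. c * laurent_at z g"])
    (auto simp: laurent_at_add distrib_left lmon_mult)

lemma laurent_at_twist: "laurent_at z (wact p (wt (- 1)) g) = laurent_at (p * z) g"
  by (rule additive_eqI[where f = g and F = "\<lambda>g. laurent_at z (wact p (wt (- 1)) g)" and G = "laurent_at (p * z)"])
    (auto simp: laurent_at_add wact_add wact_lmon power_int_mult_distrib)

lemma laurent_at_diff: "laurent_at z (f - g) = laurent_at z f - laurent_at z g"
  by (metis laurent_at_add diff_add_cancel eq_diff_eq)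

text \<open>Vanishing at all \<open>c p^N\<close> with \<open>N \<ge> 1\<close> survives the
  substitution \<open>z \<mapsto> p z\<close>, which only moves \<open>N\<close> to
  \<open>N + 1\<close>. Hence the eigenvalue argument applies, and a monomial is already excluded by
  \<open>N = 1\<close>.\<close>

lemma laurent_at_geometric_zero:
  assumes p: "p \<noteq> 0" "\<And>n::nat. n > 0 \<Longrightarrow> p ^ n \<noteq> 1" and "c \<noteq> 0"
    and zero: "\<And>N. N \<ge> 1 \<Longrightarrow> laurent_at (c * p ^ N) g = 0"
  shows "g = 0"
proof (rule twist_closed_trivial[OF p, where S = "{g. \<forall>N\<ge>1. laurent_at (c * p ^ N) g = 0}"])
  fix f d assume f: "f \<in> {g. \<forall>N\<ge>1. laurent_at (c * p ^ N) g = 0}"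
  have "laurent_at (c * p ^ N) (wact p (wt (- 1)) f - lmon 0 d * f) = 0" if "N \<ge> 1" for N
    using that f[simplified, rule_format, of N] f[simplified, rule_format, of "Suc N"]
    by (simp add: laurent_at_diff laurent_at_twist laurent_at_const_mult mult.left_commute)
  then show "wact p (wt (- 1)) f - lmon 0 d * f \<in> {g. \<forall>N\<ge>1. laurent_at (c * p ^ N) g = 0}" by simp
next
  fix n d assume "lmon n d \<in> {g. \<forall>N\<ge>1. laurent_at (c * p ^ N) g = 0}"
  then have "laurent_at (c * p ^ 1) (lmon n d) = 0" by blast
  then show "d = 0" using p \<open>c \<noteq> 0\<close> by simp
next
  show "g \<in> {g. \<forall>N\<ge>1. laurent_at (c * p ^ N) g = 0}"
  proof (intro CollectI allI impI)
    fix N :: nat assume "1 \<le> N"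
    then show "laurent_at (c * p ^ N) g = 0" by (rule zero)
  qed
qed

context rank_one_daha
begin

abbreviation Yp :: "int \<Rightarrow> op" where "Yp n \<equiv> op_pow Y n"

lemma inv_Y: "inv Y = Yi"
  by (rule inv_equality) simp_all

lemma Yp_simps [simp]: "Yp 0 f = f" "Yp 1 f = Y f" "Yp (- 1) f = Yi f"
  by (simp_all add: op_pow_def inv_Y)

lemma Yp_Suc: "Yp (n + 1) f = Y (Yp n f)"
proof (cases "n \<ge> 0")
  case True
  then have "nat (n + 1) = Suc (nat n)" by simp
  then show ?thesis using True by (simp add: op_pow_def)
next
  case False
  then obtain m where m: "- n = int (Suc m)" by (metis not_le zero_less_imp_eq_int neg_0_less_iff_less gr0_implies_Suc)
  then have n: "n = - int (Suc m)" by simp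
  show ?thesis unfolding n by (cases m) (simp_all add: op_pow_def inv_Y nat_add_distrib)
qed

lemma Yp_pred: "Yp (n - 1) f = Yi (Yp n f)"
  using Yp_Suc[of "n - 1" f] by simp

lemma Yp_add: "Yp (m + n) f = Yp m (Yp n f)"
proof (induction m rule: int_induct[where k = 0])
  case (step1 i)
  then show ?case by (metis Yp_Suc add.assoc add.commute)
next
  case (step2 i)
  then show ?case by (metis Yp_pred diff_add_eq)
qed simp

lemma Yp_plus: "Yp n (f + g) = Yp n f + Yp n g"
proof (induction n rule: int_induct[where k = 0])
qed (simp_all add: Yp_Suc Yp_pred Y_add Yi_add)

lemma Yp_const: "Yp n (lmon 0 c * f) = lmon 0 c * Yp n f"
proof (induction n rule: int_induct[where k = 0])
qed (simp_all add: Yp_Suc Yp_pred Y_const Yi_const)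

lemma T_x: "T (x * f) = xi * T f - \<kappa> * (xi * f)"
proof -
  have "T (T f - \<kappa> * f) = f" by (simp add: T_minus T_const T_sq)
  then have "T (x * f) = T (x * T (T f - \<kappa> * f))" by simp
  also have "\<dots> = xi * (T f - \<kappa> * f)" by (rule T_x_T)
  finally show ?thesis by (simp add: algebra_simps)
qed

lemma T_xi: "T (xi * f) = x * T f + \<kappa> * (xi * f)"
  using T_sq[of "x * T f"] by (simp add: T_x_T)

lemma T_one: "T 1 = lmon 0 k"
  by (rule T_unique) (simp add: kki algebra_simps)

lemma lmon_Suc: "lmon (m + 1) c = x * lmon m c" "lmon (m - 1) c = xi * lmon m c"
  by (simp_all add: lmon_mult add.commute)

section \<open>Extreme coefficients under T, U and Y\<close>

definition deg_le :: "nat \<Rightarrow> laurent \<Rightarrow> bool" where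
  "deg_le N f \<longleftrightarrow> (\<forall>j. abs j > int N \<longrightarrow> Poly_Mapping.lookup f j = 0)"

lemma deg_le_keys: "deg_le N f \<Longrightarrow> j \<in> Poly_Mapping.keys f \<Longrightarrow> abs j \<le> int N"
  unfolding deg_le_def in_keys_iff by force

text \<open>The asymmetry matters: \<open>T\<close> sends \<open>x^n\<close> with
  \<open>n > 0\<close> to exponents from \<open>-n\<close> to \<open>n - 1\<close>, whereas the
  image of \<open>x^(-n)\<close> does contain \<open>x^n\<close>. This will separate the terms with
  \<open>T\<close> from those without.\<close>

lemma T_lmon_pos:
  "(abs j > int n \<or> (j = int n \<and> n > 0) \<longrightarrow> Poly_Mapping.lookup (T (lmon (int n) 1)) j = 0) \<and>
    (j = - int n \<longrightarrow> Poly_Mapping.lookup (T (lmon (int n) 1)) j = (if n = 0 then k else inverse k))"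
proof (induction n arbitrary: j)
  case (Suc n)
  have "T (lmon (int (Suc n)) 1) = xi * T (lmon (int n) 1) - \<kappa> * lmon (int n - 1) 1"
    using T_x[of "lmon (int n) 1"] by (simp add: lmon_Suc(1)[symmetric] lmon_Suc(2)[symmetric] add.commute)
  then have "Poly_Mapping.lookup (T (lmon (int (Suc n)) 1)) j =
      Poly_Mapping.lookup (T (lmon (int n) 1)) (j + 1) - (k - inverse k) * (if int n - 1 = j then 1 else 0)"
    by (simp add: lookup_minus lookup_lmon_mult lookup_single_if)
  with Suc[of "j + 1"] show ?case by auto
qed (use T_one in \<open>auto simp: lookup_single_if\<close>)

lemma T_lmon_neg:
  "(abs j > int n \<longrightarrow> Poly_Mapping.lookup (T (lmon (- int n) 1)) j = 0) \<and>
    (j = int n \<longrightarrow> Poly_Mapping.lookup (T (lmon (- int n) 1)) j = k)"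
proof (induction n arbitrary: j)
  case (Suc n)
  have "T (lmon (- int (Suc n)) 1) = x * T (lmon (- int n) 1) + \<kappa> * lmon (- int n - 1) 1"
    using T_xi[of "lmon (- int n) 1"] by (simp add: lmon_mult algebra_simps minus_diff_commute)
  then have "Poly_Mapping.lookup (T (lmon (- int (Suc n)) 1)) j =
      Poly_Mapping.lookup (T (lmon (- int n) 1)) (j - 1) + (k - inverse k) * (if - int n - 1 = j then 1 else 0)"
    by (simp add: lookup_add lookup_lmon_mult lookup_single_if)
  with Suc[of "j - 1"] show ?case by auto
qed (use T_one in \<open>auto simp: lookup_single_if\<close>)

lemma lookup_T_expand:
  "Poly_Mapping.lookup (T f) i = (\<Sum>j\<in>Poly_Mapping.keys f. Poly_Mapping.lookup f j * Poly_Mapping.lookup (T (lmon j 1)) i)"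
proof (rule additive_expand)
  fix n c
  have "T (lmon n c) = lmon 0 c * T (lmon n 1)" by (simp add: T_const[symmetric] lmon_mult)
  then show "Poly_Mapping.lookup (T (lmon n c)) i = c * Poly_Mapping.lookup (T (lmon n 1)) i"
    by (simp add: lookup_lmon_mult)
qed (simp add: T_add lookup_add)

lemma T_lmon_outside:
  assumes "abs j \<le> int N" "abs i \<ge> int N" "abs i = int N \<longrightarrow> abs j < int N"
  shows "Poly_Mapping.lookup (T (lmon j 1)) i = 0"
proof (cases "j \<ge> 0")
  case True
  with assms show ?thesis using T_lmon_pos[of "nat j" i] by (auto split: if_splits)
next
  case False
  with assms show ?thesis using T_lmon_neg[of "nat (- j)" i] by (auto split: if_splits)
qed

lemma deg_le_T: "deg_le N f \<Longrightarrow> deg_le N (T f)"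
  unfolding deg_le_def[of N "T f"] lookup_T_expand[of f]
  by (auto intro!: sum.neutral T_lmon_outside[of _ N] dest!: deg_le_keys)

lemma top_T:
  assumes "deg_le N f" "N > 0"
  shows "Poly_Mapping.lookup (T f) (int N) = k * Poly_Mapping.lookup f (- int N)"
    and "Poly_Mapping.lookup f (- int N) = 0 \<Longrightarrow>
      Poly_Mapping.lookup (T f) (- int N) = inverse k * Poly_Mapping.lookup f (int N)"
proof -
  have "Poly_Mapping.lookup (T f) (int N) = (\<Sum>j\<in>Poly_Mapping.keys f. if j = - int N then Poly_Mapping.lookup f (- int N) * k else 0)"
    unfolding lookup_T_expand[of f]
  proof (rule sum.cong)
    fix j assume j: "j \<in> Poly_Mapping.keys f"
    then have "abs j < int N \<or> j = int N \<or> j = - int N" using deg_le_keys[OF assms(1) j] by auto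
    then show "Poly_Mapping.lookup f j * Poly_Mapping.lookup (T (lmon j 1)) (int N) =
        (if j = - int N then Poly_Mapping.lookup f (- int N) * k else 0)"
      using T_lmon_outside[of j N "int N"] T_lmon_pos[of N "int N"] T_lmon_neg[of N "int N"] assms(2)
      by (auto split: if_splits)
  qed simp
  then show "Poly_Mapping.lookup (T f) (int N) = k * Poly_Mapping.lookup f (- int N)"
    by (auto simp: in_keys_iff)
  assume 0: "Poly_Mapping.lookup f (- int N) = 0"
  have "Poly_Mapping.lookup (T f) (- int N) = (\<Sum>j\<in>Poly_Mapping.keys f. if j = int N then Poly_Mapping.lookup f (int N) * inverse k else 0)"
    unfolding lookup_T_expand[of f]
  proof (rule sum.cong)
    fix j assume j: "j \<in> Poly_Mapping.keys f"
    then have "j \<noteq> - int N" using 0 by (metis in_keys_iff)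
    then have "abs j < int N \<or> j = int N" using deg_le_keys[OF assms(1) j] by auto
    then show "Poly_Mapping.lookup f j * Poly_Mapping.lookup (T (lmon j 1)) (- int N) =
        (if j = int N then Poly_Mapping.lookup f (int N) * inverse k else 0)"
      using T_lmon_outside[of j N "- int N"] T_lmon_pos[of N "- int N"] assms(2)
      by (auto split: if_splits)
  qed simp
  then show "Poly_Mapping.lookup (T f) (- int N) = inverse k * Poly_Mapping.lookup f (int N)"
    by (auto simp: in_keys_iff)
qed

lemma lookup_U: "Poly_Mapping.lookup (U f) j = Poly_Mapping.lookup f (- j) * q powi (- j)"
  by (rule additive_eqI[where f = f and F = "\<lambda>f. Poly_Mapping.lookup (U f) j"
        and G = "\<lambda>f. Poly_Mapping.lookup f (- j) * q powi (- j)"])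
    (auto simp: U_add lookup_add U_lmon lookup_single_if distrib_right)

lemma deg_le_U: "deg_le N f \<Longrightarrow> deg_le N (U f)"
  unfolding deg_le_def lookup_U by auto

lemma deg_le_Y: "deg_le N f \<Longrightarrow> deg_le N (Y f)"
  unfolding Y_def by (intro deg_le_U deg_le_T)

lemma deg_le_Yi: "deg_le N f \<Longrightarrow> deg_le N (Yi f)"
  using deg_le_T[OF deg_le_U[of N f]] deg_le_U[of N f]
  unfolding Yi_def deg_le_def lookup_minus lookup_lmon_mult by simp

text \<open>On the extreme exponents \<open>Y\<close> is triangular with diagonal entries
  \<open>k q^N\<close> at \<open>x^(-N)\<close> and the inverse at \<open>x^N\<close>. The image of
  \<open>x^(-N)\<close> may contain \<open>x^N\<close>, hence the vanishing condition in the second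
  claim.\<close>

lemma bottom_Y:
  assumes "deg_le N f" "N > 0"
  shows "Poly_Mapping.lookup (Y f) (- int N) = k * q ^ N * Poly_Mapping.lookup f (- int N)"
    and "Poly_Mapping.lookup f (- int N) = 0 \<Longrightarrow>
      Poly_Mapping.lookup (Y f) (int N) = inverse (k * q ^ N) * Poly_Mapping.lookup f (int N)"
  using top_T[OF assms] by (simp_all add: Y_def lookup_U power_int_minus)

lemma deg_le_Yp: "deg_le N f \<Longrightarrow> deg_le N (Yp n f)"
proof (induction n rule: int_induct[where k = 0])
qed (simp_all add: Yp_Suc Yp_pred deg_le_Y deg_le_Yi)

lemma kqN: "k * q ^ N \<noteq> 0" using k0 q0 by simp

lemma bottom_Yp:
  assumes "deg_le N f" "N > 0"
  shows "Poly_Mapping.lookup (Yp n f) (- int N) = (k * q ^ N) powi n * Poly_Mapping.lookup f (- int N)"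
proof (induction n rule: int_induct[where k = 0])
  case (step1 i)
  then show ?case using bottom_Y(1)[OF deg_le_Yp[OF assms(1)] assms(2), of i] kqN[of N]
    by (simp add: Yp_Suc power_int_add mult.commute)
next
  case (step2 i)
  then show ?case using bottom_Y(1)[OF deg_le_Yp[OF assms(1)] assms(2), of "i - 1"] kqN[of N]
    by (simp add: Yp_Suc[symmetric] power_int_diff field_simps)
qed simp

lemma top_Yp:
  assumes "deg_le N f" "N > 0" "Poly_Mapping.lookup f (- int N) = 0"
  shows "Poly_Mapping.lookup (Yp n f) (int N) = (inverse k * inverse q ^ N) powi n * Poly_Mapping.lookup f (int N)"
proof -
  have 0: "Poly_Mapping.lookup (Yp i f) (- int N) = 0" for i
    using bottom_Yp[OF assms(1,2)] assms(3) by simp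
  have inv: "inverse k * inverse q ^ N = inverse (k * q ^ N)" by (simp add: power_inverse)
  show ?thesis unfolding inv
  proof (induction n rule: int_induct[where k = 0])
    case (step1 i)
    then show ?case using bottom_Y(2)[OF deg_le_Yp[OF assms(1)] assms(2) 0, of i] kqN[of N]
      by (simp add: Yp_Suc power_int_add mult.commute)
  next
    case (step2 i)
    then show ?case using bottom_Y(2)[OF deg_le_Yp[OF assms(1)] assms(2) 0, of "i - 1"] kqN[of N]
      by (simp add: Yp_Suc[symmetric] power_int_diff field_simps)
  qed simp
qed


section \<open>Linear independence of the products X^m T^e Y^n\<close>

definition act :: "laurent2 \<Rightarrow> op \<Rightarrow> op" where
  "act a h f = (\<Sum>(m, n)\<in>Poly_Mapping.keys a. lmon m (Poly_Mapping.lookup a (m, n)) * h (Yp n f))"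

lemma act_plus: "act (a + b) h f = act a h f + act b h f"
  unfolding act_def case_prod_beta prod.collapse
  using setsum_keys_plus_distrib[of "\<lambda>z c. lmon (fst z) c * h (Yp (snd z) f)" a b]
  by (simp add: single_add distrib_right)

lemma act_single [simp]: "act (Poly_Mapping.single (m, n) c) h f = lmon m c * h (Yp n f)"
  by (simp add: act_def)

lemma act_0 [simp]: "act 0 h f = 0"
  by (simp add: act_def)

lemma act_uminus: "act (- a) h f = - act a h f"
  using act_plus[of a "- a" h f] by (simp add: eq_neg_iff_add_eq_0 add.commute)

lemma act_minus: "act (a - b) h f = act a h f - act b h f"
  using act_plus[of a "- b" h f] by (simp add: act_uminus)

text \<open>The coefficient of \<open>x^M\<close>, as a Laurent polynomial in
  \<open>\<xi>\<close>.\<close>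

definition top_slice :: "int \<Rightarrow> laurent2 \<Rightarrow> laurent" where
  "top_slice M a = Poly_Mapping.map_key (\<lambda>n. (M, n)) a"

lemma lookup_top_slice [simp]: "Poly_Mapping.lookup (top_slice M a) n = Poly_Mapping.lookup a (M, n)"
  by (simp add: top_slice_def map_key.rep_eq inj_on_def)

text \<open>A term with \<open>m < M\<close> would need the exponent \<open>N + M - m > N\<close> of
  an operand supported in \<open>[-N, N]\<close>. Only the slice \<open>m = M\<close> contributes,
  and the powers \<open>z powi n\<close> assemble to its value at \<open>z\<close>.\<close>

lemma lookup_act_top:
  assumes "\<And>m n. (m, n) \<in> Poly_Mapping.keys a \<Longrightarrow> m \<le> M" "\<And>n. deg_le N (h (Yp n f))"
    and "\<And>n. Poly_Mapping.lookup (h (Yp n f)) (int N) = c * z powi n"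
  shows "Poly_Mapping.lookup (act a h f) (int N + M) = c * laurent_at z (top_slice M a)"
proof -
  have "Poly_Mapping.lookup (act a h f) (int N + M) =
      (\<Sum>p\<in>Poly_Mapping.keys a. Poly_Mapping.lookup a p * Poly_Mapping.lookup (h (Yp (snd p) f)) (int N + M - fst p))"
    unfolding act_def lookup_sum case_prod_beta prod.collapse lookup_lmon_mult ..
  also have "\<dots> = (\<Sum>p\<in>Pair M ` Poly_Mapping.keys (top_slice M a).
      Poly_Mapping.lookup a p * Poly_Mapping.lookup (h (Yp (snd p) f)) (int N + M - fst p))"
  proof (rule sum.mono_neutral_right)
    show "\<forall>p\<in>Poly_Mapping.keys a - Pair M ` Poly_Mapping.keys (top_slice M a).
        Poly_Mapping.lookup a p * Poly_Mapping.lookup (h (Yp (snd p) f)) (int N + M - fst p) = 0"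
    proof
      fix p assume p: "p \<in> Poly_Mapping.keys a - Pair M ` Poly_Mapping.keys (top_slice M a)"
      obtain m n where mn: "p = (m, n)" by force
      with p have "m \<le> M" "m \<noteq> M" using assms(1) by (auto simp: in_keys_iff)
      then have "Poly_Mapping.lookup (h (Yp n f)) (int N + M - m) = 0"
        using assms(2)[of n] unfolding deg_le_def by auto
      then show "Poly_Mapping.lookup a p * Poly_Mapping.lookup (h (Yp (snd p) f)) (int N + M - fst p) = 0"
        by (simp add: mn)
    qed
  qed (auto simp: in_keys_iff)
  also have "\<dots> = c * laurent_at z (top_slice M a)"
    by (subst sum.reindex) (simp_all add: inj_on_def laurent_at_def assms(3) sum_distrib_left ac_simps)
  finally show ?thesis .
qed

lemma act_unique_0:
  assumes "\<And>f. act a id f + act b T f = 0"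
  shows "a = 0 \<and> b = 0"
proof (rule ccontr)
  define S where "S = fst ` (Poly_Mapping.keys a \<union> Poly_Mapping.keys b)"
  define M where "M = Max S"
  assume "\<not> ?thesis"
  then have ne: "S \<noteq> {}" unfolding S_def by simp
  have fin: "finite S" unfolding S_def by simp
  have le: "(m, n) \<in> Poly_Mapping.keys a \<Longrightarrow> m \<le> M" "(m, n) \<in> Poly_Mapping.keys b \<Longrightarrow> m \<le> M" for m n
    unfolding M_def by (rule Max_ge[OF fin], force simp: S_def)+
  have q': "inverse q \<noteq> 0" "\<And>n::nat. n > 0 \<Longrightarrow> inverse q ^ n \<noteq> 1"
    using q0 not_root by (auto simp: power_inverse)
  have pos: "deg_le N (lmon (int N) 1)" "deg_le N (lmon (- int N) 1)" for N
    by (auto simp: deg_le_def lookup_single_if)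
  have a0: "top_slice M a = 0"
  proof (rule laurent_at_geometric_zero[OF q', of "inverse k"])
    fix N :: nat assume N: "1 \<le> N"
    let ?f = "lmon (int N) 1"
    have 1: "Poly_Mapping.lookup (act a id ?f) (int N + M) = 1 * laurent_at (inverse k * inverse q ^ N) (top_slice M a)"
      by (rule lookup_act_top[OF le(1)])
        (use N top_Yp[OF pos(1), of N] deg_le_Yp[OF pos(1)] in \<open>auto simp: lookup_single_if\<close>)
    \<comment> \<open>\<open>Y^n x^N\<close> has no \<open>x^(-N)\<close> term, so \<open>T\<close>
      of it has no \<open>x^N\<close> term: the part with \<open>T\<close> is invisible here. Hence
      \<open>c = 0\<close>, with 1 as a dummy point.\<close>
    have 2: "Poly_Mapping.lookup (act b T ?f) (int N + M) = 0 * laurent_at 1 (top_slice M b)"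
      by (rule lookup_act_top[OF le(2)])
        (use N top_T(1)[OF deg_le_Yp[OF pos(1)], of N] bottom_Yp[OF pos(1), of N] deg_le_T[OF deg_le_Yp[OF pos(1)]]
          in \<open>auto simp: lookup_single_if\<close>)
    show "laurent_at (inverse k * inverse q ^ N) (top_slice M a) = 0"
      using arg_cong[OF assms[of ?f], of "\<lambda>g. Poly_Mapping.lookup g (int N + M)"] 1 2 by (simp add: lookup_add)
  qed (use k0 in auto)
  have b0: "top_slice M b = 0"
  proof (rule laurent_at_geometric_zero[OF q0 not_root, of k])
    fix N :: nat assume N: "1 \<le> N"
    let ?f = "lmon (- int N) 1"
    \<comment> \<open>On \<open>x^(-N)\<close> both parts could reach the exponent
      \<open>N + M\<close>; the slice of \<open>a\<close> must therefore be known to vanish before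
      \<open>b\<close> is tested.\<close>
    have lt: "(m, n) \<in> Poly_Mapping.keys a \<Longrightarrow> m \<le> M - 1" for m n
      using le(1)[of m n] arg_cong[OF a0, of "\<lambda>g. Poly_Mapping.lookup g n"] by (cases "m = M") (auto simp: in_keys_iff)
    have 1: "Poly_Mapping.lookup (act a id ?f) (int N + M) = 0"
    proof -
      have "Poly_Mapping.lookup (id (Yp n ?f)) (int N + M - m) = 0" if "(m, n) \<in> Poly_Mapping.keys a" for m n
        using deg_le_Yp[OF pos(2), of N n] lt[OF that] unfolding deg_le_def by simp
      then show ?thesis unfolding act_def lookup_sum case_prod_beta lookup_lmon_mult
        by (intro sum.neutral) auto
    qed
    have 2: "Poly_Mapping.lookup (act b T ?f) (int N + M) = k * laurent_at (k * q ^ N) (top_slice M b)"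
      by (rule lookup_act_top[OF le(2)])
        (use N top_T(1)[OF deg_le_Yp[OF pos(2)], of N] bottom_Yp[OF pos(2), of N] deg_le_T[OF deg_le_Yp[OF pos(2)]]
          in \<open>auto simp: lookup_single_if\<close>)
    show "laurent_at (k * q ^ N) (top_slice M b) = 0"
      using arg_cong[OF assms[of ?f], of "\<lambda>g. Poly_Mapping.lookup g (int N + M)"] 1 2 k0 by (simp add: lookup_add)
  qed (use k0 in auto)
  have "M \<in> S" unfolding M_def by (rule Max_in[OF fin ne])
  then have "\<exists>n. (M, n) \<in> Poly_Mapping.keys a \<or> (M, n) \<in> Poly_Mapping.keys b"
    unfolding S_def by auto
  then obtain n where "(M, n) \<in> Poly_Mapping.keys a \<or> (M, n) \<in> Poly_Mapping.keys b" by (elim exE)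
  then have "Poly_Mapping.lookup a (M, n) \<noteq> 0 \<or> Poly_Mapping.lookup b (M, n) \<noteq> 0"
    by (simp add: in_keys_iff)
  then show False
    using arg_cong[OF a0, of "\<lambda>g. Poly_Mapping.lookup g n"] arg_cong[OF b0, of "\<lambda>g. Poly_Mapping.lookup g n"] by simp
qed

lemma act_unique:
  assumes "op_add (act a id) (act b T) = op_add (act a' id) (act b' T)"
  shows "a = a'" "b = b'"
proof -
  have "act (a - a') id f + act (b - b') T f = 0" for f
    using fun_cong[OF assms, of f] by (simp add: op_add_def act_minus algebra_simps)
  from act_unique_0[OF this] show "a = a'" "b = b'" by auto
qed

section \<open>The products X^m T^e Y^n span the algebra\<close>

definition pbw :: "int \<Rightarrow> bool \<Rightarrow> int \<Rightarrow> op" where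
  "pbw m e n f = lmon m 1 * (if e then T (Yp n f) else Yp n f)"

inductive_set pbw_span :: "op set" where
  "pbw m e n \<in> pbw_span"
| "g \<in> pbw_span \<Longrightarrow> h \<in> pbw_span \<Longrightarrow> op_add g h \<in> pbw_span"
| "g \<in> pbw_span \<Longrightarrow> op_scale c g \<in> pbw_span"

abbreviation algA :: "op set" where "algA \<equiv> subalg {T, U, Xpow 1, Xpow (- 1)}"

lemma linear_closure_induct [consumes 1, case_names pbw add scale]:
  assumes "h \<in> pbw_span" "\<And>m e n. P (pbw m e n)"
    "\<And>g h. g \<in> pbw_span \<Longrightarrow> h \<in> pbw_span \<Longrightarrow> P g \<Longrightarrow> P h \<Longrightarrow> P (op_add g h)"
    "\<And>c g. g \<in> pbw_span \<Longrightarrow> P g \<Longrightarrow> P (op_scale c g)"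
  shows "P h"
  using assms(1) by induction (auto intro: assms)

lemma span_repr:
  assumes "h \<in> pbw_span" obtains a b where "h = op_add (act a id) (act b T)"
proof -
  have "\<exists>a b. h = op_add (act a id) (act b T)"
    using assms
  proof induction
    case (1 m e n)
    have "pbw m e n = op_add (act (if e then 0 else Poly_Mapping.single (m, n) 1) id) (act (if e then Poly_Mapping.single (m, n) 1 else 0) T)"
      by (rule ext) (simp add: pbw_def op_add_def)
    then show ?case by blast
  next
    case (2 g h)
    then obtain a b a' b' where "g = op_add (act a id) (act b T)" "h = op_add (act a' id) (act b' T)" by blast
    then have "op_add g h = op_add (act (a + a') id) (act (b + b') T)"
      by (auto simp: op_add_def act_plus)
    then show ?case by blast
  next
    case (3 g c)
    then obtain a b where g: "g = op_add (act a id) (act b T)" by blast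
    have sc: "act (Poly_Mapping.single 0 c * a) h f = lmon 0 c * act a h f" for a h f
      by (rule additive_eqI[where f = a and F = "\<lambda>a. act (Poly_Mapping.single 0 c * a) h f" and G = "\<lambda>a. lmon 0 c * act a h f"])
        (auto simp: act_plus distrib_left mult_single mult.assoc[symmetric] simp flip: zero_prod_def)
    have "op_scale c g = op_add (act (Poly_Mapping.single 0 c * a) id) (act (Poly_Mapping.single 0 c * b) T)"
      by (rule ext) (simp add: g op_add_def op_scale_def sc distrib_left)
    then show ?case by blast
  qed
  then show thesis using that by blast
qed

lemma pbw_shift: "pbw (m + i) e n f = lmon m 1 * pbw i e n f"
  by (simp add: pbw_def mult.assoc[symmetric] lmon_mult)

lemma left_comp_span:
  assumes "\<And>f g. G (f + g) = G f + G g" "\<And>c f. G (lmon 0 c * f) = lmon 0 c * G f"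
    and "\<And>m e n. G \<circ> pbw m e n \<in> pbw_span" "h \<in> pbw_span"
  shows "G \<circ> h \<in> pbw_span"
  using assms(4)
proof (induction rule: linear_closure_induct)
  case (add g h)
  have *: "G \<circ> op_add g h = op_add (G \<circ> g) (G \<circ> h)"
    by (rule ext) (simp add: op_add_def assms)
  show ?case unfolding * by (intro pbw_span.intros add)
next
  case (scale c g)
  have *: "G \<circ> op_scale c g = op_scale c (G \<circ> g)"
    by (rule ext) (simp add: op_scale_def assms)
  show ?case unfolding * by (intro pbw_span.intros scale)
qed (rule assms(3))

lemma x_span: "h \<in> pbw_span \<Longrightarrow> Xpow m \<circ> h \<in> pbw_span"
proof (rule left_comp_span)
  fix i e n
  have *: "Xpow m \<circ> pbw i e n = pbw (m + i) e n"
    by (rule ext) (simp add: Xpow_def pbw_shift)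
  show "Xpow m \<circ> pbw i e n \<in> pbw_span" unfolding * by (rule pbw_span.intros)
qed (simp_all add: Xpow_def distrib_left mult.left_commute)

text \<open>These are \<open>T X = X^(-1) T - \<kappa> X^(-1)\<close> and
  \<open>T X^(-1) = X T + \<kappa> X^(-1)\<close>, arranged for inductions on the exponent of
  \<open>X\<close> that run from 0 in both directions.\<close>

lemma T_pbw_step:
  "T \<circ> pbw (1 + i) e n = op_add (Xpow (- 1) \<circ> (T \<circ> pbw i e n)) (op_scale (inverse k - k) (pbw (- 1 + i) e n))"
  "T \<circ> pbw (- 1 + i) e n = op_add (Xpow 1 \<circ> (T \<circ> pbw i e n)) (op_scale (k - inverse k) (pbw (- 1 + i) e n))"
proof -
  have "lmon 0 (inverse k - k) = - \<kappa>" by (simp add: single_diff)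
  then show
    "T \<circ> pbw (1 + i) e n = op_add (Xpow (- 1) \<circ> (T \<circ> pbw i e n)) (op_scale (inverse k - k) (pbw (- 1 + i) e n))"
    by (intro ext) (simp only: comp_apply pbw_shift T_x op_add_def op_scale_def Xpow_def, simp)
  show "T \<circ> pbw (- 1 + i) e n = op_add (Xpow 1 \<circ> (T \<circ> pbw i e n)) (op_scale (k - inverse k) (pbw (- 1 + i) e n))"
    by (rule ext) (simp only: comp_apply pbw_shift T_xi op_add_def op_scale_def Xpow_def)
qed

lemma T_span: "h \<in> pbw_span \<Longrightarrow> T \<circ> h \<in> pbw_span"
proof (rule left_comp_span)
  fix m e n
  show "T \<circ> pbw m e n \<in> pbw_span"
  proof (induction m rule: int_induct[where k = 0])
    case base
    have *: "T \<circ> pbw 0 e n = (if e then op_add (pbw 0 False n) (op_scale (k - inverse k) (pbw 0 True n)) else pbw 0 True n)"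
      by (rule ext) (simp add: pbw_def op_add_def op_scale_def T_sq)
    show ?case unfolding * by (cases e) (simp_all only: if_True if_False pbw_span.intros)
  next
    case (step1 i)
    show ?case unfolding add.commute[of i 1] T_pbw_step(1) by (intro pbw_span.intros x_span step1)
  next
    case (step2 i)
    have "i - 1 = - 1 + i" by simp
    show ?case unfolding \<open>i - 1 = - 1 + i\<close> T_pbw_step(2) by (intro pbw_span.intros x_span step2)
  qed
qed (simp_all only: T_add T_const)

text \<open>From \<open>U = T Y^(-1)\<close> and \<open>U T = Y\<close>. So left multiplication by
  \<open>U\<close> sends a basis element to a multiple of a single basis element.\<close>

lemma U_Yp: "U (Yp n f) = T (Yp (n - 1) f)" "U (T (Yp n f)) = Yp (n + 1) f"
  by (simp_all add: Yp_pred Yp_Suc T_Yi Y_def)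

lemma U_pbw: "U \<circ> pbw m e n = op_scale (q powi m) (pbw (- m) (\<not> e) (if e then n + 1 else n - 1))"
  by (rule ext) (simp add: pbw_def op_scale_def U_mult U_lmon U_Yp mult.assoc[symmetric] lmon_mult)

lemma U_span: "h \<in> pbw_span \<Longrightarrow> U \<circ> h \<in> pbw_span"
proof (rule left_comp_span)
  show "U \<circ> pbw m e n \<in> pbw_span" for m e n
    unfolding U_pbw by (intro pbw_span.intros)
qed (simp_all add: U_add U_mult)

lemma id_eq_pbw: "id = pbw 0 False 0"
  by (rule ext) (simp add: pbw_def)

lemma id_span: "id \<in> pbw_span"
  unfolding id_eq_pbw by (rule pbw_span.intros)

text \<open>The span is a left ideal containing the identity, hence everything. The arbitrary right
  factor \<open>h\<close> lets a composite be absorbed one factor at a time.\<close>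

lemma alg_span_comp: "g \<in> algA \<Longrightarrow> h \<in> pbw_span \<Longrightarrow> g \<circ> h \<in> pbw_span"
proof (induction arbitrary: h rule: subalg.induct)
  case (1 g)
  then show ?case using x_span T_span U_span by blast
next
  case 2
  then show ?case by (simp only: id_o)
next
  case (3 g g')
  have *: "op_add g g' \<circ> h = op_add (g \<circ> h) (g' \<circ> h)" by (auto simp: op_add_def)
  show ?case unfolding * by (intro pbw_span.intros 3)
next
  case (4 g c)
  have *: "op_scale c g \<circ> h = op_scale c (g \<circ> h)" by (auto simp: op_scale_def)
  show ?case unfolding * by (intro pbw_span.intros 4)
next
  case (5 g g')
  show ?case unfolding comp_assoc by (intro 5)
qed

lemma T_alg: "T \<in> algA" and U_alg: "U \<in> algA" and Xpow_alg_gen: "Xpow 1 \<in> algA" "Xpow (- 1) \<in> algA"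
  by (rule subalg.intros(1), simp)+

lemma Y_eq: "Y = U \<circ> T"
  by (auto simp: Y_def)

lemma Y_alg: "Y \<in> algA"
  unfolding Y_eq by (intro subalg.intros(5) T_alg U_alg)

lemma Yi_alg: "Yi \<in> algA"
proof -
  have *: "Yi = op_add (T \<circ> U) (op_scale (inverse k - k) U)"
    by (rule ext) (simp add: Yi_def op_add_def op_scale_def single_diff algebra_simps)
  show ?thesis unfolding * by (intro subalg.intros(3-5) T_alg U_alg)
qed

lemma Xpow_alg: "Xpow m \<in> algA"
proof (induction m rule: int_induct[where k = 0])
  case base
  have *: "Xpow 0 = id" by (auto simp: Xpow_def)
  show ?case unfolding * by (rule subalg.intros)
next
  case (step1 i)
  have *: "Xpow (i + 1) = Xpow 1 \<circ> Xpow i" by (rule ext) (simp add: Xpow_def lmon_Suc mult.assoc)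
  show ?case unfolding * by (intro subalg.intros(5) Xpow_alg_gen step1)
next
  case (step2 i)
  have *: "Xpow (i - 1) = Xpow (- 1) \<circ> Xpow i" by (rule ext) (simp add: Xpow_def lmon_Suc mult.assoc)
  show ?case unfolding * by (intro subalg.intros(5) Xpow_alg_gen step2)
qed

lemma Yp_alg: "Yp m \<in> algA"
proof (induction m rule: int_induct[where k = 0])
  case base
  have *: "Yp 0 = id" by (rule ext) simp
  show ?case unfolding * by (rule subalg.intros)
next
  case (step1 i)
  have *: "Yp (i + 1) = Y \<circ> Yp i" by (rule ext) (simp add: Yp_Suc)
  show ?case unfolding * by (intro subalg.intros(5) Y_alg step1)
next
  case (step2 i)
  have *: "Yp (i - 1) = Yi \<circ> Yp i" by (rule ext) (simp add: Yp_pred)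
  show ?case unfolding * by (intro subalg.intros(5) Yi_alg step2)
qed

theorem alg_eq_span: "algA = pbw_span"
proof
  show "algA \<subseteq> pbw_span" using alg_span_comp[OF _ id_span] by (auto simp only: o_id)
  show "pbw_span \<subseteq> algA"
  proof
    fix h assume "h \<in> pbw_span"
    then show "h \<in> algA"
    proof induction
      case (1 m e n)
      have *: "pbw m e n = Xpow m \<circ> ((if e then T else id) \<circ> Yp n)"
        by (rule ext) (simp add: pbw_def Xpow_def)
      have "(if e then T else id) \<in> algA" using T_alg subalg.intros(2) by metis
      then show ?case unfolding * by (intro subalg.intros(5) Xpow_alg Yp_alg)
    qed (rule subalg.intros; assumption)+
  qed
qed

end

context rank_one_daha
begin

section \<open>The duality anti-involution\<close>

abbreviation rep :: "laurent2 \<Rightarrow> laurent2 \<Rightarrow> op" where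
  "rep a b \<equiv> op_add (act a id) (act b T)"

lemma act_const_mult: "act (Poly_Mapping.single (0, 0) c * a) h f = lmon 0 c * act a h f"
  by (rule additive_eqI[where f = a and F = "\<lambda>a. act (Poly_Mapping.single (0, 0) c * a) h f"
        and G = "\<lambda>a. lmon 0 c * act a h f"])
    (auto simp: act_plus distrib_left mult_single mult.assoc[symmetric] lmon_mult)

lemma rep_plus: "op_add (rep a b) (rep a' b') = rep (a + a') (b + b')"
  by (rule ext) (simp add: op_add_def act_plus)

lemma rep_scale: "op_scale c (rep a b) = rep (Poly_Mapping.single (0, 0) c * a) (Poly_Mapping.single (0, 0) c * b)"
  by (rule ext) (simp add: op_scale_def op_add_def act_const_mult distrib_left)

lemma pbw_rep: "pbw m e n = rep (if e then 0 else Poly_Mapping.single (m, n) 1) (if e then Poly_Mapping.single (m, n) 1 else 0)"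
  by (rule ext) (simp add: pbw_def op_add_def)

definition coords :: "op \<Rightarrow> laurent2 \<times> laurent2" where
  "coords h = (THE (a, b). h = rep a b)"

lemma coords_rep [simp]: "coords (rep a b) = (a, b)"
  unfolding coords_def by (rule the_equality) (auto dest: act_unique)

text \<open>On Laurent polynomials in \<open>x, \<xi>\<close> the duality exchanges \<open>x\<close> and \<open>\<xi>\<^sup>-\<^sup>1\<close>.\<close>

definition flip2 :: "laurent2 \<Rightarrow> laurent2" where
  "flip2 = Poly_Mapping.map_key (\<lambda>(m, n). (- n, - m))"

lemma inj_flip: "inj (\<lambda>(m, n). (- n :: int, - m :: int))"
  by (auto simp: inj_on_def)

lemma flip2_plus: "flip2 (a + b) = flip2 a + flip2 b"
  unfolding flip2_def by (rule map_key_plus[OF inj_flip])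

lemma flip2_single: "flip2 (Poly_Mapping.single (m, n) c) = Poly_Mapping.single (- n, - m) c"
  using map_key_single[OF inj_flip, of "(- n, - m)" c] by (simp add: flip2_def)

lemma flip2_0 [simp]: "flip2 0 = 0"
  unfolding flip2_def by (rule map_key_zero[OF inj_flip])

lemma flip2_const_mult: "flip2 (Poly_Mapping.single (0, 0) c * a) = Poly_Mapping.single (0, 0) c * flip2 a"
  by (rule additive_eqI[where f = a and F = "\<lambda>a. flip2 (Poly_Mapping.single (0, 0) c * a)"
        and G = "\<lambda>a. Poly_Mapping.single (0, 0) c * flip2 a"])
    (auto simp: flip2_plus distrib_left mult_single flip2_single)

text \<open>The formula is forced: an anti-automorphism must send \<open>X^m T^e Y^n\<close> to the
  reversed product of the images, and this is again in normal order. Linearity is built in; reversal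
  of products is what remains to be checked.\<close>

definition dual :: "op \<Rightarrow> op" where
  "dual h = (case coords h of (a, b) \<Rightarrow> rep (flip2 a) (flip2 b))"

lemma dual_pbw: "dual (pbw m e n) = pbw (- n) e (- m)"
  unfolding pbw_rep[of m] pbw_rep[of "- n"] dual_def coords_rep by (auto simp: flip2_single)

lemma dual_add: "g \<in> pbw_span \<Longrightarrow> h \<in> pbw_span \<Longrightarrow> dual (op_add g h) = op_add (dual g) (dual h)"
proof -
  assume "g \<in> pbw_span" "h \<in> pbw_span"
  then obtain a b a' b' where "g = rep a b" "h = rep a' b'" by (metis span_repr)
  then show ?thesis by (simp only: rep_plus dual_def coords_rep prod.case flip2_plus)
qed

lemma dual_scale: "g \<in> pbw_span \<Longrightarrow> dual (op_scale c g) = op_scale c (dual g)"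
proof -
  assume "g \<in> pbw_span"
  then obtain a b where "g = rep a b" by (metis span_repr)
  then show ?thesis by (simp only: rep_scale dual_def coords_rep prod.case flip2_const_mult)
qed

lemma dual_span: "h \<in> pbw_span \<Longrightarrow> dual h \<in> pbw_span"
proof (induction rule: linear_closure_induct)
  case (pbw m e n)
  show ?case unfolding dual_pbw by (rule pbw_span.intros)
next
  case (add g h)
  then show ?case by (simp only: dual_add pbw_span.intros)
next
  case (scale c g)
  then show ?case by (simp only: dual_scale pbw_span.intros)
qed

lemma dual_dual: "h \<in> pbw_span \<Longrightarrow> dual (dual h) = h"
proof (induction rule: linear_closure_induct)
  case (pbw m e n)
  show ?case unfolding dual_pbw by simp
next
  case (add g h)
  then show ?case by (simp only: dual_add dual_span)
next
  case (scale c g)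
  then show ?case by (simp only: dual_scale dual_span)
qed

lemma pbw_linear:
  "pbw m e n (f + g) = pbw m e n f + pbw m e n g" "pbw m e n (lmon 0 c * f) = lmon 0 c * pbw m e n f"
  by (simp_all add: pbw_def Yp_plus Yp_const T_add T_const distrib_left mult.left_commute)

lemma pbw_minus: "pbw m e n (f - g) = pbw m e n f - pbw m e n g"
  by (metis pbw_linear(1) diff_add_cancel eq_diff_eq)

lemma span_linear:
  "h \<in> pbw_span \<Longrightarrow> h (f + g) = h f + h g \<and> h (lmon 0 c * f) = lmon 0 c * h f"
  by (induction rule: linear_closure_induct)
    (auto simp: pbw_linear op_add_def op_scale_def distrib_left mult.left_commute)

lemma comp_span: "g \<in> pbw_span \<Longrightarrow> h \<in> pbw_span \<Longrightarrow> g \<circ> h \<in> pbw_span"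
  using alg_span_comp unfolding alg_eq_span .

text \<open>For fixed \<open>g\<close> both sides are linear in \<open>h\<close>, since all
  operators of the span are linear.\<close>

lemma dual_anti_left:
  assumes g: "g \<in> pbw_span" and basis: "\<And>m e n. dual (g \<circ> pbw m e n) = dual (pbw m e n) \<circ> dual g"
    and h: "h \<in> pbw_span"
  shows "dual (g \<circ> h) = dual h \<circ> dual g"
  using h
proof (induction rule: linear_closure_induct)
  case (add h h')
  have *: "g \<circ> op_add h h' = op_add (g \<circ> h) (g \<circ> h')"
    by (rule ext) (simp add: op_add_def span_linear[OF g])
  show ?case
    unfolding * dual_add[OF comp_span[OF g add(1)] comp_span[OF g add(2)]] dual_add[OF add(1,2)] add(3,4)
    by (rule ext) (simp add: op_add_def)
next
  case (scale c h)
  have *: "g \<circ> op_scale c h = op_scale c (g \<circ> h)"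
    by (rule ext) (simp add: op_scale_def span_linear[OF g])
  show ?case
    unfolding * dual_scale[OF comp_span[OF g scale(1)]] dual_scale[OF scale(1)] scale(2)
    by (rule ext) (simp add: op_scale_def)
qed (rule basis)

lemma Xpow_eq_pbw: "Xpow m = pbw m False 0" and T_eq_pbw: "T = pbw 0 True 0"
  and Yp_eq_pbw: "Yp n = pbw 0 False n" and U_eq_pbw: "U = pbw 0 True (- 1)"
  by (rule ext, simp add: pbw_def Xpow_def T_Yi)+

lemma dual_gens: "dual (Xpow m) = Yp (- m)" "dual T = T" "dual (Yp m) = Xpow (- m)" "dual U = pbw 1 True 0" "dual id = id"
  unfolding Xpow_eq_pbw T_eq_pbw Yp_eq_pbw U_eq_pbw id_eq_pbw dual_pbw by simp_all

lemma pbw_right: "pbw m e n (Yp j f) = pbw m e (n + j) f"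
  by (simp add: pbw_def Yp_add)

lemma gens_span: "Xpow m \<in> pbw_span" "T \<in> pbw_span" "Yp m \<in> pbw_span" "U \<in> pbw_span"
  unfolding Xpow_eq_pbw T_eq_pbw Yp_eq_pbw U_eq_pbw by (rule pbw_span.intros)+

lemma dual_anti_Xpow: "h \<in> pbw_span \<Longrightarrow> dual (Xpow m \<circ> h) = dual h \<circ> dual (Xpow m)"
proof (rule dual_anti_left)
  fix i e n
  have "Xpow m \<circ> pbw i e n = pbw (m + i) e n"
    by (rule ext) (simp add: Xpow_def pbw_shift)
  then show "dual (Xpow m \<circ> pbw i e n) = dual (pbw i e n) \<circ> dual (Xpow m)"
    by (simp add: dual_pbw dual_gens o_def pbw_right algebra_simps)
qed (rule gens_span)

lemma Yi_T: "Yi (T f) = T (Y f) - \<kappa> * Y f"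
  by (simp add: Yi_def Y_def)

text \<open>Duality must turn the cross relation of \<open>T\<close> with \<open>X\<close> into one
  of \<open>T\<close> with \<open>Y\<close>. That relation is
  \<open>Y^(-1) T = T Y - \<kappa> Y\<close>, which follows from \<open>Y = U T\<close>; the
  induction on the exponent of \<open>X\<close> uses it once per step.\<close>

lemma dual_anti_T: "h \<in> pbw_span \<Longrightarrow> dual (T \<circ> h) = dual h \<circ> dual T"
proof (rule dual_anti_left)
  fix m e n
  show "dual (T \<circ> pbw m e n) = dual (pbw m e n) \<circ> dual T"
  proof (induction m rule: int_induct[where k = 0])
    case base
    have 1: "T \<circ> pbw 0 e n = (if e then op_add (pbw 0 False n) (op_scale (k - inverse k) (pbw 0 True n)) else pbw 0 True n)"
      by (rule ext) (simp add: pbw_def op_add_def op_scale_def T_sq)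
    have "dual (T \<circ> pbw 0 e n) = (if e then op_add (pbw (- n) False 0) (op_scale (k - inverse k) (pbw (- n) True 0)) else pbw (- n) True 0)"
      unfolding 1 by (cases e) (simp_all add: dual_add dual_scale dual_pbw pbw_span.intros)
    then show ?case
      by (simp only: dual_pbw dual_gens)
        (rule ext, simp add: pbw_def op_add_def op_scale_def T_sq distrib_left mult.left_commute)
  next
    case (step1 i)
    let ?P = "pbw (- n) e (- i)"
    have "dual (T \<circ> pbw (1 + i) e n) = op_add (dual (T \<circ> pbw i e n) \<circ> dual (Xpow (- 1))) (op_scale (inverse k - k) (dual (pbw (- 1 + i) e n)))"
      unfolding T_pbw_step(1)
      by (subst dual_add, intro comp_span gens_span pbw_span.intros, intro pbw_span.intros,
          subst dual_scale, intro pbw_span.intros, subst dual_anti_Xpow, intro comp_span gens_span pbw_span.intros, rule refl)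
    also have "\<dots> = dual (pbw (1 + i) e n) \<circ> dual T"
    proof
      fix f
      have 1: "pbw (- n) e (1 - i) f = ?P (Y f)" "pbw (- n) e (- 1 - i) (T f) = ?P (Yi (T f))"
        using pbw_right[of "- n" e "- i" 1 f] pbw_right[of "- n" e "- i" "- 1" "T f"]
        by (simp_all add: minus_diff_commute)
      have 2: "lmon 0 (inverse k - k) = - \<kappa>" by (simp add: single_diff)
      have 3: "?P (Yi (T f)) = ?P (T (Y f)) - \<kappa> * ?P (Y f)"
        unfolding Yi_T pbw_minus pbw_linear(2) ..
      show "op_add (dual (T \<circ> pbw i e n) \<circ> dual (Xpow (- 1))) (op_scale (inverse k - k) (dual (pbw (- 1 + i) e n))) f
          = (dual (pbw (1 + i) e n) \<circ> dual T) f"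
        unfolding step1 by (simp add: dual_pbw dual_gens op_add_def op_scale_def 1 2 3 del: single_diff)
    qed
    finally show ?case by (simp only: add.commute[of i 1])
  next
    case (step2 i)
    let ?P = "pbw (- n) e (- i)"
    have "dual (T \<circ> pbw (- 1 + i) e n) = op_add (dual (T \<circ> pbw i e n) \<circ> dual (Xpow 1)) (op_scale (k - inverse k) (dual (pbw (- 1 + i) e n)))"
      unfolding T_pbw_step(2)
      by (subst dual_add, intro comp_span gens_span pbw_span.intros, intro pbw_span.intros,
          subst dual_scale, intro pbw_span.intros, subst dual_anti_Xpow, intro comp_span gens_span pbw_span.intros, rule refl)
    also have "\<dots> = dual (pbw (- 1 + i) e n) \<circ> dual T"
    proof
      fix f
      have 1: "pbw (- n) e (1 - i) g = ?P (Y g)" for g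
        using pbw_right[of "- n" e "- i" 1 g] by (simp_all add: algebra_simps)
      have 2: "Y (T f) = T (Yi f) + \<kappa> * Y f"
        by (simp add: T_Yi Y_def T_sq U_add U_mult)
      have 3: "?P (Y (T f)) = ?P (T (Yi f)) + \<kappa> * ?P (Y f)"
        unfolding 2 pbw_linear ..
      show "op_add (dual (T \<circ> pbw i e n) \<circ> dual (Xpow 1)) (op_scale (k - inverse k) (dual (pbw (- 1 + i) e n))) f
          = (dual (pbw (- 1 + i) e n) \<circ> dual T) f"
        unfolding step2 by (simp add: dual_pbw dual_gens op_add_def op_scale_def 1 3)
    qed
    finally show ?case by (simp only: uminus_add_conv_diff)
  qed
qed (rule gens_span)

text \<open>The operator \<open>V = X T\<close> is the dual of \<open>U\<close>. Its rule
  \<open>Y V = q^(-1) V Y^(-1)\<close> mirrors \<open>U X = q X^(-1) U\<close>, and \<open>V\<close>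
  is an involution by the cross relation.\<close>

lemma Y_V: "Y (x * T f) = lmon 0 (inverse q) * (x * T (Yi f))"
  by (simp add: Y_def T_x_T U_mult U_lmon T_Yi mult.assoc[symmetric] lmon_mult)

lemma Yi_V: "Yi (x * T f) = lmon 0 q * (x * T (Y f))"
proof -
  have "x * T f = lmon 0 q * Y (x * T (Y f))"
    using q0 by (simp add: Y_V mult.assoc[symmetric] lmon_mult)
  also have "\<dots> = Y (lmon 0 q * (x * T (Y f)))" by (simp only: Y_const)
  finally show ?thesis by (metis Yi_Y)
qed

lemma Yp_V: "Yp (- m) (x * T f) = lmon 0 (q powi m) * (x * T (Yp m f))"
proof (induction m rule: int_induct[where k = 0])
  case (step1 i)
  have "Yp (- (i + 1)) (x * T f) = Yi (Yp (- i) (x * T f))" using Yp_pred[of "- i"] by simp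
  also have "\<dots> = lmon 0 (q powi (i + 1)) * (x * T (Yp (i + 1) f))"
    unfolding step1 Yi_const Yi_V using q0 by (simp add: Yp_Suc power_int_add mult.assoc[symmetric] lmon_mult)
  finally show ?case .
next
  case (step2 i)
  have "Yp (- (i - 1)) (x * T f) = Y (Yp (- i) (x * T f))" using Yp_Suc[of "- i"] by simp
  also have "\<dots> = lmon 0 (q powi (i - 1)) * (x * T (Yp (i - 1) f))"
    unfolding step2 Y_const Y_V using q0 by (simp add: Yp_pred power_int_diff mult.assoc[symmetric] lmon_mult divide_inverse)
  finally show ?case .
qed simp

lemma dual_anti_U: "h \<in> pbw_span \<Longrightarrow> dual (U \<circ> h) = dual h \<circ> dual U"
proof (rule dual_anti_left)
  fix m e n
  have "dual (U \<circ> pbw m e n) = op_scale (q powi m) (pbw (- (if e then n + 1 else n - 1)) (\<not> e) m)"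
    unfolding U_pbw by (simp add: dual_scale dual_pbw pbw_span.intros)
  also have "\<dots> = dual (pbw m e n) \<circ> dual U"
  proof
    fix f
    have "(dual (pbw m e n) \<circ> dual U) f = lmon (- n) 1 * (if e then T (Yp (- m) (x * T f)) else Yp (- m) (x * T f))"
      by (simp add: dual_pbw dual_gens) (simp add: pbw_def)
    also have "\<dots> = op_scale (q powi m) (pbw (- (if e then n + 1 else n - 1)) (\<not> e) m) f"
      by (simp only: Yp_V T_const T_x_T) (simp add: op_scale_def pbw_def mult.assoc[symmetric] lmon_mult)
    finally show "op_scale (q powi m) (pbw (- (if e then n + 1 else n - 1)) (\<not> e) m) f = (dual (pbw m e n) \<circ> dual U) f" ..
  qed
  finally show "dual (U \<circ> pbw m e n) = dual (pbw m e n) \<circ> dual U" .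
qed (rule gens_span)

lemma dual_anti: "g \<in> algA \<Longrightarrow> h \<in> pbw_span \<Longrightarrow> dual (g \<circ> h) = dual h \<circ> dual g"
proof (induction arbitrary: h rule: subalg.induct)
  case (1 g)
  then show ?case using dual_anti_U dual_anti_T dual_anti_Xpow by blast
next
  case 2
  then show ?case by (simp only: id_o o_id dual_gens)
next
  case (3 g g')
  have *: "op_add g g' \<circ> h = op_add (g \<circ> h) (g' \<circ> h)" by (auto simp: op_add_def)
  have g: "g \<in> pbw_span" "g' \<in> pbw_span" using 3 by (simp_all only: alg_eq_span)
  show ?case
    unfolding * dual_add[OF comp_span[OF g(1) 3(5)] comp_span[OF g(2) 3(5)]] dual_add[OF g] 3(3)[OF 3(5)] 3(4)[OF 3(5)]
    by (rule ext) (simp add: op_add_def span_linear[OF dual_span[OF 3(5)]])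
next
  case (4 g c)
  have *: "op_scale c g \<circ> h = op_scale c (g \<circ> h)" by (auto simp: op_scale_def)
  have g: "g \<in> pbw_span" using 4 by (simp only: alg_eq_span)
  show ?case
    unfolding * dual_scale[OF comp_span[OF g 4(3)]] dual_scale[OF g] 4(2)[OF 4(3)]
    by (rule ext) (simp add: op_scale_def span_linear[OF dual_span[OF 4(3)]])
next
  case (5 g g')
  have "g' \<circ> h \<in> pbw_span" using 5 comp_span by (simp only: alg_eq_span)
  then have "dual ((g \<circ> g') \<circ> h) = (dual h \<circ> dual g') \<circ> dual g"
    using 5 by (simp only: comp_assoc)
  also have "\<dots> = dual h \<circ> dual (g \<circ> g')"
    using 5 by (simp only: alg_eq_span comp_assoc)
  finally show ?case .
qed

text \<open>All fields of the record except \<open>dfac\<close>, the only one in which the two types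
  will differ.\<close>

definition standard :: "daha \<Rightarrow> bool" where
  "standard D \<longleftrightarrow> step D = q \<and> alg D = algA \<and> T1op D = T \<and> Yop D = Y"

lemma duality_anti_dual:
  assumes "standard D" shows "duality_anti D D dual"
proof -
  have D: "alg D = pbw_span" "T1op D = T" "Yop D = Y"
    using assms unfolding standard_def alg_eq_span by blast+
  have bij: "bij_betw dual pbw_span pbw_span"
    by (rule bij_betw_byWitness[where f' = dual]) (auto simp: dual_dual dual_span)
  have Y: "dual Y = Xpow (- 1)"
  proof -
    have "Y = Yp 1" by (rule ext) simp
    then show ?thesis using dual_gens(3)[of 1] by (simp only:)
  qed
  have anti: "dual (g \<circ> h) = dual h \<circ> dual g" if "g \<in> pbw_span" "h \<in> pbw_span" for g h
    using that dual_anti[of g h] unfolding alg_eq_span by blast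
  show ?thesis
    unfolding duality_anti_def D
    by (intro conjI ballI allI bij Y anti dual_add dual_scale dual_gens; assumption)
qed

text \<open>Since \<open>star\<close> is an arbitrary choice among the dualities, nothing is known
  about it without uniqueness. The conditions prescribe the images of \<open>T\<close>,
  \<open>X\<close> and \<open>Y\<close>; those of the generators \<open>X^(-1)\<close> and
  \<open>U\<close> have to be derived.\<close>

lemma duality_anti_unique:
  assumes D: "standard D" and \<psi>: "duality_anti D D \<psi>" and g: "g \<in> algA"
  shows "\<psi> g = dual g"
proof -
  have D': "alg D = algA" "T1op D = T" "Yop D = Y"
    using D unfolding standard_def by blast+
  note p = \<psi>[unfolded duality_anti_def D']
  have id: "\<psi> id = id" and T: "\<psi> T = T" and X: "\<psi> (Xpow 1) = Yp (- 1)" and Y: "\<psi> Y = Xpow (- 1)"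
    using p by blast+
  have add: "\<psi> (op_add g h) = op_add (\<psi> g) (\<psi> h)" if "g \<in> algA" "h \<in> algA" for g h
    using p that by blast
  have sc: "\<psi> (op_scale c g) = op_scale c (\<psi> g)" if "g \<in> algA" for c g
    using p that by blast
  have comp: "\<psi> (g \<circ> h) = \<psi> h \<circ> \<psi> g" if "g \<in> algA" "h \<in> algA" for g h
    using p that by blast
  have Xi: "\<psi> (Xpow (- 1)) = Yp 1"
  proof
    fix f
    have "Xpow 1 \<circ> Xpow (- 1) = id"
      by (rule ext) (simp add: Xpow_def mult.assoc[symmetric] lmon_mult)
    then have "\<psi> (Xpow (- 1)) \<circ> \<psi> (Xpow 1) = id"
      using comp[OF Xpow_alg Xpow_alg, of 1 "- 1"] id by simp
    then have "\<psi> (Xpow (- 1)) (Yp (- 1) (Y f)) = Y f" unfolding X by (metis comp_apply id_apply)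
    then show "\<psi> (Xpow (- 1)) f = Yp 1 f" by simp
  qed
  \<comment> \<open>This is \<open>U = Y T^(-1)\<close>; its image is \<open>T^(-1) X^(-1)\<close>,
    which equals \<open>X T\<close> by the cross relation.\<close>
  have "U = op_add (Y \<circ> T) (op_scale (inverse k - k) Y)"
    by (rule ext) (simp add: Y_def op_add_def op_scale_def T_sq U_add U_minus U_mult single_diff algebra_simps)
  then have "\<psi> U = op_add (T \<circ> Xpow (- 1)) (op_scale (inverse k - k) (Xpow (- 1)))"
    using add[OF subalg.intros(5)[OF Y_alg T_alg] subalg.intros(4)[OF Y_alg]] comp[OF Y_alg T_alg] sc[OF Y_alg] T Y
    by (simp only:)
  also have "\<dots> = pbw 1 True 0"
  proof
    fix f
    have 2: "lmon 0 (inverse k - k) = - \<kappa>" by (simp add: single_diff)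
    show "op_add (T \<circ> Xpow (- 1)) (op_scale (inverse k - k) (Xpow (- 1))) f = pbw 1 True 0 f"
      by (simp only: op_add_def op_scale_def Xpow_def comp_apply T_xi 2) (simp add: pbw_def)
  qed
  finally have U: "\<psi> U = pbw 1 True 0" .
  show ?thesis
    using g
  proof induction
    case (1 g)
    have "dual (Xpow (- 1)) = Yp 1" using dual_gens(1)[of "- 1"] by simp
    with 1 show ?case
      by (elim insertE emptyE) (simp_all only: T X Xi U dual_gens)
  next
    case 2
    show ?case by (simp only: id dual_gens)
  next
    case (3 g h)
    then show ?case using add dual_add unfolding alg_eq_span by simp
  next
    case (4 g c)
    then show ?case using sc dual_scale unfolding alg_eq_span by simp
  next
    case (5 g h)
    then show ?case using comp[of g h] dual_anti[of g h] by (simp only: alg_eq_span)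
  qed
qed

lemma star_eq_dual: "standard D \<Longrightarrow> g \<in> algA \<Longrightarrow> star D D g = dual g"
  unfolding star_def
  by (rule duality_anti_unique[OF _ someI[of "duality_anti D D", OF duality_anti_dual]])

end

section \<open>Substitutions in meromorphic functions\<close>

text \<open>Holomorphy of \<open>\<phi>\<close> keeps local quotients holomorphic. The inverse
  \<open>\<psi>\<close> makes images of open sets open, so that dense sets and zero sets without
  interior are pulled back to such sets.\<close>

definition torus_auto :: "(complex \<times> complex \<Rightarrow> complex \<times> complex) \<Rightarrow> (complex \<times> complex \<Rightarrow> complex \<times> complex) \<Rightarrow> bool" where
  "torus_auto \<phi> \<psi> \<longleftrightarrow>
     (\<forall>z\<in>torus2. \<phi> z \<in> torus2 \<and> \<psi> z \<in> torus2 \<and> \<phi> (\<psi> z) = z \<and> \<psi> (\<phi> z) = z) \<and>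
     holo2 (\<lambda>z. fst (\<phi> z)) torus2 \<and> holo2 (\<lambda>z. snd (\<phi> z)) torus2 \<and>
     continuous_on torus2 \<phi> \<and> continuous_on torus2 \<psi>"

lemma torus_auto_image_open:
  assumes "torus_auto \<phi> \<psi>" "open U" "U \<subseteq> torus2"
  shows "open (\<phi> ` U)" "open (\<psi> ` U)" "\<phi> ` U \<subseteq> torus2" "\<psi> ` U \<subseteq> torus2"
proof -
  have "\<phi> ` U = torus2 \<inter> \<psi> -` U" "\<psi> ` U = torus2 \<inter> \<phi> -` U"
    using assms unfolding torus_auto_def by (auto simp: image_iff) (metis subsetD)+
  then show "open (\<phi> ` U)" "open (\<psi> ` U)" "\<phi> ` U \<subseteq> torus2" "\<psi> ` U \<subseteq> torus2"
    using assms continuous_open_preimage[OF _ open_torus2 assms(2)] unfolding torus_auto_def by auto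
qed

lemma generically_subst:
  assumes \<phi>: "torus_auto \<phi> \<psi>" and P: "generically P"
  shows "generically (\<lambda>z. P (\<phi> z))"
  unfolding generically_iff
proof (intro allI impI)
  fix U :: "(complex \<times> complex) set" assume U: "open U" "U \<inter> torus2 \<noteq> {}"
  define U1 where "U1 = U \<inter> torus2"
  have U1: "open U1" "U1 \<subseteq> torus2" "U1 \<noteq> {}" using U open_torus2 by (auto simp: U1_def)
  note im = torus_auto_image_open[OF \<phi> U1(1,2)]
  have "\<phi> ` U1 \<inter> torus2 \<noteq> {}" using im(3) U1(3) by auto
  then obtain U2 where U2: "open U2" "U2 \<noteq> {}" "U2 \<subseteq> \<phi> ` U1" "\<forall>z\<in>U2. P z"
    using P[unfolded generically_iff] im(1) by meson
  have "U2 \<subseteq> torus2" using U2(3) im(3) by blast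
  then have "open (\<psi> ` U2)" "\<psi> ` U2 \<subseteq> U" "\<forall>z\<in>\<psi> ` U2. P (\<phi> z)"
    using torus_auto_image_open(2)[OF \<phi> U2(1)] U2(3,4) \<phi> unfolding torus_auto_def U1_def by auto
  then show "\<exists>U'. open U' \<and> U' \<noteq> {} \<and> U' \<subseteq> U \<and> (\<forall>z\<in>U'. P (\<phi> z))"
    using U2(2) by (intro exI[of _ "\<psi> ` U2"]) auto
qed

lemma holo2_subst:
  assumes "torus_auto \<phi> \<psi>" "holo2 g V"
  shows "holo2 (\<lambda>z. g (\<phi> z)) (torus2 \<inter> \<phi> -` V)"
  unfolding holo2_def
proof
  fix z assume z: "z \<in> torus2 \<inter> \<phi> -` V"
  have "holo2 (\<lambda>z. fst (\<phi> z)) torus2" "holo2 (\<lambda>z. snd (\<phi> z)) torus2"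
    using assms unfolding torus_auto_def by auto
  with z assms(2) obtain a b c d e f where
    D: "((\<lambda>z. fst (\<phi> z)) has_derivative (\<lambda>h. a * fst h + b * snd h)) (at z)"
    "((\<lambda>z. snd (\<phi> z)) has_derivative (\<lambda>h. c * fst h + d * snd h)) (at z)"
    "(g has_derivative (\<lambda>h. e * fst h + f * snd h)) (at (\<phi> z))"
    unfolding holo2_def by (auto dest!: bspec)
  have "(\<phi> has_derivative (\<lambda>h. (a * fst h + b * snd h, c * fst h + d * snd h))) (at z)"
    using has_derivative_Pair[OF D(1,2)] by simp
  from diff_chain_at[OF this D(3)]
  have "((\<lambda>z. g (\<phi> z)) has_derivative (\<lambda>h. (e * a + f * c) * fst h + (e * b + f * d) * snd h)) (at z)"
    by (simp add: o_def algebra_simps)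
  then show "\<exists>a b. ((\<lambda>z. g (\<phi> z)) has_derivative (\<lambda>h. a * fst h + b * snd h)) (at z)" by blast
qed

lemma mero2_subst:
  assumes \<phi>: "torus_auto \<phi> \<psi>" and F: "mero2 F"
  shows "mero2 (\<lambda>z. F (\<phi> z))"
  unfolding mero2_def
proof
  fix p assume p: "p \<in> torus2"
  then have "\<phi> p \<in> torus2" using \<phi> unfolding torus_auto_def by blast
  then obtain V g h where *: "open V" "\<phi> p \<in> V" "holo2 g V" "holo2 h V"
    "interior {z\<in>V. h z = 0} = {}" "\<forall>z\<in>V. h z \<noteq> 0 \<longrightarrow> F z = g z / h z"
    by (rule mero2E[OF F])
  let ?W = "torus2 \<inter> \<phi> -` V"
  have "open ?W" using \<phi> continuous_open_preimage[OF _ open_torus2 *(1)] unfolding torus_auto_def by blast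
  moreover have "interior {z\<in>?W. h (\<phi> z) = 0} = {}"
    unfolding interior_zero_iff
  proof (intro allI impI)
    fix U assume U: "open U" "U \<subseteq> ?W" "U \<noteq> {}"
    then have "open (\<phi> ` U)" "\<phi> ` U \<subseteq> V" "\<phi> ` U \<noteq> {}"
      using torus_auto_image_open(1)[OF \<phi>, of U] by auto
    then obtain z where "z \<in> \<phi> ` U" "h z \<noteq> 0"
      using *(5)[unfolded interior_zero_iff] by meson
    then show "\<exists>z\<in>U. h (\<phi> z) \<noteq> 0" by auto
  qed
  ultimately show "\<exists>V g h. open V \<and> p \<in> V \<and> holo2 g V \<and> holo2 h V \<and>
      interior {z\<in>V. h z = 0} = {} \<and> (\<forall>z\<in>V. h z \<noteq> 0 \<longrightarrow> F (\<phi> z) = g z / h z)"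
    using * p holo2_subst[OF \<phi>]
    by (intro exI[of _ ?W] exI[of _ "\<lambda>z. g (\<phi> z)"] exI[of _ "\<lambda>z. h (\<phi> z)"]) auto
qed

lemma mero2_eq_refl: "mero2_eq F F \<longleftrightarrow> mero2 F"
  by (auto simp: mero2_eq_def intro: generically_True)

lemma mero_cases [case_names abs]:
  obtains F where "mero2 F" "f = abs_mero F"
  using Quotient_abs_rep[OF Quotient_mero, of f] Quotient_rep_reflp[OF Quotient_mero, of f]
  by (metis mero2_eq_refl)

text \<open>\<open>msubst\<close> is defined through a chosen representative. Generic equality is
  preserved by torus automorphisms, so any representative may be used.\<close>

lemma msubst_abs:
  assumes \<phi>: "torus_auto \<phi> \<psi>" and F: "mero2 F"
  shows "msubst \<phi> (abs_mero F) = abs_mero (\<lambda>z. F (\<phi> z))"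
proof -
  have "mero2_eq (rep_mero (abs_mero F)) F"
    using Quotient_rep_abs[OF Quotient_mero] F mero2_eq_refl by blast
  then have "mero2_eq (\<lambda>z. rep_mero (abs_mero F) (\<phi> z)) (\<lambda>z. F (\<phi> z))"
    unfolding mero2_eq_def using generically_subst[OF \<phi>] mero2_subst[OF \<phi>] by blast
  then show ?thesis
    unfolding msubst_def o_def by (rule Quotient_rel_abs[OF Quotient_mero])
qed

lemma abs_mero_eqI: "mero2 F \<Longrightarrow> mero2 G \<Longrightarrow> (\<And>z. z \<in> torus2 \<Longrightarrow> F z = G z) \<Longrightarrow> abs_mero F = abs_mero G"
proof (rule Quotient_rel_abs[OF Quotient_mero])
  assume *: "mero2 F" "mero2 G" "\<And>z. z \<in> torus2 \<Longrightarrow> F z = G z"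
  have "generically (\<lambda>z. F z = G z)"
    unfolding generically_iff
  proof (intro allI impI)
    fix U :: "(complex \<times> complex) set" assume "open U" "U \<inter> torus2 \<noteq> {}"
    then show "\<exists>U'. open U' \<and> U' \<noteq> {} \<and> U' \<subseteq> U \<and> (\<forall>z\<in>U'. F z = G z)"
      using * open_torus2 by (intro exI[of _ "U \<inter> torus2"]) auto
  qed
  then show "mero2_eq F G" using * by (simp add: mero2_eq_def)
qed

lemma msubst_hom:
  assumes \<phi>: "torus_auto \<phi> \<psi>"
  shows "msubst \<phi> (f + g) = msubst \<phi> f + msubst \<phi> g"
    and "msubst \<phi> (f * g) = msubst \<phi> f * msubst \<phi> g"
    and "msubst \<phi> (inverse f) = inverse (msubst \<phi> f)"
    and "msubst \<phi> (mconst c) = mconst c"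
    and "msubst \<phi> mx = abs_mero (\<lambda>z. fst (\<phi> z))"
    and "msubst \<phi> mxi = abs_mero (\<lambda>z. snd (\<phi> z))"
proof -
  obtain F G where FG: "mero2 F" "f = abs_mero F" "mero2 G" "g = abs_mero G" by (metis mero_cases)
  note s = msubst_abs[OF \<phi>] mero2_subst[OF \<phi>] mero2_eq_refl
  show "msubst \<phi> (f + g) = msubst \<phi> f + msubst \<phi> g"
    using FG by (simp add: s plus_mero.abs_eq mero2_add)
  show "msubst \<phi> (f * g) = msubst \<phi> f * msubst \<phi> g"
    using FG by (simp add: s times_mero.abs_eq mero2_mult)
  show "msubst \<phi> (inverse f) = inverse (msubst \<phi> f)"
    using FG by (simp add: s inverse_mero.abs_eq mero2_inverse)
  show "msubst \<phi> (mconst c) = mconst c"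
    by (simp add: s mconst.abs_eq mero2_const)
  show "msubst \<phi> mx = abs_mero (\<lambda>z. fst (\<phi> z))" "msubst \<phi> mxi = abs_mero (\<lambda>z. snd (\<phi> z))"
    by (simp_all add: s mx_def mxi_def mero2I_holo2 holo2_fst holo2_snd)
qed

text \<open>Substitution reverses composition: the outer map is applied first to the point.
  Comparing the maps on the torus is enough for classes of meromorphic functions.\<close>

lemma msubst_msubst:
  assumes "torus_auto \<phi> \<phi>'" "torus_auto \<psi> \<psi>'" "torus_auto \<theta> \<theta>'" "\<And>z. z \<in> torus2 \<Longrightarrow> \<psi> (\<phi> z) = \<theta> z"
  shows "msubst \<phi> (msubst \<psi> f) = msubst \<theta> f"
proof -
  obtain F where F: "mero2 F" "f = abs_mero F" by (metis mero_cases)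
  then show ?thesis
    by (simp add: msubst_abs[OF assms(1)] msubst_abs[OF assms(2)] msubst_abs[OF assms(3)]
        mero2_subst[OF assms(2)] assms(4)
        abs_mero_eqI[OF mero2_subst[OF assms(1) mero2_subst[OF assms(2) F(1)]] mero2_subst[OF assms(3) F(1)]])
qed

definition torus_map :: "complex \<Rightarrow> complex \<Rightarrow> bool \<Rightarrow> bool \<Rightarrow> complex \<times> complex \<Rightarrow> complex \<times> complex" where
  "torus_map a b e e' = (\<lambda>(x, \<xi>). ((a * x) powi (if e then -1 else 1), (b * \<xi>) powi (if e' then -1 else 1)))"

lemma holo2_inverse:
  assumes "holo2 f V" "\<And>z. z \<in> V \<Longrightarrow> f z \<noteq> 0"
  shows "holo2 (\<lambda>z. inverse (f z)) V"
  unfolding holo2_def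
proof
  fix z assume z: "z \<in> V"
  then obtain a b where "(f has_derivative (\<lambda>h. a * fst h + b * snd h)) (at z)"
    using assms unfolding holo2_def by blast
  from Deriv.has_derivative_inverse[OF assms(2)[OF z] this]
  show "\<exists>a b. ((\<lambda>z. inverse (f z)) has_derivative (\<lambda>h. a * fst h + b * snd h)) (at z)"
    by (intro exI[of _ "- (inverse (f z) * a * inverse (f z))"] exI[of _ "- (inverse (f z) * b * inverse (f z))"])
      (simp add: algebra_simps)
qed

text \<open>With inversion, \<open>z \<mapsto> 1/(a z)\<close> is an involution and so its own
  inverse; without it the inverse scales by \<open>1/a\<close>.\<close>

lemma torus_auto_map:
  assumes "a \<noteq> 0" "b \<noteq> 0"
  shows "torus_auto (torus_map a b e e')
    (torus_map (if e then a else inverse a) (if e' then b else inverse b) e e')"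
proof -
  have h: "holo2 (\<lambda>z. fst (torus_map a b e e' z)) torus2 \<and> holo2 (\<lambda>z. snd (torus_map a b e e' z)) torus2"
    if "a \<noteq> 0" "b \<noteq> 0" for a b
  proof -
    have 1: "holo2 (\<lambda>z. a * fst z) torus2" "holo2 (\<lambda>z. b * snd z) torus2"
      by (intro holo2_mult holo2_const holo2_fst holo2_snd)+
    then have "holo2 (\<lambda>z. inverse (a * fst z)) torus2" "holo2 (\<lambda>z. inverse (b * snd z)) torus2"
      using that by (intro holo2_inverse; auto simp: torus2_mem)+
    then show ?thesis using 1
      by (cases e; cases e') (simp_all add: torus_map_def case_prod_beta del: inverse_mult_distrib)
  qed
  have c: "continuous_on torus2 (torus_map a b e e')" if "a \<noteq> 0" "b \<noteq> 0" for a b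
    using continuous_on_Pair[OF holo2_continuous[OF h[OF that, THEN conjunct1]] holo2_continuous[OF h[OF that, THEN conjunct2]]]
    by simp
  show ?thesis
    using h[OF assms] c[OF assms] c[of "if e then a else inverse a" "if e' then b else inverse b"] assms
    unfolding torus_auto_def
    by (auto simp: torus2_mem torus_map_def case_prod_beta)
qed

lemma wact2_torus_map: "wact2 p (Weyl l e, Weyl m e') = msubst (torus_map (p powi (- l)) (p powi m) e e')"
  by (simp add: torus_map_def)

lemma mshift_torus_map: "mshift a b = msubst (torus_map a b False False)"
  by (simp add: mshift_def torus_map_def)

lemma mshift_simps:
  assumes "a \<noteq> 0" "b \<noteq> 0"
  shows "mshift a b (f + g) = mshift a b f + mshift a b g"
    and "mshift a b (f * g) = mshift a b f * mshift a b g"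
    and "mshift a b (inverse f) = inverse (mshift a b f)"
    and "mshift a b (mconst c) = mconst c"
    and "mshift a b mx = mconst a * mx"
    and "mshift a b mxi = mconst b * mxi"
  unfolding mshift_torus_map using msubst_hom[OF torus_auto_map[OF assms, of False False]]
  by (simp_all add: torus_map_def case_prod_beta mconst_def mx_def mxi_def times_mero.abs_eq
      mero2_eq_refl mero2_const mero2I_holo2 holo2_fst holo2_snd)

lemma torus_auto_id: "torus_auto (\<lambda>z. z) (\<lambda>z. z)"
  unfolding torus_auto_def by (auto intro: holo2_fst holo2_snd)

lemma msubst_id: "msubst (\<lambda>z. z) f = f"
proof -
  obtain F where "mero2 F" "f = abs_mero F" by (metis mero_cases)
  then show ?thesis by (simp add: msubst_abs[OF torus_auto_id])
qed

lemma mshift_mshift: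
  assumes "a \<noteq> 0" "b \<noteq> 0" "c \<noteq> 0" "d \<noteq> 0"
  shows "mshift a b (mshift c d f) = mshift (c * a) (d * b) f"
  unfolding mshift_torus_map
  by (rule msubst_msubst[OF torus_auto_map torus_auto_map torus_auto_map])
    (use assms in \<open>auto simp: torus_map_def\<close>)

lemma mshift_1 [simp]: "mshift 1 1 f = f"
  unfolding mshift_torus_map using msubst_id[of f] by (simp add: torus_map_def case_prod_beta id_def)

lemma wact2_winv:
  assumes "p \<noteq> 0" shows "wact2 p (w, w') (wact2 p (winv w, winv w') f) = f"
proof -
  obtain l e m e' where w: "w = Weyl l e" "w' = Weyl m e'" by (metis weyl.exhaust)
  have "wact2 p (w, w') (wact2 p (winv w, winv w') f) = msubst (\<lambda>z. z) f"
    unfolding w winv.simps wact2_torus_map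
    by (rule msubst_msubst[OF torus_auto_map torus_auto_map torus_auto_id])
      (use assms in \<open>auto simp: torus2_mem torus_map_def power_int_minus\<close>)
  then show ?thesis by (simp add: msubst_id)
qed

lemma wact2_translation: "wact2 p (wt l, wt m) = mshift (p powi (- l)) (p powi m)"
  unfolding wact2_torus_map mshift_torus_map ..

lemma mconst_simps:
  "mconst (a + b) = mconst a + mconst b" "mconst (a * b) = mconst a * mconst b"
  "mconst (- a) = - mconst a" "mconst (a - b) = mconst a - mconst b"
  "mconst (inverse a) = inverse (mconst a)" "mconst 0 = 0" "mconst 1 = 1"
  by (transfer, simp add: mero2_eq_def mero2_const generically_True)+

lemma mconst_eq_0_iff [simp]: "mconst a = 0 \<longleftrightarrow> a = 0"
proof
  assume "mconst a = 0"
  show "a = 0"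
  proof (rule ccontr)
    assume "a \<noteq> 0"
    then have "mconst a * mconst (inverse a) = 1" by (simp add: mconst_simps(2)[symmetric] mconst_simps(7))
    with \<open>mconst a = 0\<close> show False by simp
  qed
qed (simp add: mconst_simps)

lemma not_generically: "\<not> generically P" if "\<And>z. z \<in> torus2 \<Longrightarrow> \<not> P z"
proof
  assume "generically P"
  then obtain U where "U \<noteq> {}" "U \<subseteq> torus2" "\<forall>z\<in>U. P z"
    unfolding generically_iff using open_torus2 by (metis Int_absorb torus2_mem empty_iff fst_conv snd_conv one_neq_zero)
  then show False using that by blast
qed

lemma mx_nonzero [simp]: "mx \<noteq> 0"
proof transfer
  show "\<not> mero2_eq fst (\<lambda>_. 0)"
    using not_generically[of "\<lambda>z. fst z = 0"] by (auto simp: mero2_eq_def torus2_mem)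
qed

lemma mxi_nonzero [simp]: "mxi \<noteq> 0"
proof transfer
  show "\<not> mero2_eq snd (\<lambda>_. 0)"
    using not_generically[of "\<lambda>z. snd z = 0"] by (auto simp: mero2_eq_def torus2_mem)
qed

section \<open>Evaluation of Laurent polynomials at meromorphic functions\<close>

lemma mconst_powi: "mconst (a powi n) = mconst a powi n"
proof -
  have *: "mconst (b ^ m) = mconst b ^ m" for b m by (induction m) (simp_all add: mconst_simps)
  show ?thesis by (simp add: power_int_def * mconst_simps)
qed

lemma laurent_eval_0 [simp]: "laurent_eval 0 z = 0"
  by (simp add: laurent_eval_def)

lemma laurent_eval_plus: "laurent_eval (f + g) z = laurent_eval f z + laurent_eval g z"
  unfolding laurent_eval_def by (rule setsum_keys_plus_distrib) (auto simp: mconst_simps distrib_right)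

lemma laurent_eval_single [simp]: "laurent_eval (lmon n c) z = mconst c * z powi n"
  by (simp add: laurent_eval_def)

lemma laurent_eval_const_mult: "laurent_eval (lmon 0 c * f) z = mconst c * laurent_eval f z"
  by (rule additive_eqI[where f = f and F = "\<lambda>f. laurent_eval (lmon 0 c * f) z"
        and G = "\<lambda>f. mconst c * laurent_eval f z"])
    (auto simp: laurent_eval_plus distrib_left lmon_mult mconst_simps)

lemma laurent_eval_minus: "laurent_eval (f - g) z = laurent_eval f z - laurent_eval g z"
  by (metis laurent_eval_plus diff_add_cancel eq_diff_eq)

text \<open>\<open>z\<close> is transcendental over the constants because a field endomorphism
  \<open>\<sigma>\<close> fixes the constants and doubles \<open>z\<close>: the polynomials
  vanishing at \<open>z\<close> are closed under the twist by 2, so the eigenvalue argument leaves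
  only 0.\<close>

lemma laurent_eval_nonzero:
  assumes \<sigma>: "\<And>f g. \<sigma> (f + g) = \<sigma> f + \<sigma> g" "\<And>f g. \<sigma> (f * g) = \<sigma> f * \<sigma> g"
    "\<And>f. \<sigma> (inverse f) = inverse (\<sigma> f)" "\<And>c. \<sigma> (mconst c) = mconst c" "\<sigma> z = mconst 2 * z"
    and z: "z \<noteq> 0" and f: "f \<noteq> 0"
  shows "laurent_eval f z \<noteq> 0"
proof
  assume "laurent_eval f z = 0"
  have pow: "\<sigma> (z powi n) = mconst (2 powi n) * z powi n" for n
  proof -
    have 1: "\<sigma> 1 = 1" using \<sigma>(4)[of 1] by (simp add: mconst_simps)
    have *: "\<sigma> (y ^ m) = \<sigma> y ^ m" for y m by (induction m) (simp_all add: \<sigma>(2) 1)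
    have "\<sigma> (z powi n) = \<sigma> z powi n" by (simp add: power_int_def * \<sigma>(3))
    then show ?thesis by (simp add: \<sigma>(5) mconst_powi power_int_mult_distrib)
  qed
  have tw: "laurent_eval (wact 2 (wt (- 1)) g) z = \<sigma> (laurent_eval g z)" for g
    by (rule additive_eqI[where f = g and F = "\<lambda>g. laurent_eval (wact 2 (wt (- 1)) g) z" and G = "\<lambda>g. \<sigma> (laurent_eval g z)"])
      (auto simp: laurent_eval_plus wact_add \<sigma> wact_lmon pow mconst_simps)
  have "\<sigma> 0 = 0" using \<sigma>(4)[of 0] by (simp add: mconst_simps)
  have "f = 0"
  proof (rule twist_closed_trivial[of 2 "{g. laurent_eval g z = 0}"])
    show "(2::complex) ^ n \<noteq> 1" if "n > 0" for n
    proof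
      assume "(2::complex) ^ n = 1"
      then have "norm ((2::complex) ^ n) = 1" by simp
      then have "(2::real) ^ n = 1" by (simp add: norm_power)
      then show False using that one_less_power[of "2::real" n] by simp
    qed
  qed (use \<open>laurent_eval f z = 0\<close> \<open>\<sigma> 0 = 0\<close> z in
      \<open>auto simp: laurent_eval_minus tw laurent_eval_const_mult power_int_eq_0_iff\<close>)
  with f show False by simp
qed

lemma laurent_eval_mx_nonzero: "f \<noteq> 0 \<Longrightarrow> laurent_eval f mx \<noteq> 0"
  by (rule laurent_eval_nonzero[where \<sigma> = "mshift 2 1"]) (simp_all add: mshift_simps)

lemma laurent_eval_mxi_nonzero: "f \<noteq> 0 \<Longrightarrow> laurent_eval f (inverse mxi) \<noteq> 0"
proof (rule laurent_eval_nonzero[where \<sigma> = "mshift 1 (inverse 2)"])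
  have nz: "(1::complex) \<noteq> 0" "inverse (2::complex) \<noteq> 0" by simp_all
  note m = mshift_simps[OF nz]
  show "mshift 1 (inverse 2) (inverse mxi) = mconst 2 * inverse mxi"
    unfolding m mconst_simps inverse_mult_distrib inverse_inverse_eq ..
  show "mshift 1 (inverse 2) (inverse g) = inverse (mshift 1 (inverse 2) g)" for g
    by (rule m)
qed (simp_all add: mshift_simps)

lemma laurent2_mero_plus: "laurent2_mero (a + b) = laurent2_mero a + laurent2_mero b"
  unfolding laurent2_mero_def case_prod_beta prod.collapse
  by (rule setsum_keys_plus_distrib[of "\<lambda>z c. mconst c * mx powi fst z * mxi powi snd z"])
    (simp_all add: mconst_simps distrib_right)

lemma laurent2_mero_single [simp]: "laurent2_mero (Poly_Mapping.single (m, n) c) = mconst c * mx powi m * mxi powi n"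
  by (simp add: laurent2_mero_def mconst_simps)

lemma laurent2_mero_0 [simp]: "laurent2_mero 0 = 0"
  by (simp add: laurent2_mero_def)

lemma laurent2_mero_const_mult: "laurent2_mero (Poly_Mapping.single (0, 0) c * a) = mconst c * laurent2_mero a"
  by (rule additive_eqI[where f = a and F = "\<lambda>a. laurent2_mero (Poly_Mapping.single (0, 0) c * a)"
        and G = "\<lambda>a. mconst c * laurent2_mero a"])
    (auto simp: laurent2_mero_plus distrib_left mult_single mconst_simps)

text \<open>Exchange of the two normalising factors, left and right in turn; \<open>v\<close> is the
  mixed term in which only one of them has been replaced.\<close>

lemma cross_cancel:
  fixes u v w :: "'a::field"
  assumes "f * u = e * v" "f' * v = e' * w" "e \<noteq> 0" "f \<noteq> 0" "e' \<noteq> 0" "f' \<noteq> 0"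
  shows "inverse e * inverse e' * u = inverse f * inverse f' * w"
proof -
  have "u = e * v / f" "v = e' * w / f'" using assms by (simp_all add: field_simps)
  then show ?thesis using assms by (simp add: field_simps)
qed

lemma vscale_simps:
  "vscale c (u + v) = vscale c u + vscale c v" "vscale (c + d) u = vscale c u + vscale d u"
  "vscale c (vscale d u) = vscale (c * d) u" "vscale 1 u = u" "fst (vscale c u) = c * fst u" "snd (vscale c u) = c * snd u"
  by (simp_all add: vscale_def distrib_left distrib_right mult.assoc)

definition mulop :: "laurent \<Rightarrow> op" where "mulop f g = f * g"

lemma subalg_mono:
  assumes "h \<in> subalg G" "G \<subseteq> subalg G'" shows "h \<in> subalg G'"
  using assms(1)
  by induction (use assms(2) in blast, (rule subalg.intros; assumption)+)

text \<open>A word of least length exists as soon as there is any word, so the word chosen in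
  \<open>dfac\<close> does spell \<open>w\<close>.\<close>

lemma reduced_expr_exists:
  assumes "\<exists>js. \<exists>\<omega>\<in>\<Omega>. w = prod_list (map s js) * \<omega>"
  shows "reduced_expr s \<Omega> w (SOME js. reduced_expr s \<Omega> w js)"
proof -
  obtain js where "\<exists>\<omega>\<in>\<Omega>. w = prod_list (map s js) * \<omega>" using assms by blast
  from ex_has_least_nat[of "\<lambda>js. \<exists>\<omega>\<in>\<Omega>. w = prod_list (map s js) * \<omega>", OF this, of length]
  show ?thesis unfolding reduced_expr_def by (intro someI_ex[of "reduced_expr s \<Omega> w", unfolded reduced_expr_def]) blast
qed

text \<open>The products \<open>s_0 s_1\<close> and \<open>s_1 s_0\<close> are the translations by
  \<open>a\<close> and \<open>-a\<close>, so only translation parts from 0 to \<open>a - 1\<close>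
  remain: \<open>a = 2\<close> in type A, where \<open>u\<close> supplies the odd ones, and
  \<open>a = 1\<close> in type C.\<close>

lemma expr_exists:
  assumes s: "s I1 = ws1" "s I0 = Weyl a True"
    and base: "\<And>e r. 0 \<le> r \<Longrightarrow> r < a \<Longrightarrow> \<exists>js. \<exists>\<omega>\<in>\<Omega>. Weyl r e = prod_list (map s js) * \<omega>"
    and "a > 0"
  shows "\<exists>js. \<exists>\<omega>\<in>\<Omega>. w = prod_list (map s js) * \<omega>"
proof -
  define P where "P w \<longleftrightarrow> (\<exists>js. \<exists>\<omega>\<in>\<Omega>. w = prod_list (map s js) * \<omega>)" for w
  have step: "P (s j * w)" if "P w" for j w
  proof -
    from that obtain js where "\<exists>\<omega>\<in>\<Omega>. w = prod_list (map s js) * \<omega>" unfolding P_def by (elim exE)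
    then obtain \<omega> where "\<omega> \<in> \<Omega>" "w = prod_list (map s js) * \<omega>" by (elim bexE)
    then have "s j * w = prod_list (map s (j # js)) * \<omega>" by (simp add: mult.assoc)
    then show ?thesis using \<open>\<omega> \<in> \<Omega>\<close> unfolding P_def by blast
  qed
  have up: "P (Weyl (l + a) e)" "P (Weyl (l - a) e)" if "P (Weyl l e)" for l e
    using step[OF step[OF that, of I1], of I0] step[OF step[OF that, of I0], of I1] by (simp_all add: s add.commute)
  obtain l e where w: "w = Weyl l e" by (metis weyl.exhaust)
  have "P (Weyl (l mod a + m * a) e)" for m
  proof (induction m rule: int_induct[where k = 0])
    case base
    then show ?case using assms(3)[of "l mod a" e] \<open>a > 0\<close> by (simp add: P_def)
  next
    case (step1 i)
    then show ?case using up(1)[of "l mod a + i * a" e] by (simp add: algebra_simps)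
  next
    case (step2 i)
    then show ?case using up(2)[of "l mod a + i * a" e] by (simp add: algebra_simps)
  qed
  from this[of "l div a"] show ?thesis by (simp add: w P_def)
qed

context rank_one_daha
begin

section \<open>The bispectral qKZ cocycle\<close>

definition cr :: "op \<Rightarrow> H0K" where
  "cr h = (case coords h of (a, b) \<Rightarrow> (laurent2_mero a, laurent2_mero b))"

lemma laurent2_act_standard: "standard D \<Longrightarrow> laurent2_act D a h = act a h"
  by (rule ext) (simp add: laurent2_act_def act_def standard_def)

lemma coord_standard: "standard D \<Longrightarrow> coord D h = cr h"
  unfolding coord_def cr_def coords_def by (simp add: laurent2_act_standard) (simp add: standard_def)

lemma cr_pbw: "cr (pbw m e n) = (if e then (0, mx powi m * mxi powi n) else (mx powi m * mxi powi n, 0))"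
  unfolding pbw_rep cr_def coords_rep by (simp add: mconst_simps)

lemma cr_add: "g \<in> pbw_span \<Longrightarrow> h \<in> pbw_span \<Longrightarrow> cr (op_add g h) = cr g + cr h"
proof -
  assume "g \<in> pbw_span" "h \<in> pbw_span"
  then obtain a b a' b' where "g = rep a b" "h = rep a' b'" by (metis span_repr)
  then show ?thesis by (simp only: rep_plus cr_def coords_rep prod.case laurent2_mero_plus plus_prod_def fst_conv snd_conv)
qed

lemma cr_scale: "g \<in> pbw_span \<Longrightarrow> cr (op_scale c g) = vscale (mconst c) (cr g)"
proof -
  assume "g \<in> pbw_span"
  then obtain a b where "g = rep a b" by (metis span_repr)
  then show ?thesis by (simp only: rep_scale cr_def coords_rep prod.case laurent2_mero_const_mult vscale_def fst_conv snd_conv)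
qed

lemma cr_Xpow: "h \<in> pbw_span \<Longrightarrow> cr (Xpow m \<circ> h) = vscale (mx powi m) (cr h)"
proof (induction rule: linear_closure_induct)
  case (pbw i e n)
  have *: "Xpow m \<circ> pbw i e n = pbw (m + i) e n"
    by (rule ext) (simp add: Xpow_def pbw_shift)
  show ?case unfolding * cr_pbw by (simp add: vscale_def power_int_add mult.assoc)
next
  case (add g h)
  have *: "Xpow m \<circ> op_add g h = op_add (Xpow m \<circ> g) (Xpow m \<circ> h)"
    by (rule ext) (simp add: op_add_def Xpow_def distrib_left)
  show ?case unfolding * cr_add[OF x_span[OF add(1)] x_span[OF add(2)]] cr_add[OF add(1,2)] add(3,4)
    by (simp only: vscale_simps)
next
  case (scale c g)
  have *: "Xpow m \<circ> op_scale c g = op_scale c (Xpow m \<circ> g)"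
    by (rule ext) (simp add: op_scale_def Xpow_def mult.left_commute)
  show ?case unfolding * cr_scale[OF x_span[OF scale(1)]] cr_scale[OF scale(1)] scale(2)
    by (simp only: vscale_simps mult.commute)
qed

lemma Yp_right_span: "h \<in> pbw_span \<Longrightarrow> h \<circ> Yp m \<in> pbw_span"
  by (intro comp_span gens_span)

lemma cr_Yp: "h \<in> pbw_span \<Longrightarrow> cr (h \<circ> Yp m) = vscale (mxi powi m) (cr h)"
proof (induction rule: linear_closure_induct)
  case (pbw i e n)
  have *: "pbw i e n \<circ> Yp m = pbw i e (n + m)"
    by (rule ext) (simp add: pbw_right)
  show ?case unfolding * cr_pbw by (simp add: vscale_def power_int_add ac_simps)
next
  case (add g h)
  have *: "op_add g h \<circ> Yp m = op_add (g \<circ> Yp m) (h \<circ> Yp m)"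
    by (rule ext) (simp add: op_add_def)
  show ?case unfolding * cr_add[OF Yp_right_span[OF add(1)] Yp_right_span[OF add(2)]] cr_add[OF add(1,2)] add(3,4)
    by (simp only: vscale_simps)
next
  case (scale c g)
  have *: "op_scale c g \<circ> Yp m = op_scale c (g \<circ> Yp m)"
    by (rule ext) (simp add: op_scale_def)
  show ?case unfolding * cr_scale[OF Yp_right_span[OF scale(1)]] cr_scale[OF scale(1)] scale(2)
    by (simp only: vscale_simps mult.commute)
qed

lemma mulop_plus: "mulop (f + g) = op_add (mulop f) (mulop g)" and mulop_lmon: "mulop (lmon n c) = op_scale c (Xpow n)"
  by (rule ext, simp add: mulop_def op_add_def op_scale_def Xpow_def distrib_right mult.assoc[symmetric] lmon_mult)+

lemma mulop_0: "mulop 0 = op_scale 0 id"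
  by (rule ext) (simp add: mulop_def op_scale_def)

lemma mulop_span: "mulop f \<in> pbw_span"
proof (induction f rule: poly_mapping_additive_induct)
  case zero
  show ?case unfolding mulop_0 by (intro pbw_span.intros id_span)
next
  case (single n c)
  show ?case unfolding mulop_lmon by (intro pbw_span.intros gens_span)
next
  case (add f g)
  show ?case unfolding mulop_plus by (intro pbw_span.intros add)
qed

lemma cr_mulop_left: "h \<in> pbw_span \<Longrightarrow> cr (mulop f \<circ> h) = vscale (laurent_eval f mx) (cr h)"
proof (induction f rule: poly_mapping_additive_induct)
  case zero
  have *: "mulop 0 \<circ> h = op_scale 0 h" by (rule ext) (simp add: mulop_def op_scale_def)
  show ?case unfolding * using zero by (simp add: cr_scale mconst_simps laurent_eval_def)
next
  case (single n c)
  have *: "mulop (lmon n c) \<circ> h = op_scale c (Xpow n \<circ> h)"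
    unfolding mulop_lmon by (rule ext) (simp add: op_scale_def)
  show ?case unfolding * cr_scale[OF x_span[OF single]] cr_Xpow[OF single] laurent_eval_single vscale_simps ..
next
  case (add f g)
  have *: "mulop (f + g) \<circ> h = op_add (mulop f \<circ> h) (mulop g \<circ> h)"
    unfolding mulop_plus by (rule ext) (simp add: op_add_def)
  note sp = comp_span[OF mulop_span add(3)]
  show ?case unfolding * cr_add[OF sp sp] add(1)[OF add(3)] add(2)[OF add(3)] laurent_eval_plus vscale_simps ..
qed

text \<open>The dual of \<open>f(X)\<close> is \<open>f(Y^(-1))\<close>, and \<open>Y\<close> on the
  right of a basis element acts as \<open>\<xi>\<close>. This is the origin of the argument
  \<open>1/\<xi>\<close> in the normalisation of \<open>tau\<close>.\<close>

lemma cr_mulop_right: "h \<in> pbw_span \<Longrightarrow> cr (h \<circ> dual (mulop f)) = vscale (laurent_eval f (inverse mxi)) (cr h)"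
proof (induction f rule: poly_mapping_additive_induct)
  case zero
  have *: "h \<circ> dual (mulop 0) = op_scale 0 h"
    unfolding mulop_0 dual_scale[OF id_span] using span_linear[OF zero, of _ _ 0] by (intro ext) (simp add: op_scale_def)
  show ?case unfolding * using zero by (simp add: cr_scale mconst_simps laurent_eval_def)
next
  case (single n c)
  have *: "h \<circ> dual (mulop (lmon n c)) = op_scale c (h \<circ> Yp (- n))"
    unfolding mulop_lmon dual_scale[OF gens_span(1)] dual_gens
    by (rule ext) (simp add: op_scale_def span_linear[OF single])
  have "mxi powi (- n) = inverse mxi powi n" by (simp add: power_int_minus power_int_inverse)
  then show ?case unfolding * cr_scale[OF Yp_right_span[OF single]] cr_Yp[OF single] laurent_eval_single vscale_simps by simp
next
  case (add f g)
  have *: "h \<circ> dual (mulop (f + g)) = op_add (h \<circ> dual (mulop f)) (h \<circ> dual (mulop g))"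
    unfolding mulop_plus dual_add[OF mulop_span mulop_span]
    by (rule ext) (simp add: op_add_def span_linear[OF add(3)])
  note sp = comp_span[OF add(3) dual_span[OF mulop_span]]
  show ?case unfolding * cr_add[OF sp sp] add(1)[OF add(3)] add(2)[OF add(3)] laurent_eval_plus vscale_simps ..
qed

section \<open>Independence of the cocycle from the normalising factors\<close>

definition twisted :: "laurent \<Rightarrow> weyl \<Rightarrow> op" where
  "twisted e w = mulop e \<circ> wact q w"

text \<open>The two properties of \<open>d_w\<close> on which the cocycle depends: it can be divided
  by, and \<open>d_w w\<close> lies in the algebra.\<close>

definition admissible :: "laurent \<Rightarrow> weyl \<Rightarrow> bool" where
  "admissible e w \<longleftrightarrow> e \<noteq> 0 \<and> twisted e w \<in> pbw_span"

definition ncr :: "laurent \<Rightarrow> weyl \<Rightarrow> laurent \<Rightarrow> weyl \<Rightarrow> op \<Rightarrow> H0K" where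
  "ncr e w e' w' h = vscale (inverse (laurent_eval e mx) * inverse (laurent_eval e' (inverse mxi)))
     (cr (twisted e w \<circ> h \<circ> dual (twisted e' w')))"

text \<open>The equality \<open>f (e w) = e (f w)\<close> holds on the left, and duality carries its
  analogue for \<open>w'\<close> to the right. One side is exchanged at a time, with
  \<open>?B h ?A'\<close> in between; transcendence of \<open>x\<close> and \<open>1/\<xi>\<close>
  allows the division.\<close>

lemma ncr_indep:
  assumes "admissible e w" "admissible f w" "admissible e' w'" "admissible f' w'" "h \<in> pbw_span"
  shows "ncr e w e' w' h = ncr f w f' w' h"
proof -
  let ?A = "twisted e w" and ?B = "twisted f w" and ?A' = "dual (twisted e' w')" and ?B' = "dual (twisted f' w')"
  have sp: "?A \<in> pbw_span" "?B \<in> pbw_span" "?A' \<in> pbw_span" "?B' \<in> pbw_span"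
    using assms unfolding admissible_def by (auto intro: dual_span)
  have nz: "laurent_eval e mx \<noteq> 0" "laurent_eval f mx \<noteq> 0"
      "laurent_eval e' (inverse mxi) \<noteq> 0" "laurent_eval f' (inverse mxi) \<noteq> 0"
    using assms by (auto simp: admissible_def laurent_eval_mx_nonzero laurent_eval_mxi_nonzero)
  have l: "mulop f \<circ> (?A \<circ> h \<circ> ?A') = mulop e \<circ> (?B \<circ> h \<circ> ?A')"
    by (rule ext) (simp add: twisted_def mulop_def mult.left_commute)
  have "mulop f' \<circ> twisted e' w' = mulop e' \<circ> twisted f' w'"
    by (rule ext) (simp add: twisted_def mulop_def mult.left_commute)
  then have "?A' \<circ> dual (mulop f') = ?B' \<circ> dual (mulop e')"
    using dual_anti[of "mulop f'" "twisted e' w'"] dual_anti[of "mulop e'" "twisted f' w'"] assms mulop_span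
    unfolding alg_eq_span admissible_def by (simp only:)
  then have r: "(?B \<circ> h \<circ> ?A') \<circ> dual (mulop f') = (?B \<circ> h \<circ> ?B') \<circ> dual (mulop e')"
    by (simp only: comp_assoc)
  have 1: "vscale (laurent_eval f mx) (cr (?A \<circ> h \<circ> ?A')) = vscale (laurent_eval e mx) (cr (?B \<circ> h \<circ> ?A'))"
    using cr_mulop_left[OF comp_span[OF comp_span[OF sp(1) assms(5)] sp(3)], of f]
      cr_mulop_left[OF comp_span[OF comp_span[OF sp(2) assms(5)] sp(3)], of e] l by (simp only:)
  have 2: "vscale (laurent_eval f' (inverse mxi)) (cr (?B \<circ> h \<circ> ?A')) = vscale (laurent_eval e' (inverse mxi)) (cr (?B \<circ> h \<circ> ?B'))"
    using cr_mulop_right[OF comp_span[OF comp_span[OF sp(2) assms(5)] sp(3)], of f']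
      cr_mulop_right[OF comp_span[OF comp_span[OF sp(2) assms(5)] sp(4)], of e'] r by (simp only:)
  show ?thesis
    using 1 2 nz unfolding ncr_def vscale_def by (auto intro!: cross_cancel)
qed

definition dfac_ok :: "daha \<Rightarrow> bool" where
  "dfac_ok D \<longleftrightarrow> (\<forall>w. admissible (dfac D w) w)"

text \<open>The action of the inverse of \<open>(w, w')\<close> on the coefficients undoes the one
  inside \<open>tau\<close>, which leaves a linear map given by two columns. By independence these
  may be computed with any admissible factors.\<close>

lemma Cmat_eq:
  assumes D: "standard D" "dfac_ok D" and e: "admissible e w" "admissible e' w'"
  shows "Cmat D D (w, w') v = vscale (fst v) (ncr e w e' w' id) + vscale (snd v) (ncr e w e' w' T)"
proof -
  have S: "step D = q" "T1op D = T" using D unfolding standard_def by auto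
  have St: "Stilde D w = twisted (dfac D w) w" for w
    by (rule ext) (simp add: Stilde_def twisted_def mulop_def S)
  have ok: "admissible (dfac D w) w" for w using D(2) unfolding dfac_ok_def by blast
  have star: "star D D (twisted (dfac D w') w') = dual (twisted (dfac D w') w')"
    by (rule star_eq_dual[OF D(1)]) (use ok in \<open>simp only: admissible_def alg_eq_span\<close>)
  have n: "ncr (dfac D w) w (dfac D w') w' h = ncr e w e' w' h" if "h \<in> pbw_span" for h
    by (rule ncr_indep[OF ok e(1) ok e(2) that])
  have "Cmat D D (w, w') v = vscale (fst v) (ncr (dfac D w) w (dfac D w') w' id)
      + vscale (snd v) (ncr (dfac D w) w (dfac D w') w' T)"
    unfolding Cmat_def tau_def St coord_standard[OF D(1)] ncr_def S Let_def prod.case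
    by (simp add: wact2_winv[OF q0] vscale_simps mult.commute star)
  then show ?thesis unfolding n[OF id_span] n[OF gens_span(2)] .
qed

lemma bqKZ_solutions_cong:
  assumes "standard D" "dfac_ok D" "standard E" "dfac_ok E"
  shows "bqKZ_solutions D D = bqKZ_solutions E E"
proof -
  have "Cmat D D (w, w') v = Cmat E E (w, w') v" for w w' v
  proof -
    have a: "admissible (dfac D w) w" for w using assms(2) unfolding dfac_ok_def by blast
    show ?thesis unfolding Cmat_eq[OF assms(1,2) a a] Cmat_eq[OF assms(3,4) a a] ..
  qed
  moreover have "step D = step E" using assms unfolding standard_def by simp
  ultimately show ?thesis unfolding bqKZ_solutions_def by (simp only:)
qed

text \<open>Since \<open>(d v)(e w) = d (v e) v w\<close>, the recursion of
  \<open>word_factor\<close> is composition of operators, and the span is closed under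
  composition.\<close>

lemma admissible_word:
  assumes "\<And>j. admissible (d j) (s' j)" "wact q \<omega> \<in> pbw_span"
  shows "admissible (word_factor q s' d js) (prod_list (map s' js) * \<omega>)"
proof (induction js)
  case Nil
  have "twisted 1 \<omega> = wact q \<omega>" by (rule ext) (simp add: twisted_def mulop_def)
  then show ?case using assms(2) by (simp add: admissible_def)
next
  case (Cons j js)
  have "twisted (word_factor q s' d (j # js)) (prod_list (map s' (j # js)) * \<omega>)
      = twisted (d j) (s' j) \<circ> twisted (word_factor q s' d js) (prod_list (map s' js) * \<omega>)"
    by (rule ext) (simp add: twisted_def mulop_def wact_mult[OF q0] mult.assoc wact_times[OF q0])
  then show ?case using Cons assms(1)[of j] unfolding admissible_def by (simp add: comp_span q0)
qed

lemma dfac_okI: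
  assumes "\<And>j. admissible (d j) (s' j)" "\<And>\<omega>. \<omega> \<in> \<Omega> \<Longrightarrow> wact q \<omega> \<in> pbw_span"
    and "\<And>w. \<exists>js. \<exists>\<omega>\<in>\<Omega>. w = prod_list (map s' js) * \<omega>"
    and "dfac D = (\<lambda>w. word_factor q s' d (SOME js. reduced_expr s' \<Omega> w js))"
  shows "dfac_ok D"
  unfolding dfac_ok_def assms(4)
proof
  fix w
  obtain \<omega> where \<omega>: "\<omega> \<in> \<Omega>" "w = prod_list (map s' (SOME js. reduced_expr s' \<Omega> w js)) * \<omega>"
    using reduced_expr_exists[OF assms(3)[of w]] unfolding reduced_expr_def by blast
  from admissible_word[of d s', OF assms(1) assms(2)[OF \<omega>(1)], of "SOME js. reduced_expr s' \<Omega> w js"] \<omega>(2)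
  show "admissible (word_factor q s' d (SOME js. reduced_expr s' \<Omega> w js)) w" by (simp only:)
qed

end

lemma lmon_diff_nonzero: "a \<noteq> 0 \<Longrightarrow> n \<noteq> 0 \<Longrightarrow> lmon 0 a - lmon n b \<noteq> 0"
proof
  assume "a \<noteq> 0" "n \<noteq> 0" "lmon 0 a - lmon n b = 0"
  then have "Poly_Mapping.lookup (lmon 0 a - lmon n b) 0 = 0" by simp
  with \<open>a \<noteq> 0\<close> \<open>n \<noteq> 0\<close> show False by (simp add: lookup_minus lookup_single_if)
qed

lemma two_term_nonzero:
  assumes "a \<noteq> 0" "n \<noteq> 0"
  shows "mconst a - mconst b * mx powi n \<noteq> 0" "mconst a - mconst b * inverse mxi powi n \<noteq> 0"
  using laurent_eval_mx_nonzero[OF lmon_diff_nonzero[OF assms]] laurent_eval_mxi_nonzero[OF lmon_diff_nonzero[OF assms]]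
  by (simp_all add: laurent_eval_minus)

section \<open>The two types realised in the same algebra\<close>

context rank_one_daha
begin

lemma wact_wu: "wact q wu = U"
  by (rule ext) (simp add: U_A_def)

lemma U_1 [simp]: "U 1 = 1"
  by (simp add: U_A_def)

lemma U_x: "U x = lmon 0 q * xi"
  by (simp_all add: U_lmon lmon_mult power_int_minus)

lemma d_A_I1: "d_A k q I1 = lmon 0 (inverse k) - lmon 0 k * x * x"
  by (simp add: d_A_def lmon_mult)

lemma U_d_A: "U (d_A k q I1) = d_A k q I0"
  unfolding d_A_def by (simp add: U_minus U_mult U_lmon power2_eq_square power_int_def)

lemma U_s_U: "wact q ws0_A f = U (s (U f))"
  unfolding wact_wu[symmetric] wact_times[OF q0, symmetric] by simp

text \<open>Conjugating the characterisation of \<open>T\<close> by \<open>U\<close> gives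
  \<open>T_0 = U T_1 U\<close>. Hence \<open>T_0\<close> is redundant as a generator in type A, and
  the generators that remain are those of the specialised type C.\<close>

lemma T_A_I0: "T_A k q I0 = U \<circ> T \<circ> U"
proof (rule ext)
  fix f
  have z: "U (x * x) = x_A q I0" by (simp add: U_lmon lmon_mult power2_eq_square power_int_def)
  have "U ((1 - x * x) * T (U f)) = U (d_A k q I1 * s (U f) + \<kappa> * U f)"
    unfolding T_char d_A_I1 ..
  then have *: "(1 - x_A q I0) * U (T (U f)) = d_A k q I0 * U (s (U f)) + \<kappa> * f"
    using z by (simp add: U_mult U_minus U_add U_d_A)
  have "T_A k q I0 f = U (T (U f))"
    unfolding T_A_def[of k q I0]
  proof (rule hecke_opI)
    show "x_A q I0 \<noteq> 1" by (simp add: lmon_neq_1)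
    have "\<kappa> = lmon 0 k * (1 - x_A q I0) - d_A k q I0"
      by (simp add: d_A_def single_diff right_diff_distrib)
    then show "(1 - x_A q I0) * U (T (U f)) =
        d_A k q I0 * wact q (s_A I0) f + (lmon 0 k * (1 - x_A q I0) - d_A k q I0) * f"
      using * by (simp only: s_A.simps U_s_U)
  qed
  then show "T_A k q I0 f = (U \<circ> T \<circ> U) f" by simp
qed

lemma standard_A: "standard (daha_A k q)"
proof -
  have "{T, T_A k q I0, U, Xpow 1, Xpow (- 1)} \<subseteq> algA"
  proof -
    have "T_A k q I0 \<in> algA" unfolding T_A_I0 by (intro subalg.intros(5) T_alg U_alg)
    then show ?thesis using T_alg U_alg Xpow_alg by blast
  qed
  moreover have "{T, U, Xpow 1, Xpow (- 1)} \<subseteq> subalg {T, T_A k q I0, U, Xpow 1, Xpow (- 1)}"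
    by (intro subsetI subalg.intros(1)) blast
  ultimately have "subalg {T, T_A k q I0, U, Xpow 1, Xpow (- 1)} = algA"
    by (intro equalityI subsetI) (erule subalg_mono, assumption)+
  then show ?thesis by (simp add: standard_def daha_A_def Y_eq)
qed

lemma d_C_one: "d_C k 1 y = lmon 0 (inverse k) - lmon 0 k * y^2"
proof -
  have e: "lmon 0 (inverse k) * lmon 0 k = 1" by (simp add: lmon_mult k0)
  have "d_C k 1 y = lmon 0 (inverse k) - (lmon 0 (inverse k) * lmon 0 k) * lmon 0 k * y^2"
    by (simp add: d_C_def algebra_simps power2_eq_square)
  then show ?thesis unfolding e by simp
qed

text \<open>The numerator equals the denominator of \<open>c\<close>, so \<open>c = 1\<close>,
  \<open>b = 0\<close>, and the Hecke operator is the bare reflection.\<close>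

lemma d_C_one_one: "d_C 1 1 y = 1 - y^2"
  by (simp add: d_C_def algebra_simps power2_eq_square)

lemma T_C_gens:
  assumes "r^2 = q"
  shows "T_C k 1 1 1 r I1 = T" "T_C k 1 1 1 r I0 = U"
    "d_CC k 1 1 1 r I1 = d_A k q I1"
proof -
  have sq: "(lmon 1 1)\<^sup>2 = lmon 2 (1::complex)" by (simp add: power2_eq_square lmon_mult)
  show d: "d_CC k 1 1 1 r I1 = d_A k q I1" by (simp add: d_C_one d_A_def sq)
  show "T_C k 1 1 1 r I1 = T" unfolding T_C.simps d T_A_def assms by (simp add: sq)
  show "T_C k 1 1 1 r I0 = U"
  proof
    fix f
    have "(lmon (- 1) r)\<^sup>2 \<noteq> 1" by (simp add: power2_eq_square lmon_mult lmon_neq_1)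
    then have "hecke_op q 1 (d_C 1 1 (lmon (- 1) r)) ((lmon (- 1) r)\<^sup>2) wu f = U f"
      by (intro hecke_opI) (simp_all add: d_C_one_one U_A_def)
    then show "T_C k 1 1 1 r I0 f = U f" by (simp add: assms)
  qed
qed

lemma standard_C: "r^2 = q \<Longrightarrow> standard (daha_C k 1 1 1 r)"
  by (simp add: standard_def daha_C_def T_C_gens Y_eq del: T_C.simps)

lemma d_A_nonzero: "d_A k q j \<noteq> 0"
  using lmon_diff_nonzero[of "inverse k" 2 k] lmon_diff_nonzero[of "inverse k" "- 2" "k * q^2"] k0
  by (cases j) (simp_all add: d_A_def lmon_mult)

text \<open>By the characterisation of \<open>T\<close> this intertwiner is
  \<open>(1 - X^2) T - \<kappa>\<close>, a combination of basis elements.\<close>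

lemma admissible_I1: "admissible (d_A k q I1) ws1"
proof -
  have *: "twisted (d_A k q I1) ws1 = op_add T (op_add (op_scale (- 1) (Xpow 2 \<circ> T)) (op_scale (inverse k - k) id))"
  proof
    fix f
    have "d_A k q I1 * s f = (1 - x * x) * T f - \<kappa> * f" unfolding T_char d_A_I1 by simp
    then show "twisted (d_A k q I1) ws1 f = op_add T (op_add (op_scale (- 1) (Xpow 2 \<circ> T)) (op_scale (inverse k - k) id)) f"
      by (simp add: twisted_def mulop_def op_add_def op_scale_def Xpow_def lmon_mult single_diff algebra_simps single_uminus)
  qed
  have "twisted (d_A k q I1) ws1 \<in> pbw_span"
    unfolding * by (intro pbw_span.intros x_span gens_span id_span)
  then show ?thesis by (simp add: admissible_def d_A_nonzero)
qed

lemma admissible_A: "admissible (d_A k q j) (s_A j)"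
proof (cases j)
  case I0
  have *: "twisted (d_A k q I0) ws0_A = U \<circ> twisted (d_A k q I1) ws1 \<circ> U"
    by (rule ext) (simp add: twisted_def mulop_def U_s_U U_mult U_d_A)
  have "twisted (d_A k q I0) ws0_A \<in> pbw_span"
    unfolding * using admissible_I1 by (intro comp_span gens_span) (simp add: admissible_def)
  then show ?thesis by (simp add: I0 admissible_def d_A_nonzero)
qed (simp add: admissible_I1)

lemma wact_one_span: "wact q 1 \<in> pbw_span"
proof -
  have "wact q 1 = id" by (rule ext) simp
  then show ?thesis using id_span by (simp only:)
qed

lemma dfac_ok_A: "dfac_ok (daha_A k q)"
proof (rule dfac_okI)
  show "admissible (d_A k q j) (s_A j)" for j by (rule admissible_A)
  show "wact q \<omega> \<in> pbw_span" if "\<omega> \<in> {1, wu}" for \<omega>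
    using that wact_one_span gens_span(4) wact_wu by (metis insertE singletonD)
  show "\<exists>js. \<exists>\<omega>\<in>{1, wu}. w = prod_list (map s_A js) * \<omega>" for w
  proof (rule expr_exists)
    fix e and m :: int assume "0 \<le> m" "m < 2"
    then consider "m = 0" "\<not> e" | "m = 0" e | "m = 1" e | "m = 1" "\<not> e" by linarith
    then show "\<exists>js. \<exists>\<omega>\<in>{1, wu}. Weyl m e = prod_list (map s_A js) * \<omega>"
    proof cases
      case 1 then show ?thesis by (intro exI[of _ "[]"] bexI[of _ 1]) (simp_all add: one_weyl_def)
    next
      case 2 then show ?thesis by (intro exI[of _ "[I1]"] bexI[of _ 1]) (simp_all add: one_weyl_def)
    next
      case 3 then show ?thesis by (intro exI[of _ "[]"] bexI[of _ wu]) (simp_all add: one_weyl_def)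
    next
      case 4 then show ?thesis by (intro exI[of _ "[I0]"] bexI[of _ wu]) (simp_all add: one_weyl_def)
    qed
  qed simp_all
qed (simp add: daha_A_def)

lemma dfac_ok_C:
  assumes "r^2 = q" shows "dfac_ok (daha_C k 1 1 1 r)"
proof (rule dfac_okI)
  show "admissible (d_CC k 1 1 1 r j) (s_C j)" for j
  proof (cases j)
    case I1
    then show ?thesis using admissible_I1 T_C_gens(3)[OF assms] by simp
  next
    case I0
    \<comment> \<open>In type C the reflection \<open>s_0\<close> acts as \<open>U\<close>, which is
      itself in the algebra, so only nonvanishing of the factor has to be seen.\<close>
    have "d_CC k 1 1 1 r I0 = lmon 0 1 - lmon (- 2) (r^2)"
      by (simp add: d_C_one_one power2_eq_square lmon_mult)
    then have "d_CC k 1 1 1 r I0 \<noteq> 0" using lmon_diff_nonzero[of 1 "- 2" "r^2"] by simp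
    then show ?thesis
      unfolding I0 admissible_def twisted_def s_C.simps wact_wu using comp_span[OF mulop_span gens_span(4)] by blast
  qed
  show "wact q \<omega> \<in> pbw_span" if "\<omega> \<in> {1}" for \<omega>
    using that wact_one_span by blast
  show "\<exists>js. \<exists>\<omega>\<in>{1}. w = prod_list (map s_C js) * \<omega>" for w
  proof (rule expr_exists)
    fix e and m :: int assume "0 \<le> m" "m < 1"
    then consider "m = 0" "\<not> e" | "m = 0" e by linarith
    then show "\<exists>js. \<exists>\<omega>\<in>{1}. Weyl m e = prod_list (map s_C js) * \<omega>"
    proof cases
      case 1 then show ?thesis by (intro exI[of _ "[]"] bexI[of _ 1]) (simp_all add: one_weyl_def)
    next
      case 2 then show ?thesis by (intro exI[of _ "[I1]"] bexI[of _ 1]) (simp_all add: one_weyl_def)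
    qed
  qed simp_all
qed (simp add: daha_C_def assms)

lemma SOL_bqKZ_eq: "r^2 = q \<Longrightarrow> SOL_bqKZ_C k 1 1 1 r = SOL_bqKZ_A k q"
  unfolding SOL_bqKZ_C_def SOL_bqKZ_A_def
  by (intro bqKZ_solutions_cong standard_A standard_C dfac_ok_A dfac_ok_C)

section \<open>The translations of length one\<close>

abbreviation K :: mero where "K \<equiv> mconst k"

text \<open>The equation of the basic translation in \<open>x\<close> has \<open>t = q / x\<close> and \<open>\<eta> = \<xi>\<close>, the one in \<open>\<xi>\<close>
  has \<open>t = q \<xi>\<close> and \<open>\<eta> = x\<^sup>-\<^sup>1\<close>.\<close>

definition qkz_rel :: "mero \<Rightarrow> mero \<Rightarrow> H0K \<Rightarrow> H0K \<Rightarrow> bool" where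
  "qkz_rel t \<eta> f g \<longleftrightarrow>
     fst f = inverse (inverse K - K * t^2) * (fst g * ((1 - t^2) * \<eta>) - snd g * ((K - inverse K) * t^2 * \<eta>)) \<and>
     snd f = inverse (inverse K - K * t^2) * (fst g * ((inverse K - K) * inverse \<eta>) + snd g * ((1 - t^2) * inverse \<eta>))"

lemma wact_wt1: "wact q (wt 1) f = U (s f)"
  unfolding wact_wu[symmetric] wact_times[OF q0, symmetric] by simp

text \<open>As \<open>t(1) = u s_1\<close>, this operator is \<open>U\<close> applied after
  \<open>(1 - X^2) T - \<kappa>\<close>, that is \<open>(1 - q^2 X^(-2)) Y - \<kappa> U\<close> with
  \<open>U = T Y^(-1)\<close>.\<close>

lemma twisted_wt1:
  "twisted (d_A k q I0) (wt 1) =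
    op_add (pbw 0 False 1) (op_add (op_scale (- (q^2)) (pbw (- 2) False 1)) (op_scale (inverse k - k) (pbw 0 True (- 1))))"
proof
  fix f
  have "d_A k q I1 * s f = (1 - x * x) * T f - \<kappa> * f" unfolding T_char d_A_I1 by simp
  then have "U (d_A k q I1 * s f) = (1 - U x * U x) * Y f - \<kappa> * U f"
    by (simp add: U_mult U_minus Y_def)
  moreover have "twisted (d_A k q I0) (wt 1) f = U (d_A k q I1 * s f)"
    by (simp add: twisted_def mulop_def wact_wt1 U_mult U_d_A)
  moreover have "(1 - U x * U x) * Y f - \<kappa> * U f = op_add (pbw 0 False 1)
      (op_add (op_scale (- (q^2)) (pbw (- 2) False 1)) (op_scale (inverse k - k) (pbw 0 True (- 1)))) f"
    by (simp add: U_x pbw_def op_add_def op_scale_def T_Yi lmon_mult single_diff single_uminus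
        power2_eq_square algebra_simps mult_single[symmetric])
  ultimately show "twisted (d_A k q I0) (wt 1) f =
    op_add (pbw 0 False 1) (op_add (op_scale (- (q^2)) (pbw (- 2) False 1)) (op_scale (inverse k - k) (pbw 0 True (- 1)))) f"
    by (simp only:)
qed

lemma Y_T: "Y (T f) = U f + \<kappa> * Y f"
  by (simp add: Y_def T_sq U_add U_mult)

text \<open>Here \<open>Y T = T Y^(-1) + \<kappa> Y\<close>, and its last term cancels against
  \<open>\<kappa> U T = \<kappa> Y\<close>, except for the part multiplied by
  \<open>q^2 X^(-2)\<close>.\<close>

lemma twisted_wt1_T:
  "twisted (d_A k q I0) (wt 1) \<circ> T =
    op_add (pbw 0 True (- 1)) (op_add (op_scale (- (q^2)) (pbw (- 2) True (- 1))) (op_scale (- (q^2) * (k - inverse k)) (pbw (- 2) False 1)))"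
proof
  fix f
  have "lmon 0 (inverse k - k) = - \<kappa>" by (simp add: single_diff)
  moreover have "lmon 0 (- (q^2) * (k - inverse k)) = lmon 0 (- (q^2)) * \<kappa>" by (simp add: lmon_mult)
  ultimately show "(twisted (d_A k q I0) (wt 1) \<circ> T) f =
    op_add (pbw 0 True (- 1)) (op_add (op_scale (- (q^2)) (pbw (- 2) True (- 1))) (op_scale (- (q^2) * (k - inverse k)) (pbw (- 2) False 1))) f"
    unfolding twisted_wt1 op_add_def op_scale_def comp_apply
    by (simp only: pbw_def if_True if_False Yp_simps T_Yi Y_T single_one mult_1 T_sq) (simp add: algebra_simps Y_def)
qed

lemma twisted_one: "twisted 1 (wt 0) = id"
  unfolding one_weyl_def[symmetric] by (rule ext) (simp add: twisted_def mulop_def)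

lemma admissible_one: "admissible 1 (wt 0)"
  unfolding admissible_def twisted_one using id_span by simp

lemma admissible_wt1: "admissible (d_A k q I0) (wt 1)"
  unfolding admissible_def twisted_wt1 by (intro conjI d_A_nonzero pbw_span.intros)

lemma laurent_eval_one: "laurent_eval 1 z = 1"
  using laurent_eval_single[of 0 1 z] by (simp add: mconst_simps)

lemma laurent_eval_d: "laurent_eval (d_A k q I0) z = inverse K - K * (mconst q * inverse z)^2"
  by (simp add: d_A_def laurent_eval_minus lmon_mult mconst_simps power_int_minus power2_eq_square power_int_def
      power_mult_distrib ac_simps)

lemmas cr_simps = cr_add cr_scale cr_pbw pbw_span.intros vscale_def mconst_simps

text \<open>The columns of \<open>C_(1,0)\<close>, read off from the basis expansions by
  \<open>X \<mapsto> x\<close> on the left and \<open>Y \<mapsto> \<xi>\<close> on the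
  right.\<close>

lemma ncr_x:
  "ncr (d_A k q I0) (wt 1) 1 (wt 0) id = vscale (inverse (inverse K - K * (mconst q * inverse mx)^2))
     ((1 - (mconst q * inverse mx)^2) * mxi, (inverse K - K) * inverse mxi)"
  "ncr (d_A k q I0) (wt 1) 1 (wt 0) T = vscale (inverse (inverse K - K * (mconst q * inverse mx)^2))
     (- ((K - inverse K) * (mconst q * inverse mx)^2 * mxi), (1 - (mconst q * inverse mx)^2) * inverse mxi)"
  unfolding ncr_def twisted_one dual_gens laurent_eval_one laurent_eval_d comp_id twisted_wt1_T
  unfolding twisted_wt1
  by (simp_all add: cr_simps power_int_minus power2_eq_square power_int_def algebra_simps)

lemma dual_wt1:
  "dual (twisted (d_A k q I0) (wt 1)) =
    op_add (pbw (- 1) False 0) (op_add (op_scale (- (q^2)) (pbw (- 1) False 2)) (op_scale (inverse k - k) (pbw 1 True 0)))"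
  unfolding twisted_wt1 by (simp add: dual_add dual_scale dual_pbw pbw_span.intros)

text \<open>Duality fixes \<open>T\<close> and reverses products, so the expansion already found for
  the translation in \<open>x\<close> also yields the one for \<open>\<xi>\<close>.\<close>

lemma T_dual_wt1:
  "T \<circ> dual (twisted (d_A k q I0) (wt 1)) =
    op_add (pbw 1 True 0) (op_add (op_scale (- (q^2)) (pbw 1 True 2)) (op_scale (- (q^2) * (k - inverse k)) (pbw (- 1) False 2)))"
proof -
  have "twisted (d_A k q I0) (wt 1) \<in> algA" using admissible_wt1 unfolding admissible_def alg_eq_span by blast
  from dual_anti[OF this gens_span(2)]
  have "T \<circ> dual (twisted (d_A k q I0) (wt 1)) = dual (twisted (d_A k q I0) (wt 1) \<circ> T)"
    by (simp only: dual_gens)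
  then show ?thesis unfolding twisted_wt1_T by (simp add: dual_add dual_scale dual_pbw pbw_span.intros)
qed

lemma ncr_xi:
  "ncr 1 (wt 0) (d_A k q I0) (wt 1) id = vscale (inverse (inverse K - K * (mconst q * mxi)^2))
     ((1 - (mconst q * mxi)^2) * inverse mx, (inverse K - K) * inverse (inverse mx))"
  "ncr 1 (wt 0) (d_A k q I0) (wt 1) T = vscale (inverse (inverse K - K * (mconst q * mxi)^2))
     (- ((K - inverse K) * (mconst q * mxi)^2 * inverse mx), (1 - (mconst q * mxi)^2) * inverse (inverse mx))"
  unfolding ncr_def twisted_one laurent_eval_one laurent_eval_d id_comp T_dual_wt1
  unfolding dual_wt1
  by (simp_all add: cr_simps power_int_minus power2_eq_square power_int_def algebra_simps)

lemma qkz_relI: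
  assumes "vscale (fst g) (vscale (inverse (inverse K - K * t^2)) ((1 - t^2) * \<eta>, (inverse K - K) * inverse \<eta>))
      + vscale (snd g) (vscale (inverse (inverse K - K * t^2)) (- ((K - inverse K) * t^2 * \<eta>), (1 - t^2) * inverse \<eta>)) = f"
  shows "qkz_rel t \<eta> f g"
  unfolding qkz_rel_def assms[symmetric] vscale_def by (simp add: algebra_simps)

lemma qKZ_basic:
  assumes "f \<in> SOL_bqKZ_A k q"
  shows "qkz_rel (mconst q * inverse mx) mxi f (map_prod (mshift (inverse q) 1) (mshift (inverse q) 1) f)"
    and "qkz_rel (mconst q * mxi) (inverse mx) f (map_prod (mshift 1 q) (mshift 1 q) f)"
proof -
  have st: "step (daha_A k q) = q" by (simp add: daha_A_def)
  have *: "Cmat (daha_A k q) (daha_A k q) (wt l, wt m)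
      (map_prod (mshift (q powi (- l)) (q powi m)) (mshift (q powi (- l)) (q powi m)) f) = f" for l m
    using assms unfolding SOL_bqKZ_A_def bqKZ_solutions_def st by blast
  have p: "q powi (- 1) = inverse q" "q powi (- 0) = 1" "q powi 0 = 1" "q powi 1 = q" by (simp_all add: power_int_minus)
  show "qkz_rel (mconst q * inverse mx) mxi f (map_prod (mshift (inverse q) 1) (mshift (inverse q) 1) f)"
    by (rule qkz_relI) (rule *[of 1 0, unfolded Cmat_eq[OF standard_A dfac_ok_A admissible_wt1 admissible_one] ncr_x p])
  show "qkz_rel (mconst q * mxi) (inverse mx) f (map_prod (mshift 1 q) (mshift 1 q) f)"
    by (rule qkz_relI) (rule *[of 0 1, unfolded Cmat_eq[OF standard_A dfac_ok_A admissible_one admissible_wt1] ncr_xi p])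
qed

end

section \<open>The bispectral eigenvalue equations\<close>

lemma mshift_more:
  assumes "a \<noteq> 0" "b \<noteq> 0"
  shows "mshift a b (f - g) = mshift a b f - mshift a b g" "mshift a b 1 = 1" "mshift a b (f ^ n) = mshift a b f ^ n"
proof -
  note m = mshift_simps[OF assms]
  show "mshift a b (f - g) = mshift a b f - mshift a b g"
    using m(1)[of "f - g" g] by simp
  show 1: "mshift a b 1 = 1" using m(4)[of 1] by (simp add: mconst_simps)
  show "mshift a b (f ^ n) = mshift a b f ^ n" by (induction n) (simp_all add: 1 m(2))
qed

text \<open>With the weights \<open>K/\<eta>\<close> and \<open>\<eta>\<close> the coefficients of
  \<open>g0\<close> and \<open>g1\<close> become \<open>1/K - K t^2\<close> and \<open>K\<close>
  times it, which cancels the denominator.\<close>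

lemma qkz_first_order:
  fixes K t \<eta> f0 f1 g0 g1 :: "'a::field"
  assumes "f0 = inverse (inverse K - K * t^2) * (g0 * ((1 - t^2) * \<eta>) - g1 * ((K - inverse K) * t^2 * \<eta>))"
    and "f1 = inverse (inverse K - K * t^2) * (g0 * ((inverse K - K) * inverse \<eta>) + g1 * ((1 - t^2) * inverse \<eta>))"
    and "K \<noteq> 0" "\<eta> \<noteq> 0" "inverse K - K * t^2 \<noteq> 0"
  shows "K * inverse \<eta> * f0 + \<eta> * f1 = g0 + K * g1"
proof -
  define L where "L = inverse K"
  define \<theta> where "\<theta> = inverse \<eta>"
  define N where "N = inverse (L - K * t^2)"
  have r: "K * L = 1" "\<eta> * \<theta> = 1" "N * (L - K * t^2) = 1"
    using assms(3-5) by (simp_all add: L_def \<theta>_def N_def)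
  show ?thesis
    unfolding assms(1,2) L_def[symmetric] \<theta>_def[symmetric] N_def[symmetric] using r by algebra
qed

text \<open>\<open>G\<close> is chi of the solution shifted one way, known from the first order
  relation. The shift \<open>(h0, h1)\<close> the other way is given by the qKZ matrix at
  \<open>t = 1/y\<close>, so the combination is expressed through \<open>f0\<close> and
  \<open>f1\<close>.\<close>

lemma qkz_macdonald:
  fixes K t \<eta> f0 f1 h0 h1 G y :: "'a::field"
  assumes "h0 = inverse (inverse K - K * (inverse y)^2) * (f0 * ((1 - (inverse y)^2) * \<eta>) - f1 * ((K - inverse K) * (inverse y)^2 * \<eta>))"
    and "h1 = inverse (inverse K - K * (inverse y)^2) * (f0 * ((inverse K - K) * inverse \<eta>) + f1 * ((1 - (inverse y)^2) * inverse \<eta>))"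
    and "G = K * inverse \<eta> * f0 + \<eta> * f1"
    and "K \<noteq> 0" "\<eta> \<noteq> 0" "y \<noteq> 0" "inverse K - K * (inverse y)^2 \<noteq> 0" "1 - y^2 \<noteq> 0"
  shows "(K + inverse K - (K - inverse K * y^2) / (1 - y^2)) * G + (K - inverse K * y^2) / (1 - y^2) * (h0 + K * h1)
    = (\<eta> + inverse \<eta>) * (f0 + K * f1)"
proof -
  define L where "L = inverse K"
  define \<theta> where "\<theta> = inverse \<eta>"
  define z where "z = inverse y"
  define N where "N = inverse (L - K * z^2)"
  define M where "M = inverse (1 - y^2)"
  have r: "K * L = 1" "\<eta> * \<theta> = 1" "y * z = 1" "N * (L - K * z^2) = 1" "M * (1 - y^2) = 1"
    using assms(4-8) by (simp_all add: L_def \<theta>_def N_def M_def z_def)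
  \<comment> \<open>The numerator of the Macdonald coefficient is \<open>- y^2\<close> times the
    denominator of the qKZ matrix, so the new pole disappears.\<close>
  have c: "(K - L * y^2) * N = - (y^2)"
    using r(3,4) by algebra
  show ?thesis
    unfolding assms(1-3) divide_inverse L_def[symmetric] \<theta>_def[symmetric] N_def[symmetric] M_def[symmetric] z_def[symmetric]
    using r(1,2,3,5) c by algebra
qed

section \<open>The crossed product and the residues of Y + 1/Y\<close>

lemma wact2_hom:
  assumes "p \<noteq> 0"
  shows "wact2 p ww (f + g) = wact2 p ww f + wact2 p ww g" "wact2 p ww (mconst c) = mconst c"
    "wact2 p ww 0 = 0" "wact2 p ww 1 = 1"
proof -
  obtain l e m e' where ww: "ww = (Weyl l e, Weyl m e')" by (metis prod.exhaust weyl.exhaust)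
  have nz: "p powi (- l) \<noteq> 0" "p powi m \<noteq> 0" using assms by simp_all
  note h = msubst_hom[OF torus_auto_map[OF nz]]
  show "wact2 p ww (f + g) = wact2 p ww f + wact2 p ww g" unfolding ww wact2_torus_map by (rule h)
  show c: "wact2 p ww (mconst c) = mconst c" for c unfolding ww wact2_torus_map by (rule h)
  show "wact2 p ww 0 = 0" "wact2 p ww 1 = 1" using c[of 0] c[of 1] by (simp_all add: mconst_simps)
qed

lemma cp_times_add_left: "cp_times p (A + B) C = cp_times p A C + cp_times p B C"
  unfolding cp_times_def case_prod_beta prod.collapse
  by (rule setsum_keys_plus_distrib[of "\<lambda>v a. \<Sum>w\<in>Poly_Mapping.keys C.
        Poly_Mapping.single (fst v * fst w, snd v * snd w) (a * wact2 p v (Poly_Mapping.lookup C w))"])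
    (simp_all add: distrib_right single_add sum.distrib)

lemma cp_times_add_right:
  assumes "p \<noteq> 0" shows "cp_times p A (B + C) = cp_times p A B + cp_times p A C"
proof -
  have "(\<Sum>w\<in>Poly_Mapping.keys (B + C). Poly_Mapping.single (fst v * fst w, snd v * snd w) (a * wact2 p v (Poly_Mapping.lookup (B + C) w)))
    = (\<Sum>w\<in>Poly_Mapping.keys B. Poly_Mapping.single (fst v * fst w, snd v * snd w) (a * wact2 p v (Poly_Mapping.lookup B w)))
    + (\<Sum>w\<in>Poly_Mapping.keys C. Poly_Mapping.single (fst v * fst w, snd v * snd w) (a * wact2 p v (Poly_Mapping.lookup C w)))" for v a
    by (rule setsum_keys_plus_distrib[of "\<lambda>w b. Poly_Mapping.single (fst v * fst w, snd v * snd w) (a * wact2 p v b)"])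
      (simp_all add: wact2_hom[OF assms] distrib_left single_add)
  then show ?thesis
    unfolding cp_times_def case_prod_beta prod.collapse by (simp add: sum.distrib)
qed

lemma cp_times_single:
  assumes "p \<noteq> 0"
  shows "cp_times p (Poly_Mapping.single (v, v') a) (Poly_Mapping.single (w, w') b) =
    Poly_Mapping.single (v * w, v' * w') (a * wact2 p (v, v') b)"
  by (simp add: cp_times_def wact2_hom[OF assms])

lemma Res_add: "Res (A + B) = Res A + Res B"
  unfolding Res_def case_prod_beta prod.collapse
  by (rule setsum_keys_plus_distrib[of "\<lambda>w a. Poly_Mapping.single (wtrans (fst w), wtrans (snd w)) a"])
    (simp_all add: single_add)

lemma Res_single: "Res (Poly_Mapping.single (w, w') a) = Poly_Mapping.single (wtrans w, wtrans w') a"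
  by (simp add: Res_def)

lemma cp_apply_add: "cp_apply p (A + B) f = cp_apply p A f + cp_apply p B f"
  unfolding cp_apply_def
  by (rule setsum_keys_plus_distrib[of "\<lambda>w a. a * wact2 p w f"]) (simp_all add: distrib_right)

lemma cp_apply_single: "cp_apply p (Poly_Mapping.single w a) f = a * wact2 p w f"
  by (simp add: cp_apply_def)

lemma cp_T_inv_eq: "cp_T_inv k c s = Poly_Mapping.single s c + cp_const (mconst (inverse k) - c)"
  by (simp add: cp_T_inv_def cp_T_def cp_const_def mconst_simps single_diff[symmetric])

text \<open>\<open>Res\<close> identifies \<open>u s\<close> with \<open>u\<close>, so in
  \<open>U T\<close> the two terms with the transformed \<open>c\<close> cancel and leave the
  constant \<open>\<kappa>\<close>. The coefficients \<open>c\<close> and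
  \<open>1/\<kappa> - c\<close> come from \<open>T^(-1) U\<close>.\<close>

lemma macdonald_operator:
  assumes "p \<noteq> 0"
    and r: "wtrans (u * s) = wtrans u" "wtrans (u' * s') = wtrans u'"
  shows "cp_apply p (Res (cp_times p (Poly_Mapping.single (u, u') 1) (cp_T \<kappa> c (s, s'))
        + cp_times p (cp_T_inv \<kappa> c (s, s')) (Poly_Mapping.single (u, u') 1))) f =
    (mconst \<kappa> + mconst (inverse \<kappa>) - c) * wact2 p (wtrans u, wtrans u') f
      + c * wact2 p (wtrans (s * u), wtrans (s' * u')) f"
proof -
  have "wact2 p (u, u') c + wact2 p (u, u') (mconst \<kappa> - c) = mconst \<kappa>"
    unfolding wact2_hom(1)[OF assms(1), symmetric] by (simp add: wact2_hom[OF assms(1)])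
  then have e: "wact2 p (u, u') (mconst \<kappa> - c) = mconst \<kappa> - wact2 p (u, u') c"
    by (simp add: eq_diff_eq add.commute)
  show ?thesis
    unfolding cp_T_inv_eq cp_T_def cp_const_def cp_times_add_left cp_times_add_right[OF assms(1)]
      cp_times_single[OF assms(1)] Res_add Res_single cp_apply_add cp_apply_single r mult_1_right mult_1_left e
      wact2_hom(4)[OF assms(1)]
    by (simp add: algebra_simps)
qed

lemma L_x_A_apply:
  assumes "q \<noteq> 0" "k \<noteq> 0"
  shows "cp_apply q (L_x_A k q) f =
    (let c = (mconst k - inverse (mconst k) * mx^2) / (1 - mx^2) in
     (mconst k + inverse (mconst k) - c) * mshift (inverse q) 1 f + c * mshift q 1 f)"
proof -
  have w: "wact2 q (wtrans wu, wtrans 1) f = mshift (inverse q) 1 f" "wact2 q (wtrans (ws1 * wu), wtrans (1 * 1)) f = mshift q 1 f"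
    by (simp_all add: one_weyl_def wact2_translation power_int_minus del: wact2.simps)
  have c: "c_A (mx^2) (inverse k) = (mconst k - inverse (mconst k) * mx^2) / (1 - mx^2)"
    by (simp add: c_A_def mconst_simps)
  show ?thesis
    unfolding L_x_A_def Let_def
    by (subst macdonald_operator[OF assms(1)]) (simp_all only: w c, simp_all add: one_weyl_def mconst_simps add.commute)
qed

lemma L_xi_A_apply:
  assumes "q \<noteq> 0" "k \<noteq> 0"
  shows "cp_apply q (L_xi_A k q) f =
    (let c = (inverse (mconst k) - mconst k * mxi^2) / (1 - mxi^2) in
     (mconst k + inverse (mconst k) - c) * mshift 1 q f + c * mshift 1 (inverse q) f)"
proof -
  have w: "wact2 q (wtrans 1, wtrans wu) f = mshift 1 q f" "wact2 q (wtrans (1 * 1), wtrans (ws1 * wu)) f = mshift 1 (inverse q) f"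
    by (simp_all add: one_weyl_def wact2_translation power_int_minus del: wact2.simps)
  have c: "c_A (mxi^2) k = (inverse (mconst k) - mconst k * mxi^2) / (1 - mxi^2)"
    by (simp add: c_A_def mconst_simps)
  show ?thesis
    unfolding L_xi_A_def Let_def
    by (subst macdonald_operator[OF assms(1)]) (simp_all only: w c, simp_all add: one_weyl_def mconst_simps)
qed

lemma c_C_one: "k \<noteq> 0 \<Longrightarrow> c_C y k 1 = c_A (y^2) k"
proof -
  assume k: "k \<noteq> 0"
  then have "inverse (mconst k) * ((1 - mconst k * y) * (1 + mconst k * y)) = inverse (mconst k) - mconst k * y^2"
    by (simp add: field_simps power2_eq_square)
  then show ?thesis by (simp add: c_C_def c_A_def mconst_simps)
qed

lemma c_C_one_one: "1 - y^2 \<noteq> 0 \<Longrightarrow> c_C y 1 1 = 1"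
  by (simp add: c_C_one c_A_def mconst_simps)

lemma cp_T_one: "cp_T 1 1 s = Poly_Mapping.single s 1" "cp_T_inv 1 1 s = Poly_Mapping.single s 1"
  by (simp_all add: cp_T_inv_def cp_T_def cp_const_def mconst_simps)

text \<open>Once \<open>c_0\<close> is 1, the operator of \<open>s_0\<close> and its inverse are
  both the element \<open>s_0\<close>, which is the \<open>u\<close> of type A with step
  \<open>r^2\<close>. As division by zero gives 0, \<open>c_0 = 1\<close> requires
  \<open>1 - z \<noteq> 0\<close> in the field.\<close>

lemma SOL_bAW_eq:
  assumes "r \<noteq> 0" "k \<noteq> 0"
  shows "SOL_bAW k 1 1 1 r = SOL_bMR k (r^2)"
proof -
  have "1 - (mconst r * inverse mx)^2 \<noteq> 0"
    using two_term_nonzero(1)[of 1 "- 2" "r^2"]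
    by (simp add: mconst_simps power2_eq_square power_int_def ac_simps)
  then have 1: "c_C (mconst r * inverse mx) 1 1 = 1" by (rule c_C_one_one)
  have "1 - (mconst (inverse r) * inverse mxi)^2 \<noteq> 0"
    using two_term_nonzero(2)[of 1 2 "inverse r ^ 2"]
    by (simp add: mconst_simps power2_eq_square power_int_def ac_simps)
  then have 2: "c_C (mconst (inverse r) * inverse mxi) 1 1 = 1" by (rule c_C_one_one)
  have "L_x_C k 1 1 1 r = L_x_A k (r^2)"
    using 1 assms by (simp add: L_x_C_def L_x_A_def Let_def cp_T_one c_C_one inverse_eq_divide)
  moreover have "L_xi_C k 1 1 1 r = L_xi_A k (r^2)"
    using 2 assms by (simp add: L_xi_C_def L_xi_A_def Let_def cp_T_one c_C_one)
  ultimately show ?thesis unfolding SOL_bAW_def SOL_bMR_def by (simp only:)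
qed

section \<open>From qKZ solutions to the bispectral eigenvalue equations\<close>

context rank_one_daha
begin

lemma qkz_rel_shift:
  assumes "a \<noteq> 0" "b \<noteq> 0" "qkz_rel t \<eta> f g"
  shows "qkz_rel (mshift a b t) (mshift a b \<eta>) (map_prod (mshift a b) (mshift a b) f) (map_prod (mshift a b) (mshift a b) g)"
proof -
  note m = mshift_simps[OF assms(1,2)] mshift_more[OF assms(1,2)]
  from assms(3) show ?thesis unfolding qkz_rel_def by (simp add: m)
qed

lemma denominators_nonzero:
  "inverse K - K * (mconst q * inverse mx)^2 \<noteq> 0" "inverse K - K * (mconst q * mxi)^2 \<noteq> 0"
  "inverse K - K * (inverse mx)^2 \<noteq> 0" "inverse K - K * mxi^2 \<noteq> 0"
  "1 - mx^2 \<noteq> 0" "1 - (inverse mxi)^2 \<noteq> 0" "1 - mxi^2 \<noteq> 0" "1 - K^2 * (inverse mxi)^2 \<noteq> 0"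
proof -
  show "inverse K - K * (mconst q * inverse mx)^2 \<noteq> 0"
    using laurent_eval_mx_nonzero[OF d_A_nonzero, of I0] unfolding laurent_eval_d .
  show "inverse K - K * (mconst q * mxi)^2 \<noteq> 0"
    using laurent_eval_mxi_nonzero[OF d_A_nonzero, of I0] unfolding laurent_eval_d by simp
  have p: "z powi (- 2) = (inverse z)^2" "z powi 2 = z^2" for z :: mero by (simp_all add: power_int_def)
  show "inverse K - K * (inverse mx)^2 \<noteq> 0" "inverse K - K * mxi^2 \<noteq> 0"
    using two_term_nonzero[of "inverse k" "- 2" k] k0 unfolding p mconst_simps by simp_all
  show "1 - mx^2 \<noteq> 0" "1 - (inverse mxi)^2 \<noteq> 0" "1 - mxi^2 \<noteq> 0" "1 - K^2 * (inverse mxi)^2 \<noteq> 0"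
    using two_term_nonzero[of 1 2 1] two_term_nonzero(2)[of 1 "- 2" 1] two_term_nonzero(2)[of 1 2 "k^2"]
    unfolding p by (simp_all add: mconst_simps power2_eq_square)
qed

lemma K_nonzero: "K \<noteq> 0" using k0 by simp

lemma chi_shift: "a \<noteq> 0 \<Longrightarrow> b \<noteq> 0 \<Longrightarrow> mshift a b (chi_A k f) = mshift a b (fst f) + K * mshift a b (snd f)"
  by (simp add: chi_A_def mshift_simps)

lemma qKZ_first_order:
  assumes "f \<in> SOL_bqKZ_A k q"
  shows "K * inverse mxi * fst f + mxi * snd f = mshift (inverse q) 1 (chi_A k f)"
    and "K * inverse (inverse mx) * fst f + inverse mx * snd f = mshift 1 q (chi_A k f)"
proof -
  have q: "inverse q \<noteq> 0" "q \<noteq> 0" "(1::complex) \<noteq> 0" using q0 by simp_all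
  note rel = qKZ_basic[OF assms, unfolded qkz_rel_def fst_map_prod snd_map_prod]
  show "K * inverse mxi * fst f + mxi * snd f = mshift (inverse q) 1 (chi_A k f)"
    unfolding chi_shift[OF q(1,3)]
    by (rule qkz_first_order[OF conjunct1[OF rel(1)] conjunct2[OF rel(1)] K_nonzero mxi_nonzero denominators_nonzero(1)])
  have "inverse mx \<noteq> 0" by simp
  then show "K * inverse (inverse mx) * fst f + inverse mx * snd f = mshift 1 q (chi_A k f)"
    unfolding chi_shift[OF q(3,2)]
    by (rule qkz_first_order[OF conjunct1[OF rel(2)] conjunct2[OF rel(2)] K_nonzero _ denominators_nonzero(2)])
qed

text \<open>The functions chi(f) and chi(f)(x/q) are two linear combinations of the coordinates of
  \<open>f\<close>, with determinant \<open>\<xi> - K^2/\<xi> \<noteq> 0\<close>.\<close>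

lemma chi_A_inj: "inj_on (chi_A k) (SOL_bqKZ_A k q)"
proof
  fix f g assume f: "f \<in> SOL_bqKZ_A k q" and g: "g \<in> SOL_bqKZ_A k q" and e: "chi_A k f = chi_A k g"
  have 1: "K * inverse mxi * fst f + mxi * snd f = K * inverse mxi * fst g + mxi * snd g"
    using qKZ_first_order(1)[OF f] qKZ_first_order(1)[OF g] e by simp
  have 2: "fst f = fst g + K * snd g - K * snd f" using e by (simp add: chi_A_def eq_diff_eq)
  have "mxi * ((1 - K^2 * (inverse mxi)^2) * (snd f - snd g)) = 0"
  proof -
    have "mxi * inverse mxi = 1" by simp
    then show ?thesis using 1 2 by algebra
  qed
  then have "snd f = snd g" using denominators_nonzero(8) by simp
  with 2 show "f = g" by (simp add: prod_eq_iff)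
qed

lemma chi_A_SOL:
  assumes f: "f \<in> SOL_bqKZ_A k q"
  shows "chi_A k f \<in> SOL_bMR k q"
proof -
  have q: "inverse q \<noteq> 0" "q \<noteq> 0" "(1::complex) \<noteq> 0" using q0 by simp_all
  have inv: "map_prod (mshift a b) (mshift a b) (map_prod (mshift c d) (mshift c d) f) = f"
    if "a \<noteq> 0" "b \<noteq> 0" "c \<noteq> 0" "d \<noteq> 0" "c * a = 1" "d * b = 1" for a b c d
    using that by (cases f) (simp add: mshift_mshift)
  \<comment> \<open>Replacing \<open>x\<close> by \<open>q x\<close> turns \<open>t = q/x\<close>
    into \<open>1/x\<close> and expresses \<open>f(q x)\<close> through \<open>f\<close>: this is
    the second neighbour in the difference operator.\<close>
  have x: "qkz_rel (inverse mx) mxi (map_prod (mshift q 1) (mshift q 1) f) f"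
    using qkz_rel_shift[OF q(2,3) qKZ_basic(1)[OF f]] q0
    by (simp add: inv mshift_simps mconst_simps mult.assoc[symmetric])
  have xi: "qkz_rel mxi (inverse mx) (map_prod (mshift 1 (inverse q)) (mshift 1 (inverse q)) f) f"
    using qkz_rel_shift[OF q(3,1) qKZ_basic(2)[OF f]] q0
    by (simp add: inv mshift_simps mconst_simps mult.assoc[symmetric])
  note x = x[unfolded qkz_rel_def fst_map_prod snd_map_prod]
  note xi = xi[unfolded qkz_rel_def fst_map_prod snd_map_prod]
  have nz: "inverse mxi \<noteq> 0" "inverse mx \<noteq> 0" by simp_all
  have "cp_apply q (L_x_A k q) (chi_A k f) = (mxi + inverse mxi) * (fst f + K * snd f)"
    unfolding L_x_A_apply[OF q0 k0] Let_def chi_shift[OF q(2,3)]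
    by (rule qkz_macdonald[OF conjunct1[OF x] conjunct2[OF x] qKZ_first_order(1)[OF f, symmetric]
          K_nonzero mxi_nonzero mx_nonzero denominators_nonzero(3,5)])
  moreover have "cp_apply q (L_xi_A k q) (chi_A k f) = (inverse mx + inverse (inverse mx)) * (fst f + K * snd f)"
  proof -
    \<comment> \<open>In the direction of \<open>\<xi>\<close> the shifted relation has
      \<open>t = \<xi>\<close>, so \<open>y = 1/\<xi>\<close>. The coefficient takes the required
      shape after extending the fraction by \<open>- \<xi>^(-2)\<close>.\<close>
    have c: "(inverse K - K * mxi^2) / (1 - mxi^2) = (K - inverse K * (inverse mxi)^2) / (1 - (inverse mxi)^2)"
    proof -
      have "(K - inverse K * (inverse mxi)^2) = - ((inverse mxi)^2 * (inverse K - K * mxi^2))"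
        "1 - (inverse mxi)^2 = - ((inverse mxi)^2 * (1 - mxi^2))"
        by (simp_all add: right_diff_distrib power_inverse)
      then show ?thesis by simp
    qed
    show ?thesis
      unfolding L_xi_A_apply[OF q0 k0] Let_def chi_shift[OF q(3,1)] c
      by (rule qkz_macdonald[where y = "inverse mxi", unfolded inverse_inverse_eq[of mxi],
            OF conjunct1[OF xi] conjunct2[OF xi] qKZ_first_order(2)[OF f, symmetric]
            K_nonzero nz(2,1) denominators_nonzero(4,6)])
  qed
  ultimately show ?thesis
    unfolding SOL_bMR_def p1_def by (simp add: chi_A_def add.commute)
qed

end

theorem theorem3p1p2:
  fixes q :: real and r k :: complex
  assumes "0 < q" and "q < 1" and "r^2 = of_real q" and "k \<noteq> 0"
  shows "chi_C k \<in> SOL_bqKZ_C k 1 1 1 r \<rightarrow> SOL_bAW k 1 1 1 r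
       \<and> inj_on (chi_C k) (SOL_bqKZ_C k 1 1 1 r)
       \<and> chi_A k \<in> SOL_bqKZ_A k (of_real q) \<rightarrow> SOL_bMR k (of_real q)
       \<and> inj_on (chi_A k) (SOL_bqKZ_A k (of_real q))
       \<and> sp \<in> SOL_bqKZ_C k 1 1 1 r \<rightarrow> SOL_bqKZ_A k (of_real q)
       \<and> inj_on sp (SOL_bqKZ_C k 1 1 1 r)
       \<and> sp \<in> SOL_bAW k 1 1 1 r \<rightarrow> SOL_bMR k (of_real q)
       \<and> inj_on sp (SOL_bAW k 1 1 1 r)
       \<and> (\<forall>f \<in> SOL_bqKZ_C k 1 1 1 r. chi_A k (sp f) = sp (chi_C k f))"
proof -
  interpret rank_one_daha "of_real q" k
  proof
    show "(complex_of_real q) ^ n \<noteq> 1" if "n > 0" for n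
    proof
      assume "(complex_of_real q) ^ n = 1"
      then have "q ^ n = 1" by (metis of_real_1 of_real_eq_iff of_real_power)
      then show False using power_less_one_iff[of q n] assms(1,2) that by simp
    qed
  qed (use assms in auto)
  have "r \<noteq> 0" using assms(1,3) by auto
  \<comment> \<open>The argument of type A is the step of the translations, which is
    \<open>r^2\<close> in type C; so \<open>r^2 = q\<close> makes both types use the same
    shifts.\<close>
  then have W: "SOL_bAW k 1 1 1 r = SOL_bMR k (of_real q)"
    using SOL_bAW_eq[of r k] assms(3,4) by simp
  have "chi_C k = chi_A k" by (rule ext) (simp add: chi_C_def chi_A_def)
  then show ?thesis
    unfolding W SOL_bqKZ_eq[OF assms(3)] using chi_A_inj chi_A_SOL
    by (auto simp: sp_def inj_on_def)
qed

end
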